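(* Let $A$ be a zero-one matrix indexed by a countable set of states $S$ and $M$ a zero-one matrix indexed by $S_0\subset S$ such that $M$ is irreducible, $M(ij)=1$ implies $A(ij)=1$, and $X_M$ has at least one periodic point. Let $\varphi:X_A\to\mathbb R$ be a summable function with $[\varphi]_2<\infty$. Choose any nonempty $U\subset S_0$ with $U\ne S_0$ and let $V=S_0\setminus U$. Then $\mathcal L_{M,\varphi}[U,V,\lambda]:F_b(X)\to F_b(X)$ has a spectral gap at $\lambda$, where $\lambda$ is the spectral radius of $\mathcal L_{M,\varphi}$.
   Context: $X=X_A=\{\omega\in\prod_{n\ge0}S:A(\omega_n\omega_{n+1})=1\ \forall n\}$ with the product topology and the shift $\sigma$; $X_M=\{\omega\in\prod_{n\ge0}S_0:M(\omega_n\omega_{n+1})=1\ \forall n\}\subset X$; $M$ is irreducible if for all $a,b\in S_0$ there is an $M$-admissible word (consecutive letters $ij$ satisfy $M(ij)=1$) starting at $a$ and ending at $b$. $[s]=\{\omega\in X:\omega_0=s\}$; $\varphi$ is summable if $\sum_{s:[s]\ne\emptyset}\exp(\sup_{[s]}\varphi)<\infty$. Fix $\theta\in(0,1)$, $d_\theta(\omega,\upsilon)=\theta^{\min\{n:\omega_n\neq\upsilon_n\}}$ for $\omega\ne\upsilon$; $[f]_k=\sup\{|f(\omega)-f(\upsilon)|/d_\theta(\omega,\upsilon):\omega\neq\upsilon,\ \omega_0\cdots\omega_{k-1}=\upsilon_0\cdots\upsilon_{k-1}\}$. $F_b(X)$ is the Banach space of continuous $f:X\to\mathbb C$ with $\|f\|_\infty+[f]_1<\infty$.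 The transfer operator is $\mathcal L_{M,\varphi}f(\omega)=\sum_{a\in S:M(a\omega_0)=1}e^{\varphi(a\cdot\omega)}f(a\cdot\omega)$, with $M(ij)=0$ if $i\notin S_0$ or $j\notin S_0$. For $U\subset S$, $\chi_U$ is the indicator of $\{\omega\in X:\omega_0\in U\}$. For a bounded operator $\mathcal M$ on $F_b(X)$, $\mathcal M_{U_1U_2}f=\chi_{U_1}\mathcal M(\chi_{U_2}f)$ and, for $\lambda$ in the resolvent set of $\mathcal M_{VV}$, $\mathcal M[U,V,\lambda]=\mathcal M_{UU}+\mathcal M_{UV}(\lambda\mathcal I-\mathcal M_{VV})^{-1}\mathcal M_{VU}$. An operator has a spectral gap at $\lambda$ if $\lambda$ is a simple eigenvalue of the operator and an isolated point of its spectrum. *)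

theory Defs
  imports "HOL-Analysis.Analysis"
begin

section \<open>Markov shifts\<close>

definition zero_one_matrix :: "'s set \<Rightarrow> ('s \<Rightarrow> 's \<Rightarrow> nat) \<Rightarrow> bool" where
  "zero_one_matrix S A \<longleftrightarrow> (\<forall>i\<in>S. \<forall>j\<in>S. A i j = 0 \<or> A i j = 1)"

definition markov_shift :: "'s set \<Rightarrow> ('s \<Rightarrow> 's \<Rightarrow> nat) \<Rightarrow> (nat \<Rightarrow> 's) set" where
  "markov_shift S A = {\<omega>. (\<forall>n. \<omega> n \<in> S) \<and> (\<forall>n. A (\<omega> n) (\<omega> (Suc n)) = 1)}"

definition shift_topology :: "'s set \<Rightarrow> ('s \<Rightarrow> 's \<Rightarrow> nat) \<Rightarrow> (nat \<Rightarrow> 's) topology" where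
  "shift_topology S A =
     subtopology (product_topology (\<lambda>_. discrete_topology S) UNIV) (markov_shift S A)"

definition shift :: "(nat \<Rightarrow> 's) \<Rightarrow> nat \<Rightarrow> 's" where
  "shift \<omega> = (\<lambda>n. \<omega> (Suc n))"

definition periodic_point :: "(nat \<Rightarrow> 's) \<Rightarrow> bool" where
  "periodic_point \<omega> \<longleftrightarrow> (\<exists>p\<ge>1. (shift ^^ p) \<omega> = \<omega>)"

definition admissible_word :: "'s set \<Rightarrow> ('s \<Rightarrow> 's \<Rightarrow> nat) \<Rightarrow> 's list \<Rightarrow> bool" where
  "admissible_word S0 M w \<longleftrightarrow>
     w \<noteq> [] \<and> set w \<subseteq> S0 \<and> successively (\<lambda>i j. M i j = 1) w"

text \<open>One-letter words are admissible, so the \<open>1 \<times> 1\<close> zero matrix counts as irreducible.\<close>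

definition irreducible_matrix :: "'s set \<Rightarrow> ('s \<Rightarrow> 's \<Rightarrow> nat) \<Rightarrow> bool" where
  "irreducible_matrix S0 M \<longleftrightarrow>
     (\<forall>a\<in>S0. \<forall>b\<in>S0. \<exists>w. admissible_word S0 M w \<and> hd w = a \<and> last w = b)"

definition cylinder :: "(nat \<Rightarrow> 's) set \<Rightarrow> 's \<Rightarrow> (nat \<Rightarrow> 's) set" where
  "cylinder X s = {\<omega>\<in>X. \<omega> 0 = s}"

text \<open>The boundedness requirement expresses that no supremum over a cylinder is \<open>+\<infinity>\<close>.\<close>

definition summable_potential ::
  "'s set \<Rightarrow> (nat \<Rightarrow> 's) set \<Rightarrow> ((nat \<Rightarrow> 's) \<Rightarrow> real) \<Rightarrow> bool" where
  "summable_potential S X \<phi> \<longleftrightarrow>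
     (\<forall>s\<in>S. bdd_above (\<phi> ` cylinder X s)) \<and>
     (\<lambda>s. exp (SUP \<omega>\<in>cylinder X s. \<phi> \<omega>)) summable_on {s\<in>S. cylinder X s \<noteq> {}}"

section \<open>Locally Lipschitz functions\<close>

definition d_theta :: "real \<Rightarrow> (nat \<Rightarrow> 's) \<Rightarrow> (nat \<Rightarrow> 's) \<Rightarrow> real" where
  "d_theta \<theta> \<omega> \<upsilon> = (if \<omega> = \<upsilon> then 0 else \<theta> ^ (LEAST n. \<omega> n \<noteq> \<upsilon> n))"

definition lip_seminorm ::
  "real \<Rightarrow> (nat \<Rightarrow> 's) set \<Rightarrow> nat \<Rightarrow> ((nat \<Rightarrow> 's) \<Rightarrow> 'b::real_normed_vector) \<Rightarrow> ennreal" where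
  "lip_seminorm \<theta> X k f =
     (SUP (\<omega>, \<upsilon>) \<in> {(\<omega>, \<upsilon>). \<omega> \<in> X \<and> \<upsilon> \<in> X \<and> \<omega> \<noteq> \<upsilon> \<and> (\<forall>i<k. \<omega> i = \<upsilon> i)}.
        ennreal (norm (f \<omega> - f \<upsilon>) / d_theta \<theta> \<omega> \<upsilon>))"

definition sup_norm ::
  "(nat \<Rightarrow> 's) set \<Rightarrow> ((nat \<Rightarrow> 's) \<Rightarrow> 'b::real_normed_vector) \<Rightarrow> ennreal" where
  "sup_norm X f = (SUP \<omega>\<in>X. ennreal (norm (f \<omega>)))"

text \<open>A function on \<open>X\<close> is represented by its extension by zero to all sequences, so that
  equality of functions on \<open>X\<close> is equality in HOL and the pointwise operations are available.\<close>

definition Fb :: "real \<Rightarrow> 's set \<Rightarrow> ('s \<Rightarrow> 's \<Rightarrow> nat) \<Rightarrow> ((nat \<Rightarrow> 's) \<Rightarrow> complex) set" where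
  "Fb \<theta> S A = {f. continuous_map (shift_topology S A) euclidean f \<and>
     (\<forall>\<omega>. \<omega> \<notin> markov_shift S A \<longrightarrow> f \<omega> = 0) \<and>
     sup_norm (markov_shift S A) f + lip_seminorm \<theta> (markov_shift S A) 1 f < \<infinity>}"

definition Fb_norm ::
  "real \<Rightarrow> 's set \<Rightarrow> ('s \<Rightarrow> 's \<Rightarrow> nat) \<Rightarrow> ((nat \<Rightarrow> 's) \<Rightarrow> complex) \<Rightarrow> real" where
  "Fb_norm \<theta> S A f =
     enn2real (sup_norm (markov_shift S A) f + lip_seminorm \<theta> (markov_shift S A) 1 f)"

section \<open>Spectral theory on a normed space of functions\<close>

text \<open>Since \<open>Fb\<close> depends on term parameters, it is a set and not a type. Below, \<open>W\<close> is (the carrier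
  of) a complex vector space of functions under pointwise operations and \<open>N\<close> is its norm;
  operators matter only through their values on \<open>W\<close>.\<close>

type_synonym 'x operator = "('x \<Rightarrow> complex) \<Rightarrow> ('x \<Rightarrow> complex)"

definition bounded_operator ::
  "('x \<Rightarrow> complex) set \<Rightarrow> (('x \<Rightarrow> complex) \<Rightarrow> real) \<Rightarrow> 'x operator \<Rightarrow> bool" where
  "bounded_operator W N T \<longleftrightarrow>
     (\<forall>f\<in>W. T f \<in> W) \<and>
     (\<forall>f\<in>W. \<forall>g\<in>W. T (\<lambda>x. f x + g x) = (\<lambda>x. T f x + T g x)) \<and>
     (\<forall>c. \<forall>f\<in>W. T (\<lambda>x. c * f x) = (\<lambda>x. c * T f x)) \<and>
     (\<exists>C. \<forall>f\<in>W. N (T f) \<le> C * N f)"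

definition scalar_minus :: "complex \<Rightarrow> 'x operator \<Rightarrow> 'x operator" where
  "scalar_minus z T = (\<lambda>f x. z * f x - T f x)"

definition resolvent_set ::
  "('x \<Rightarrow> complex) set \<Rightarrow> (('x \<Rightarrow> complex) \<Rightarrow> real) \<Rightarrow> 'x operator \<Rightarrow> complex set" where
  "resolvent_set W N T = {z. \<exists>R. bounded_operator W N R \<and>
     (\<forall>f\<in>W. R (scalar_minus z T f) = f \<and> scalar_minus z T (R f) = f)}"

definition resolvent :: "('x \<Rightarrow> complex) set \<Rightarrow> 'x operator \<Rightarrow> complex \<Rightarrow> 'x operator" where
  "resolvent W T z = the_inv_into W (scalar_minus z T)"

definition spectrum ::
  "('x \<Rightarrow> complex) set \<Rightarrow> (('x \<Rightarrow> complex) \<Rightarrow> real) \<Rightarrow> 'x operator \<Rightarrow> complex set" where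
  "spectrum W N T = - resolvent_set W N T"

definition spectral_radius ::
  "('x \<Rightarrow> complex) set \<Rightarrow> (('x \<Rightarrow> complex) \<Rightarrow> real) \<Rightarrow> 'x operator \<Rightarrow> real" where
  "spectral_radius W N T = (SUP z\<in>spectrum W N T. cmod z)"

definition generalized_eigenspace ::
  "('x \<Rightarrow> complex) set \<Rightarrow> 'x operator \<Rightarrow> complex \<Rightarrow> ('x \<Rightarrow> complex) set" where
  "generalized_eigenspace W T z = {f\<in>W. \<exists>n. (scalar_minus z T ^^ n) f = (\<lambda>_. 0)}"

text \<open>Simplicity is algebraic: the generalized eigenspace is one-dimensional.\<close>

definition simple_eigenvalue ::
  "('x \<Rightarrow> complex) set \<Rightarrow> 'x operator \<Rightarrow> complex \<Rightarrow> bool" where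
  "simple_eigenvalue W T z \<longleftrightarrow>
     (\<exists>h\<in>W. h \<noteq> (\<lambda>_. 0) \<and> T h = (\<lambda>x. z * h x) \<and>
        generalized_eigenspace W T z = {(\<lambda>x. c * h x) |c. True})"

definition spectral_gap ::
  "('x \<Rightarrow> complex) set \<Rightarrow> (('x \<Rightarrow> complex) \<Rightarrow> real) \<Rightarrow> 'x operator \<Rightarrow> complex \<Rightarrow> bool" where
  "spectral_gap W N T z \<longleftrightarrow> simple_eigenvalue W T z \<and> z isolated_in spectrum W N T"

section \<open>Transfer operators and their induced operators\<close>

definition zero_extend :: "'s set \<Rightarrow> ('s \<Rightarrow> 's \<Rightarrow> nat) \<Rightarrow> 's \<Rightarrow> 's \<Rightarrow> nat" where
  "zero_extend S0 M i j = (if i \<in> S0 \<and> j \<in> S0 then M i j else 0)"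

text \<open>Here \<open>case_nat a \<omega>\<close> is the concatenation \<open>a \<cdot> \<omega>\<close>. For \<open>f\<close> in \<open>Fb\<close> and summable \<open>\<phi>\<close> the
  series converges absolutely, so the unordered sum is the usual one.\<close>

definition transfer_operator ::
  "'s set \<Rightarrow> ('s \<Rightarrow> 's \<Rightarrow> nat) \<Rightarrow> 's set \<Rightarrow> ('s \<Rightarrow> 's \<Rightarrow> nat) \<Rightarrow> ((nat \<Rightarrow> 's) \<Rightarrow> real) \<Rightarrow>
     (nat \<Rightarrow> 's) operator" where
  "transfer_operator S A S0 M \<phi> f \<omega> =
     (if \<omega> \<in> markov_shift S A
      then \<Sum>\<^sub>\<infinity>a\<in>{a\<in>S. zero_extend S0 M a (\<omega> 0) = 1}.
             of_real (exp (\<phi> (case_nat a \<omega>))) * f (case_nat a \<omega>)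
      else 0)"

definition chi :: "(nat \<Rightarrow> 's) set \<Rightarrow> 's set \<Rightarrow> (nat \<Rightarrow> 's) \<Rightarrow> complex" where
  "chi X U = indicator {\<omega>\<in>X. \<omega> 0 \<in> U}"

definition block ::
  "(nat \<Rightarrow> 's) set \<Rightarrow> (nat \<Rightarrow> 's) operator \<Rightarrow> 's set \<Rightarrow> 's set \<Rightarrow> (nat \<Rightarrow> 's) operator" where
  "block X T U1 U2 f = (\<lambda>\<omega>. chi X U1 \<omega> * T (\<lambda>\<upsilon>. chi X U2 \<upsilon> * f \<upsilon>) \<omega>)"

definition induced_operator ::
  "((nat \<Rightarrow> 's) \<Rightarrow> complex) set \<Rightarrow> (nat \<Rightarrow> 's) set \<Rightarrow> (nat \<Rightarrow> 's) operator \<Rightarrow>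
     's set \<Rightarrow> 's set \<Rightarrow> complex \<Rightarrow> (nat \<Rightarrow> 's) operator" where
  "induced_operator W X T U V z f =
     (\<lambda>\<omega>. block X T U U f \<omega> + block X T U V (resolvent W (block X T V V) z (block X T V U f)) \<omega>)"

end

theory Submission
  imports Defs
begin

text \<open>
  Let \<open>\<Lambda>\<close> be the exponential growth rate of \<open>sup (L\<^sup>n 1)\<close>. A Lasota--Yorke inequality makes \<open>z - L\<close>
  invertible for \<open>|z| > \<Lambda>\<close>, and normalised resolvents \<open>(t - L)\<^sup>-\<^sup>1 1\<close> accumulate, as \<open>t\<close> decreases
  to \<open>\<Lambda>\<close>, at an eigenfunction \<open>h\<close> that is positive on the states in \<open>S0\<close>; so \<open>\<Lambda>\<close> is the spectral
  radius. No eigenmeasure is used: a minimum principle says that a supersolution \<open>L g \<le> \<Lambda> g\<close>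
  dominates some multiple \<open>c h\<close> with equality on \<open>X\<^sub>M\<close>. It shows that the eigenvalue \<open>\<Lambda>\<close> of \<open>L\<close> is
  simple and that \<open>\<Lambda> - L\<^sub>V\<^sub>V\<close> and \<open>\<Lambda> - L + u \<otimes> \<delta>\<^sub>w\<close>, where \<open>u = \<chi>\<^sub>U h\<close> and \<open>w\<close> is a point of \<open>X\<^sub>M\<close>
  starting in \<open>U\<close>, are injective. Injectivity implies invertibility: an approximate null sequence has
  a pointwise limit, which by the Lasota--Yorke inequality is nonzero, so the operators are bounded
  below, and they are endpoints of rays of invertible operators. The Schur complement turns these
  facts into the simplicity of \<open>\<Lambda>\<close> for the induced operator \<open>J\<close> and the invertibility of
  \<open>z - J + u \<otimes> \<delta>\<^sub>w\<close> for \<open>z\<close> near \<open>\<Lambda>\<close>, and \<open>z - J\<close> differs from this by a rank-one operator that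
  destroys invertibility only at \<open>z = \<Lambda>\<close>.
\<close>

section \<open>Resolvents on a Banach space of functions\<close>

text \<open>With infinitely many letters neither \<open>X\<close> nor its cylinders need be compact,
  so uniform limits and attained minima are not at hand. Summability of \<open>\<phi>\<close>
  replaces compactness: outside a finite set of letters the weights \<open>p\<close> have an
  arbitrarily small sum, which reduces limits of \<open>T\<close> and sign arguments to finitely
  many letters. The choice of \<open>u\<close> and \<open>w\<close> meets several demands.
  \<open>u\<close> turns out to be the eigenvector of \<open>J\<close> at \<open>\<Lambda>\<close>,
  so subtracting \<open>u \<otimes> \<delta>\<^sub>w\<close> moves this eigenvalue to
  \<open>\<Lambda> - h w\<close>, and the resolvent of the modified operator is explicit at
  \<open>u\<close>. \<open>u\<close> is nonnegative, which keeps the real points beyond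
  \<open>\<Lambda>\<close> in the resolvent set. \<open>w\<close> starts in \<open>U\<close>, so
  evaluation at \<open>w\<close> sees only the \<open>U\<close>-component and the perturbation
  passes through the Schur complement. \<open>w\<close> lies in \<open>XM\<close>, where the minimum
  principle gives equality. \<open>J\<close> is built once, from the inverse of
  \<open>\<Lambda> - L\<^sub>V\<^sub>V\<close>; in \<open>z - J\<close> only the scalar moves, so no
  dependence of the induced operator on \<open>z\<close> has to be studied.\<close>

locale banach_fun =
  fixes W :: "('x \<Rightarrow> complex) set" and N :: "('x \<Rightarrow> complex) \<Rightarrow> real"
  assumes zero_mem: "(\<lambda>_. 0) \<in> W"
    and add_mem: "f \<in> W \<Longrightarrow> g \<in> W \<Longrightarrow> (\<lambda>x. f x + g x) \<in> W"
    and scale_mem: "f \<in> W \<Longrightarrow> (\<lambda>x. c * f x) \<in> W"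
    and N_add: "f \<in> W \<Longrightarrow> g \<in> W \<Longrightarrow> N (\<lambda>x. f x + g x) \<le> N f + N g"
    and N_scale: "f \<in> W \<Longrightarrow> N (\<lambda>x. c * f x) = cmod c * N f"
    and pointwise_le: "f \<in> W \<Longrightarrow> cmod (f x) \<le> N f"
    and complete: "(\<And>n. F n \<in> W) \<Longrightarrow> summable (\<lambda>n. N (F n)) \<Longrightarrow>
      (\<lambda>x. \<Sum>n. F n x) \<in> W \<and> N (\<lambda>x. \<Sum>n. F n x) \<le> (\<Sum>n. N (F n))"
begin

section \<open>Norm estimates and the algebra of bounded operators\<close>

lemma N_nonneg: "f \<in> W \<Longrightarrow> 0 \<le> N f"
  using pointwise_le[of f] norm_ge_zero order_trans by blast

lemma N_zero: "N (\<lambda>_. 0) = 0"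
  using N_scale[OF zero_mem, of 0] by simp

lemma minus_mem: "f \<in> W \<Longrightarrow> (\<lambda>x. - f x) \<in> W"
  using scale_mem[of f "-1"] by simp

lemma diff_mem: "f \<in> W \<Longrightarrow> g \<in> W \<Longrightarrow> (\<lambda>x. f x - g x) \<in> W"
  using add_mem[OF _ minus_mem, of f g] by simp

lemma N_minus: "f \<in> W \<Longrightarrow> N (\<lambda>x. - f x) = N f"
  using N_scale[of f "-1"] by simp

lemma N_diff: "f \<in> W \<Longrightarrow> g \<in> W \<Longrightarrow> N (\<lambda>x. f x - g x) \<le> N f + N g"
  using N_add[OF _ minus_mem, of f g] by (simp add: N_minus)

abbreviation bop :: "'x operator \<Rightarrow> bool" where "bop \<equiv> bounded_operator W N"

lemma bop_mem: "bop T \<Longrightarrow> f \<in> W \<Longrightarrow> T f \<in> W"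
  and bop_add: "bop T \<Longrightarrow> f \<in> W \<Longrightarrow> g \<in> W \<Longrightarrow> T (\<lambda>x. f x + g x) = (\<lambda>x. T f x + T g x)"
  and bop_scale: "bop T \<Longrightarrow> f \<in> W \<Longrightarrow> T (\<lambda>x. c * f x) = (\<lambda>x. c * T f x)"
  by (auto simp: bounded_operator_def)

lemma bop_diff:
  assumes "bop T" "f \<in> W" "g \<in> W"
  shows "T (\<lambda>x. f x - g x) = (\<lambda>x. T f x - T g x)"
  using bop_add[OF assms(1,2) scale_mem[OF assms(3)], of "-1"] bop_scale[OF assms(1,3), of "-1"]
  by simp

lemma bop_zero: "bop T \<Longrightarrow> T (\<lambda>_. 0) = (\<lambda>_. 0)"
  using bop_scale[OF _ zero_mem, of T 0] by simp

lemma bop_bound: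
  assumes "bop T"
  obtains C where "0 < C" "\<And>f. f \<in> W \<Longrightarrow> N (T f) \<le> C * N f"
proof -
  obtain C where C: "\<And>f. f \<in> W \<Longrightarrow> N (T f) \<le> C * N f"
    using assms unfolding bounded_operator_def by blast
  have "N (T f) \<le> (\<bar>C\<bar> + 1) * N f" if "f \<in> W" for f
    using C[OF that] N_nonneg[OF that] mult_right_mono[of C "\<bar>C\<bar> + 1" "N f"] by linarith
  then show thesis using that[of "\<bar>C\<bar> + 1"] by auto
qed

lemma bopI:
  assumes "\<And>f. f \<in> W \<Longrightarrow> T f \<in> W"
    "\<And>f g x. f \<in> W \<Longrightarrow> g \<in> W \<Longrightarrow> T (\<lambda>x. f x + g x) x = T f x + T g x"
    "\<And>c f x. f \<in> W \<Longrightarrow> T (\<lambda>x. c * f x) x = c * T f x"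
    "\<And>f. f \<in> W \<Longrightarrow> N (T f) \<le> C * N f"
  shows "bop T"
  unfolding bounded_operator_def using assms(1,2,3)
  by (intro conjI exI[of _ C] ballI assms(4)) (auto simp: fun_eq_iff)

lemma bop_cong:
  assumes "bop T" "\<And>f. f \<in> W \<Longrightarrow> T' f = T f"
  shows "bop T'"
proof -
  obtain C where C: "0 < C" "\<And>f. f \<in> W \<Longrightarrow> N (T f) \<le> C * N f"
    using bop_bound[OF assms(1)] by blast
  show ?thesis
    by (rule bopI[of _ C])
       (simp_all add: assms C bop_mem[OF assms(1)] bop_add[OF assms(1)] bop_scale[OF assms(1)]
          add_mem scale_mem)
qed

lemma bop_id: "bop (\<lambda>f. f)"
  by (rule bopI[of _ 1]) auto

lemma bop_comp:
  assumes T: "bop T" and T': "bop T'"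
  shows "bop (\<lambda>f. T (T' f))"
proof -
  obtain C where C: "0 < C" "\<And>f. f \<in> W \<Longrightarrow> N (T f) \<le> C * N f" using bop_bound[OF T] by blast
  obtain D where D: "0 < D" "\<And>f. f \<in> W \<Longrightarrow> N (T' f) \<le> D * N f" using bop_bound[OF T'] by blast
  have "N (T (T' f)) \<le> (C * D) * N f" if "f \<in> W" for f
  proof -
    have "C * N (T' f) \<le> C * (D * N f)" using C(1) D(2)[OF that] by (intro mult_left_mono) auto
    then show ?thesis using C(2)[OF bop_mem[OF T' that]] by (simp add: mult.assoc)
  qed
  then show ?thesis
    by (intro bopI[of _ "C * D"])
       (simp_all add: bop_mem[OF T] bop_mem[OF T'] bop_add[OF T] bop_add[OF T']
          bop_scale[OF T] bop_scale[OF T'])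
qed

lemma bop_plus:
  assumes T: "bop T" and T': "bop T'"
  shows "bop (\<lambda>f x. T f x + T' f x)"
proof -
  obtain C where C: "0 < C" "\<And>f. f \<in> W \<Longrightarrow> N (T f) \<le> C * N f" using bop_bound[OF T] by blast
  obtain D where D: "0 < D" "\<And>f. f \<in> W \<Longrightarrow> N (T' f) \<le> D * N f" using bop_bound[OF T'] by blast
  have "N (\<lambda>x. T f x + T' f x) \<le> (C + D) * N f" if "f \<in> W" for f
    using N_add[OF bop_mem[OF T that] bop_mem[OF T' that]] C(2)[OF that] D(2)[OF that]
    by (simp add: algebra_simps)
  then show ?thesis
    by (intro bopI[of _ "C + D"])
       (simp_all add: bop_mem[OF T] bop_mem[OF T'] bop_add[OF T] bop_add[OF T']
          bop_scale[OF T] bop_scale[OF T'] add_mem algebra_simps)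
qed

lemma bop_cmult:
  assumes T: "bop T"
  shows "bop (\<lambda>f x. c * T f x)"
proof -
  have "bop (\<lambda>f x. c * f x)"
    by (rule bopI[of _ "cmod c"]) (auto simp: scale_mem N_scale algebra_simps)
  from bop_comp[OF this T] show ?thesis .
qed

lemma bop_minus:
  assumes T: "bop T" and T': "bop T'"
  shows "bop (\<lambda>f x. T f x - T' f x)"
  using bop_plus[OF T bop_cmult[OF T', of "-1"]] by simp

lemma bop_scalar_minus: "bop T \<Longrightarrow> bop (scalar_minus z T)"
  using bop_minus[OF bop_cmult[OF bop_id] , of T z] by (simp add: scalar_minus_def)

text \<open>Point evaluation is continuous because \<open>N\<close> dominates all values; these are
  the operators \<open>u \<otimes> \<delta>\<^sub>w\<close>.\<close>

lemma bop_rank_one: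
  assumes "u \<in> W"
  shows "bop (\<lambda>f x. f w * u x)"
proof -
  have "N (\<lambda>x. f w * u x) \<le> N u * N f" if "f \<in> W" for f
    using N_scale[OF assms, of "f w"] mult_right_mono[OF pointwise_le[OF that, of w] N_nonneg[OF assms]]
    by (simp add: mult.commute)
  then show ?thesis
    by (intro bopI[of _ "N u"]) (simp_all add: scale_mem assms algebra_simps)
qed

text \<open>The axiom \<open>complete\<close> identifies the sum of an absolutely convergent series
  with its pointwise sum. The remainder after \<open>m\<close> terms is again such a series, with
  norm at most the tail of the norms, so its image under \<open>T\<close> tends to zero.\<close>

lemma bop_suminf:
  assumes T: "bop T" and f: "\<And>n. f n \<in> W" "summable (\<lambda>n. N (f n))"
  shows "(\<lambda>n. T (f n) x) sums T (\<lambda>x. \<Sum>n. f n x) x"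
proof -
  obtain C where C: "0 < C" "\<And>f. f \<in> W \<Longrightarrow> N (T f) \<le> C * N f" using bop_bound[OF T] by blast
  define F where "F = (\<lambda>x. \<Sum>n. f n x)"
  define tail where "tail m = (\<lambda>x. \<Sum>n. f (n + m) x)" for m
  have sm: "summable (\<lambda>n. N (f (n + m)))" for m
    using f(2) by (rule summable_ignore_initial_segment)
  have tail: "tail m \<in> W" "N (tail m) \<le> (\<Sum>n. N (f (n + m)))" for m
    using complete[of "\<lambda>n. f (n + m)", OF f(1) sm] by (auto simp: tail_def)
  have ptsum: "summable (\<lambda>n. f n x)" for x
    by (rule summable_comparison_test[OF _ f(2)]) (use pointwise_le[OF f(1)] in auto)
  have step: "T F x - (\<Sum>n<m. T (f n) x) = T (tail m) x" for m
  proof (induction m)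
    case 0
    show ?case by (simp add: F_def tail_def)
  next
    case (Suc m)
    have "tail m = (\<lambda>x. f m x + tail (Suc m) x)"
      unfolding tail_def using suminf_split_head[OF summable_ignore_initial_segment[OF ptsum, of m]]
      by (auto simp: fun_eq_iff algebra_simps)
    then have "T (tail m) x = T (f m) x + T (tail (Suc m)) x"
      using bop_add[OF T f(1)[of m] tail(1)[of "Suc m"]] by simp
    then have "T (tail (Suc m)) x = T (tail m) x - T (f m) x" by simp
    then show ?case unfolding Suc[symmetric] by simp
  qed
  have "(\<lambda>m. C * (\<Sum>n. N (f (n + m)))) \<longlonglongrightarrow> C * 0"
    by (intro tendsto_intros suminf_exist_split2[OF f(2)])
  moreover have "cmod ((\<Sum>n<m. T (f n) x) - T F x) \<le> C * (\<Sum>n. N (f (n + m)))" for m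
  proof -
    have "cmod (T (tail m) x) \<le> C * N (tail m)"
      using pointwise_le[OF bop_mem[OF T tail(1)]] C(2)[OF tail(1)] order_trans by blast
    also have "\<dots> \<le> C * (\<Sum>n. N (f (n + m)))" using tail(2) C(1) by simp
    finally show ?thesis unfolding step[of m, symmetric] by (subst norm_minus_commute)
  qed
  ultimately have "(\<lambda>m. (\<Sum>n<m. T (f n) x) - T F x) \<longlonglongrightarrow> 0"
    unfolding mult_zero_right by (rule Lim_null_comparison[OF always_eventually[OF allI], rotated])
  then show ?thesis unfolding sums_def F_def[symmetric] by (subst Lim_null)
qed

section \<open>Resolvents: Neumann series and perturbations\<close>

definition is_resolvent :: "'x operator \<Rightarrow> complex \<Rightarrow> 'x operator \<Rightarrow> bool" where
  "is_resolvent T z R \<longleftrightarrow> bop R \<and>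
     (\<forall>f\<in>W. R (scalar_minus z T f) = f \<and> scalar_minus z T (R f) = f)"

lemma resolvent_set_iff: "z \<in> resolvent_set W N T \<longleftrightarrow> (\<exists>R. is_resolvent T z R)"
  by (auto simp: resolvent_set_def is_resolvent_def)

lemma is_resolventD:
  assumes "is_resolvent T z R"
  shows "bop R" "\<And>f. f \<in> W \<Longrightarrow> R (scalar_minus z T f) = f"
    "\<And>f. f \<in> W \<Longrightarrow> scalar_minus z T (R f) = f"
  using assms by (auto simp: is_resolvent_def)

lemma resolvent_eq:
  assumes R: "is_resolvent T z R" and f: "f \<in> W"
  shows "resolvent W T z f = R f"
proof -
  have "inj_on (scalar_minus z T) W"
    by (rule inj_on_inverseI[of _ R]) (rule is_resolventD(2)[OF R])
  then show ?thesis
    unfolding resolvent_def using is_resolventD(3)[OF R f] bop_mem[OF is_resolventD(1)[OF R] f]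
    by (metis the_inv_into_f_f)
qed

lemma bop_funpow_mem: "bop T \<Longrightarrow> f \<in> W \<Longrightarrow> (T ^^ n) f \<in> W"
  by (induction n) (auto intro: bop_mem)

text \<open>The bounds \<open>c n\<close> concern the iterates themselves, not powers of one
  operator norm, so the series reaches down to the growth rate of the iterates. Shifting its index
  shows that composing it with \<open>T\<close> on either side gives \<open>z\<close> times the
  series minus the identity.\<close>

lemma neumann:
  assumes T: "bop T" and c: "\<And>n f. f \<in> W \<Longrightarrow> N ((T ^^ n) f) \<le> c n * N f"
    and z: "z \<noteq> 0" and s: "summable (\<lambda>n. c n / cmod z ^ Suc n)"
  shows "is_resolvent T z (\<lambda>f x. \<Sum>n. (T ^^ n) f x / z ^ Suc n)"
    and "f \<in> W \<Longrightarrow> (\<lambda>n. (T ^^ n) f x / z ^ Suc n) sums (\<Sum>n. (T ^^ n) f x / z ^ Suc n)"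
proof -
  define R where "R = (\<lambda>f x. \<Sum>n. (T ^^ n) f x / z ^ Suc n)"
  define t where "t f n = (\<lambda>x. (1 / z ^ Suc n) * (T ^^ n) f x)" for f n
  have t_mem: "t f n \<in> W" if "f \<in> W" for f n
    unfolding t_def by (intro scale_mem bop_funpow_mem T that)
  have Nt: "N (t f n) \<le> c n / cmod z ^ Suc n * N f" if "f \<in> W" for f n
  proof -
    have "N (t f n) = N ((T ^^ n) f) / cmod z ^ Suc n"
      unfolding t_def by (subst N_scale[OF bop_funpow_mem[OF T that]])
        (simp add: norm_divide norm_power norm_mult)
    also have "\<dots> \<le> c n * N f / cmod z ^ Suc n"
      by (intro divide_right_mono c that) auto
    finally show ?thesis by simp
  qed
  have st: "summable (\<lambda>n. N (t f n))" if "f \<in> W" for f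
    by (rule summable_comparison_test[OF _ summable_mult2[OF s, of "N f"]])
       (use Nt[OF that] N_nonneg[OF t_mem[OF that]] in auto)
  have R_t: "R f = (\<lambda>x. \<Sum>n. t f n x)" for f by (simp add: R_def t_def)
  have R_mem: "R f \<in> W" and R_N: "N (R f) \<le> (\<Sum>n. N (t f n))" if "f \<in> W" for f
    using complete[OF t_mem[OF that] st[OF that]] by (auto simp: R_t)
  have sums: "(\<lambda>n. t f n x) sums R f x" if "f \<in> W" for f x
    using bop_suminf[OF bop_id t_mem[OF that] st[OF that], of x] by (simp add: R_t)
  from sums show "f \<in> W \<Longrightarrow> (\<lambda>n. (T ^^ n) f x / z ^ Suc n) sums (\<Sum>n. (T ^^ n) f x / z ^ Suc n)"
    by (auto simp: R_def t_def)
  have T_pow_add: "(T ^^ n) (\<lambda>x. f x + g x) = (\<lambda>x. (T ^^ n) f x + (T ^^ n) g x)"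
    if "f \<in> W" "g \<in> W" for f g n
    by (induction n) (simp_all add: bop_add[OF T] bop_funpow_mem[OF T] that)
  have T_pow_scale: "(T ^^ n) (\<lambda>x. a * f x) = (\<lambda>x. a * (T ^^ n) f x)" if "f \<in> W" for f n a
    by (induction n) (simp_all add: bop_scale[OF T] bop_funpow_mem[OF T] that)
  have bR: "bop R"
  proof (rule bopI[of _ "\<Sum>n. c n / cmod z ^ Suc n"])
    fix f g x assume f: "f \<in> W" and g: "g \<in> W"
    have "(\<lambda>n. t f n x + t g n x) = (\<lambda>n. t (\<lambda>x. f x + g x) n x)"
      by (simp add: t_def T_pow_add[OF f g] algebra_simps add_divide_distrib)
    then show "R (\<lambda>x. f x + g x) x = R f x + R g x"
      using sums_add[OF sums[OF f, of x] sums[OF g, of x]] sums[OF add_mem[OF f g], of x]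
        sums_unique2 by fastforce
  next
    fix a f x assume f: "f \<in> W"
    have "(\<lambda>n. a * t f n x) = (\<lambda>n. t (\<lambda>x. a * f x) n x)"
      by (simp add: t_def T_pow_scale[OF f])
    then show "R (\<lambda>x. a * f x) x = a * R f x"
      using sums_mult[OF sums[OF f, of x], of a] sums[OF scale_mem[OF f], of a x]
        sums_unique2 by fastforce
  next
    fix f assume f: "f \<in> W"
    show "R f \<in> W" by (rule R_mem[OF f])
    have "N (R f) \<le> (\<Sum>n. N (t f n))" by (rule R_N[OF f])
    also have "\<dots> \<le> (\<Sum>n. c n / cmod z ^ Suc n * N f)"
      by (rule suminf_le[OF Nt[OF f] st[OF f] summable_mult2[OF s]])
    also have "\<dots> = (\<Sum>n. c n / cmod z ^ Suc n) * N f" by (rule suminf_mult2[OF s, symmetric])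
    finally show "N (R f) \<le> (\<Sum>n. c n / cmod z ^ Suc n) * N f" .
  qed
  have TR: "T (R f) x = z * R f x - f x" and RT: "R (T f) x = z * R f x - f x" if f: "f \<in> W" for f x
  proof -
    have "(\<lambda>n. t f (Suc n) x) sums (R f x - t f 0 x)"
      using sums[OF f, of x] by (subst sums_Suc_iff) simp
    then have "(\<lambda>n. z * t f (Suc n) x) sums (z * (R f x - t f 0 x))" by (rule sums_mult)
    moreover have "z * (R f x - t f 0 x) = z * R f x - f x"
      using z by (simp add: t_def right_diff_distrib)
    ultimately have "(\<lambda>n. z * t f (Suc n) x) sums (z * R f x - f x)" by simp
    moreover have eq: "z * t f (Suc n) x = T (t f n) x" for n
      unfolding t_def by (subst bop_scale[OF T bop_funpow_mem[OF T f]]) (simp add: z)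
    ultimately have "(\<lambda>n. T (t f n) x) sums (z * R f x - f x)" by simp
    then show "T (R f) x = z * R f x - f x"
      using bop_suminf[OF T t_mem[OF f] st[OF f], of x] sums_unique2 unfolding R_t by blast
    have "T (t f n) x = t (T f) n x" for n
      unfolding t_def by (subst bop_scale[OF T bop_funpow_mem[OF T f]])
        (simp add: funpow_swap1)
    then have "(\<lambda>n. t (T f) n x) sums (z * R f x - f x)"
      using \<open>(\<lambda>n. T (t f n) x) sums (z * R f x - f x)\<close> by simp
    then show "R (T f) x = z * R f x - f x"
      using sums[OF bop_mem[OF T f], of x] sums_unique2 by blast
  qed
  have "R (scalar_minus z T f) = f" if f: "f \<in> W" for f
  proof -
    have "R (scalar_minus z T f) = (\<lambda>x. z * R f x - R (T f) x)"
      using bop_diff[OF bR scale_mem[OF f, of z] bop_mem[OF T f]] bop_scale[OF bR f, of z]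
      by (simp add: scalar_minus_def)
    then show ?thesis by (simp add: RT[OF f])
  qed
  moreover have "scalar_minus z T (R f) = f" if f: "f \<in> W" for f
    by (simp add: scalar_minus_def TR[OF f])
  ultimately show "is_resolvent T z (\<lambda>f x. \<Sum>n. (T ^^ n) f x / z ^ Suc n)"
    using bR unfolding is_resolvent_def R_def by blast
qed

text \<open>Factor \<open>z' - T = (1 - Q) (z - T)\<close> with \<open>Q = (z - z') R\<close>. The
  norm of \<open>Q\<close> is below one, so a geometric Neumann series inverts the first
  factor.\<close>

lemma resolvent_perturb:
  assumes T: "bop T" and R: "is_resolvent T z R"
    and C: "\<And>f. f \<in> W \<Longrightarrow> N (R f) \<le> C * N f" and "0 \<le> C" "cmod (z' - z) * C < 1"
  shows "\<exists>R'. is_resolvent T z' R'"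
proof -
  note bR = is_resolventD(1)[OF R]
  define Q where "Q = (\<lambda>f x. (z - z') * R f x)"
  define q where "q = cmod (z' - z) * C"
  have q: "0 \<le> q" "q < 1" using assms by (auto simp: q_def)
  have bQ: "bop Q" unfolding Q_def by (rule bop_cmult[OF bR])
  have NQ: "N (Q f) \<le> q * N f" if f: "f \<in> W" for f
  proof -
    have "N (Q f) = cmod (z' - z) * N (R f)"
      unfolding Q_def N_scale[OF bop_mem[OF bR f]] by (simp add: norm_minus_commute)
    also have "\<dots> \<le> cmod (z' - z) * (C * N f)" by (intro mult_left_mono C f) auto
    finally show ?thesis by (simp add: q_def mult.assoc)
  qed
  have NQn: "N ((Q ^^ n) f) \<le> q ^ n * N f" if f: "f \<in> W" for n f
  proof (induction n)
    case (Suc n)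
    have "N ((Q ^^ Suc n) f) \<le> q * N ((Q ^^ n) f)" using NQ[OF bop_funpow_mem[OF bQ f]] by simp
    also have "\<dots> \<le> q * (q ^ n * N f)" by (intro mult_left_mono Suc q)
    finally show ?case by simp
  qed simp
  obtain P where P: "is_resolvent Q 1 P"
    using neumann(1)[OF bQ NQn, of 1] q by (auto simp: summable_geometric)
  note bP = is_resolventD(1)[OF P]
  have e1: "scalar_minus z' T (R f) = scalar_minus 1 Q f" if f: "f \<in> W" for f
    using fun_cong[OF is_resolventD(3)[OF R f]]
    by (auto simp: scalar_minus_def Q_def fun_eq_iff algebra_simps)
  have e2: "scalar_minus z' T f = scalar_minus 1 Q (scalar_minus z T f)" if f: "f \<in> W" for f
    using is_resolventD(2)[OF R f] by (auto simp: scalar_minus_def Q_def fun_eq_iff algebra_simps)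
  have "is_resolvent T z' (\<lambda>f. R (P f))"
    unfolding is_resolvent_def
    using bop_comp[OF bR bP] e1 e2 is_resolventD(2,3)[OF P] is_resolventD(2)[OF R]
      bop_mem[OF bP] bop_mem[OF bop_scalar_minus[OF T]] by simp
  then show ?thesis by blast
qed

text \<open>Continuity method: bounded below at the endpoint of a ray of invertible operators.\<close>

lemma resolvent_endpoint:
  fixes lam :: real
  assumes T: "bop T" and "0 < c" and c: "\<And>f. f \<in> W \<Longrightarrow> c * N f \<le> N (scalar_minus lam T f)"
    and ray: "\<And>t. lam < t \<Longrightarrow> \<exists>R. is_resolvent T (of_real t) R"
  shows "\<exists>R. is_resolvent T (of_real lam) R"
proof -
  \<comment> \<open>The lower bound makes the resolvent at \<open>lam + c / 3\<close> have norm at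
    most \<open>3 / (2 * c)\<close>. Times the distance \<open>c / 3\<close> this is
    \<open>1 / 2\<close>, which is within reach of \<open>resolvent_perturb\<close>.\<close>
  define t where "t = lam + c / 3"
  obtain R where R: "is_resolvent T (of_real t) R" using ray[of t] \<open>0 < c\<close> by (auto simp: t_def)
  note bR = is_resolventD(1)[OF R]
  have "N (R f) \<le> 3 / (2 * c) * N f" if f: "f \<in> W" for f
  proof -
    have m: "R f \<in> W" by (rule bop_mem[OF bR f])
    have "scalar_minus lam T (R f) = (\<lambda>x. f x - of_real (c / 3) * R f x)"
      using fun_cong[OF is_resolventD(3)[OF R f]]
      by (auto simp: scalar_minus_def t_def fun_eq_iff algebra_simps)
    then have "c * N (R f) \<le> N f + c / 3 * N (R f)"
      using c[OF m] N_diff[OF f scale_mem[OF m, of "of_real (c / 3)"]] N_scale[OF m, of "of_real (c / 3)"]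
        \<open>0 < c\<close> by (simp add: norm_divide norm_mult)
    then show ?thesis using \<open>0 < c\<close> by (simp add: field_simps)
  qed
  then show ?thesis
    by (rule resolvent_perturb[OF T R]) (use \<open>0 < c\<close> in \<open>auto simp: t_def norm_divide norm_mult\<close>)
qed

text \<open>The Sherman-Morrison formula for \<open>z - T + u \<otimes> \<delta>\<^sub>w\<close>,
  whose denominator is \<open>1 + R u w\<close>.\<close>

lemma resolvent_rank_one:
  assumes T: "bop T" and R: "is_resolvent T z R" and u: "u \<in> W" and ne: "1 + R u w \<noteq> 0"
  shows "\<exists>R'. is_resolvent (\<lambda>f x. T f x - f w * u x) z R'"
proof -
  note bR = is_resolventD(1)[OF R]
  have Ru: "R u \<in> W" by (rule bop_mem[OF bR u])
  define R' where "R' = (\<lambda>f x. R f x - (R f w / (1 + R u w)) * R u x)"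
  have "bop (\<lambda>f x. R f w * ((1 / (1 + R u w)) * R u x))"
    using bop_comp[OF bop_rank_one[OF scale_mem[OF Ru, of "1 / (1 + R u w)"], of w] bR] .
  from bop_minus[OF bR this] have bR': "bop R'"
    by (simp add: R'_def)
  have "scalar_minus z (\<lambda>f x. T f x - f w * u x) (R' f) x = f x" if f: "f \<in> W" for f x
  proof -
    have Rf: "R f \<in> W" by (rule bop_mem[OF bR f])
    define b where "b = R f w / (1 + R u w)"
    have TR: "T (R' f) x = T (R f) x - b * T (R u) x"
      unfolding R'_def b_def[symmetric] bop_diff[OF T Rf scale_mem[OF Ru]] bop_scale[OF T Ru] ..
    have w: "R' f w = b" unfolding R'_def b_def using ne by (simp add: field_simps)
    have R'x: "R' f x = R f x - b * R u x" by (simp add: R'_def b_def)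
    have f_u: "z * R f x - T (R f) x = f x" "z * R u x - T (R u) x = u x"
      using fun_cong[OF is_resolventD(3)[OF R f], of x] fun_cong[OF is_resolventD(3)[OF R u], of x]
      by (auto simp: scalar_minus_def)
    have "scalar_minus z (\<lambda>f x. T f x - f w * u x) (R' f) x
      = (z * R f x - T (R f) x) - b * (z * R u x - T (R u) x - u x)"
      unfolding scalar_minus_def TR w unfolding R'x by (simp add: algebra_simps)
    then show ?thesis unfolding f_u by simp
  qed
  moreover have "R' (scalar_minus z (\<lambda>f x. T f x - f w * u x) f) x = f x" if f: "f \<in> W" for f x
  proof -
    have m: "scalar_minus z T f \<in> W" by (rule bop_mem[OF bop_scalar_minus[OF T] f])
    have "scalar_minus z (\<lambda>f x. T f x - f w * u x) f = (\<lambda>x. scalar_minus z T f x + f w * u x)"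
      by (simp add: scalar_minus_def algebra_simps)
    then have "R (scalar_minus z (\<lambda>f x. T f x - f w * u x) f) = (\<lambda>x. f x + f w * R u x)"
      using bop_add[OF bR m scale_mem[OF u, of "f w"]] bop_scale[OF bR u, of "f w"]
        is_resolventD(2)[OF R f] by simp
    then show ?thesis unfolding R'_def using ne by (simp add: field_simps)
  qed
  ultimately have "is_resolvent (\<lambda>f x. T f x - f w * u x) z R'"
    unfolding is_resolvent_def using bR' by (auto simp: fun_eq_iff)
  then show ?thesis by blast
qed

end

section \<open>Locally Lipschitz functions on a Markov shift\<close>

lemma d_theta_nonneg: "0 < \<theta> \<Longrightarrow> 0 \<le> d_theta \<theta> \<omega> \<upsilon>"
  by (simp add: d_theta_def)

lemma d_theta_pos: "0 < \<theta> \<Longrightarrow> \<omega> \<noteq> \<upsilon> \<Longrightarrow> 0 < d_theta \<theta> \<omega> \<upsilon>"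
  by (simp add: d_theta_def)

lemma d_theta_refl: "d_theta \<theta> \<omega> \<omega> = 0"
  by (simp add: d_theta_def)

lemma d_theta_le:
  assumes "0 < \<theta>" "\<theta> < 1" "\<And>i. i < n \<Longrightarrow> \<omega> i = \<upsilon> i"
  shows "d_theta \<theta> \<omega> \<upsilon> \<le> \<theta> ^ n"
proof (cases "\<omega> = \<upsilon>")
  case False
  then have "\<exists>m. \<omega> m \<noteq> \<upsilon> m" by auto
  then have "\<omega> (LEAST m. \<omega> m \<noteq> \<upsilon> m) \<noteq> \<upsilon> (LEAST m. \<omega> m \<noteq> \<upsilon> m)" by (rule LeastI_ex)
  then have "n \<le> (LEAST m. \<omega> m \<noteq> \<upsilon> m)" using assms(3) linorder_not_le by blast
  then show ?thesis using assms(1,2) False by (simp add: d_theta_def power_decreasing)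
qed (use assms in \<open>simp add: d_theta_refl\<close>)

lemma d_theta_le_1: "0 < \<theta> \<Longrightarrow> \<theta> < 1 \<Longrightarrow> d_theta \<theta> \<omega> \<upsilon> \<le> 1"
  using d_theta_le[of \<theta> 0] by simp

text \<open>A common first letter delays the first disagreement by one place. This contraction is
  the source of the factor \<open>\<theta> ^ n\<close> in the Lasota-Yorke inequality.\<close>

lemma d_theta_Cons:
  "d_theta \<theta> (case_nat a \<omega>) (case_nat a \<upsilon>) = \<theta> * d_theta \<theta> \<omega> \<upsilon>"
proof (cases "\<omega> = \<upsilon>")
  case False
  then obtain m where m: "\<omega> m \<noteq> \<upsilon> m" by auto
  have "(LEAST n. case_nat a \<omega> n \<noteq> case_nat a \<upsilon> n) = Suc (LEAST n. \<omega> n \<noteq> \<upsilon> n)"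
    using Least_Suc[of "\<lambda>n. case_nat a \<omega> n \<noteq> case_nat a \<upsilon> n" "Suc m"] m by simp
  moreover have "case_nat a \<omega> \<noteq> case_nat a \<upsilon>" using m by (metis old.nat.simps(5))
  ultimately show ?thesis using False by (simp add: d_theta_def)
qed (simp add: d_theta_refl)

lemma lip_seminorm_le:
  assumes "0 < \<theta>" "0 \<le> K"
    and "\<And>\<omega> \<upsilon>. \<omega> \<in> X \<Longrightarrow> \<upsilon> \<in> X \<Longrightarrow> (\<forall>i<k. \<omega> i = \<upsilon> i) \<Longrightarrow>
           norm (f \<omega> - f \<upsilon>) \<le> K * d_theta \<theta> \<omega> \<upsilon>"
  shows "lip_seminorm \<theta> X k f \<le> ennreal K"
  unfolding lip_seminorm_def
proof (rule SUP_least, clarify)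
  fix \<omega> \<upsilon> assume *: "\<omega> \<in> X" "\<upsilon> \<in> X" "\<omega> \<noteq> \<upsilon>" "\<forall>i<k. \<omega> i = \<upsilon> i"
  have "norm (f \<omega> - f \<upsilon>) / d_theta \<theta> \<omega> \<upsilon> \<le> K"
    using assms(3)[OF *(1,2,4)] d_theta_pos[OF assms(1) *(3)] by (simp add: pos_divide_le_eq)
  then show "ennreal (norm (f \<omega> - f \<upsilon>) / d_theta \<theta> \<omega> \<upsilon>) \<le> ennreal K" by (rule ennreal_leI)
qed

lemma lip_seminorm_bound:
  assumes "0 < \<theta>" "lip_seminorm \<theta> X k f < \<infinity>" "\<omega> \<in> X" "\<upsilon> \<in> X" "\<forall>i<k. \<omega> i = \<upsilon> i"
  shows "norm (f \<omega> - f \<upsilon>) \<le> enn2real (lip_seminorm \<theta> X k f) * d_theta \<theta> \<omega> \<upsilon>"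
proof (cases "\<omega> = \<upsilon>")
  case False
  have "ennreal (norm (f \<omega> - f \<upsilon>) / d_theta \<theta> \<omega> \<upsilon>) \<le> lip_seminorm \<theta> X k f"
    unfolding lip_seminorm_def by (rule SUP_upper2[of "(\<omega>, \<upsilon>)"]) (use assms False in auto)
  then have "norm (f \<omega> - f \<upsilon>) / d_theta \<theta> \<omega> \<upsilon> \<le> enn2real (lip_seminorm \<theta> X k f)"
    using assms(2) enn2real_mono[of "ennreal (norm (f \<omega> - f \<upsilon>) / d_theta \<theta> \<omega> \<upsilon>)"]
      d_theta_nonneg[OF assms(1), of \<omega> \<upsilon>] by simp
  then show ?thesis using d_theta_pos[OF assms(1) False] by (simp add: pos_divide_le_eq)
qed (simp add: d_theta_refl)

lemma openin_shift_cylinder: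
  assumes "\<omega> \<in> markov_shift S A"
  shows "openin (shift_topology S A) {\<upsilon> \<in> markov_shift S A. \<forall>i<n. \<upsilon> i = \<omega> i}"
proof -
  have "openin (product_topology (\<lambda>_. discrete_topology S) UNIV)
     (PiE UNIV (\<lambda>i. if i < n then {\<omega> i} else S))"
    unfolding openin_PiE_gen using assms
    by (auto simp: markov_shift_def intro: finite_subset[of _ "{..<n}"])
  moreover have "{\<upsilon> \<in> markov_shift S A. \<forall>i<n. \<upsilon> i = \<omega> i} =
     PiE UNIV (\<lambda>i. if i < n then {\<omega> i} else S) \<inter> markov_shift S A"
    by (auto simp: PiE_iff markov_shift_def split: if_splits)
  ultimately show ?thesis unfolding shift_topology_def openin_subtopology by blast
qed

lemma topspace_shift: "topspace (shift_topology S A) = markov_shift S A"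
  unfolding shift_topology_def by (auto simp: markov_shift_def)

text \<open>Long cylinders are open and have small diameter. Hence membership in \<open>Fb\<close>
  comes down to the two finite bounds, and continuity follows from them.\<close>

lemma continuous_of_lipschitz:
  fixes f :: "(nat \<Rightarrow> 's) \<Rightarrow> 'b::real_normed_vector"
  assumes th: "0 < \<theta>" "\<theta> < 1" and "0 \<le> K"
    and f: "\<And>\<omega> \<upsilon>. \<omega> \<in> markov_shift S A \<Longrightarrow> \<upsilon> \<in> markov_shift S A \<Longrightarrow> \<omega> 0 = \<upsilon> 0 \<Longrightarrow>
           norm (f \<omega> - f \<upsilon>) \<le> K * d_theta \<theta> \<omega> \<upsilon>"
  shows "continuous_map (shift_topology S A) euclidean f"
  unfolding continuous_map_def
proof (intro conjI allI impI)
  fix G :: "'b set" assume "openin euclidean G"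
  then have G: "open G" by simp
  show "openin (shift_topology S A) {\<omega> \<in> topspace (shift_topology S A). f \<omega> \<in> G}"
  proof (subst openin_subopen, clarify)
    fix \<omega> assume \<omega>: "\<omega> \<in> topspace (shift_topology S A)" "f \<omega> \<in> G"
    obtain e where e: "0 < e" "ball (f \<omega>) e \<subseteq> G" using G \<omega>(2) by (auto simp: open_contains_ball)
    have "(\<lambda>n. K * \<theta> ^ n) \<longlonglongrightarrow> K * 0" using th by (intro tendsto_intros LIMSEQ_realpow_zero) auto
    then have "eventually (\<lambda>n. K * \<theta> ^ n < e) sequentially" using e(1) by (intro order_tendstoD) auto
    \<comment> \<open>\<open>1 \<le> n\<close> makes the first letters agree, as the Lipschitz
      hypothesis requires.\<close>
    then obtain n where n: "K * \<theta> ^ n < e" "1 \<le> n"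
      by (metis eventually_at_top_linorder nat_le_linear)
    have "f \<upsilon> \<in> G" if "\<upsilon> \<in> markov_shift S A" "\<forall>i<n. \<upsilon> i = \<omega> i" for \<upsilon>
    proof -
      have "norm (f \<upsilon> - f \<omega>) \<le> K * d_theta \<theta> \<upsilon> \<omega>"
        using f[OF that(1), of \<omega>] \<omega> that(2) n(2) by (simp add: topspace_shift)
      also have "\<dots> \<le> K * \<theta> ^ n" using \<open>0 \<le> K\<close> that(2) by (intro mult_left_mono d_theta_le th) auto
      finally show ?thesis using n(1) e(2) by (auto simp: dist_norm norm_minus_commute subset_iff)
    qed
    then show "\<exists>T. openin (shift_topology S A) T \<and> \<omega> \<in> T \<and>
        T \<subseteq> {\<omega> \<in> topspace (shift_topology S A). f \<omega> \<in> G}"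
      using openin_shift_cylinder[of \<omega> S A n] \<omega>
      by (intro exI[of _ "{\<upsilon> \<in> markov_shift S A. \<forall>i<n. \<upsilon> i = \<omega> i}"]) (auto simp: topspace_shift)
  qed
qed auto

text \<open>\<open>sn\<close> and \<open>ls\<close> are the two real summands of
  \<open>Fb_norm\<close>. Since \<open>enn2real\<close> sends infinity to zero, they are informative
  only where the extended values are finite, as on \<open>Fb\<close>.\<close>

definition sn :: "(nat \<Rightarrow> 's) set \<Rightarrow> ((nat \<Rightarrow> 's) \<Rightarrow> complex) \<Rightarrow> real" where
  "sn X f = enn2real (sup_norm X f)"

definition ls :: "real \<Rightarrow> (nat \<Rightarrow> 's) set \<Rightarrow> ((nat \<Rightarrow> 's) \<Rightarrow> complex) \<Rightarrow> real" where
  "ls \<theta> X f = enn2real (lip_seminorm \<theta> X 1 f)"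

section \<open>The space \<open>Fb\<close> as a Banach space of functions\<close>

locale shift_space =
  fixes \<theta> :: real and S :: "'s set" and A :: "'s \<Rightarrow> 's \<Rightarrow> nat"
  assumes theta: "0 < \<theta>" "\<theta> < 1"
begin

abbreviation "X \<equiv> markov_shift S A"
abbreviation "W \<equiv> Fb \<theta> S A"
abbreviation "N \<equiv> Fb_norm \<theta> S A"
abbreviation "d \<equiv> d_theta \<theta> :: (nat \<Rightarrow> 's) \<Rightarrow> (nat \<Rightarrow> 's) \<Rightarrow> real"

lemmas d_nonneg = d_theta_nonneg[OF theta(1)]

lemma FbI:
  assumes "\<And>\<omega>. \<omega> \<notin> X \<Longrightarrow> f \<omega> = 0" "0 \<le> B" "\<And>\<omega>. \<omega> \<in> X \<Longrightarrow> cmod (f \<omega>) \<le> B"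
    and "0 \<le> K" "\<And>\<omega> \<upsilon>. \<omega> \<in> X \<Longrightarrow> \<upsilon> \<in> X \<Longrightarrow> \<omega> 0 = \<upsilon> 0 \<Longrightarrow> cmod (f \<omega> - f \<upsilon>) \<le> K * d \<omega> \<upsilon>"
  shows "f \<in> W" "sn X f \<le> B" "ls \<theta> X f \<le> K" "N f \<le> B + K"
proof -
  have s: "sup_norm X f \<le> ennreal B"
    unfolding sup_norm_def using assms(3) by (intro SUP_least ennreal_leI)
  have l: "lip_seminorm \<theta> X 1 f \<le> ennreal K"
    using assms(4,5) by (intro lip_seminorm_le theta) auto
  have sl: "sup_norm X f + lip_seminorm \<theta> X 1 f \<le> ennreal (B + K)"
    using add_mono[OF s l] assms by (simp add: ennreal_plus)
  show "sn X f \<le> B" using enn2real_mono[OF s] assms by (simp add: sn_def)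
  show "ls \<theta> X f \<le> K" using enn2real_mono[OF l] assms by (simp add: ls_def)
  show "N f \<le> B + K" using enn2real_mono[OF sl] assms by (simp add: Fb_norm_def del: ennreal_plus)
  have "continuous_map (shift_topology S A) euclidean f"
    by (rule continuous_of_lipschitz[OF theta assms(4,5)])
  moreover have "sup_norm X f + lip_seminorm \<theta> X 1 f < \<infinity>"
    unfolding infinity_ennreal_def using sl ennreal_less_top by (rule le_less_trans)
  ultimately show "f \<in> W"
    unfolding Fb_def using assms(1) by blast
qed

lemma FbD:
  assumes "f \<in> W"
  shows "\<omega> \<notin> X \<Longrightarrow> f \<omega> = 0" "\<omega> \<in> X \<Longrightarrow> cmod (f \<omega>) \<le> sn X f"
    and "\<omega> \<in> X \<Longrightarrow> \<upsilon> \<in> X \<Longrightarrow> \<omega> 0 = \<upsilon> 0 \<Longrightarrow> cmod (f \<omega> - f \<upsilon>) \<le> ls \<theta> X f * d \<omega> \<upsilon>"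
    and "N f = sn X f + ls \<theta> X f" "0 \<le> sn X f" "0 \<le> ls \<theta> X f"
proof -
  have fin: "sup_norm X f + lip_seminorm \<theta> X 1 f < top" and z: "\<And>\<omega>. \<omega> \<notin> X \<Longrightarrow> f \<omega> = 0"
    using assms by (auto simp: Fb_def)
  then have s: "sup_norm X f < top" and l: "lip_seminorm \<theta> X 1 f < top"
    by (auto simp: ennreal_add_eq_top less_top)
  show "\<omega> \<notin> X \<Longrightarrow> f \<omega> = 0" by (rule z)
  show "cmod (f \<omega>) \<le> sn X f" if "\<omega> \<in> X"
  proof -
    have "ennreal (cmod (f \<omega>)) \<le> sup_norm X f" unfolding sup_norm_def using that by (rule SUP_upper)
    then show ?thesis using s enn2real_mono[of "ennreal (cmod (f \<omega>))" "sup_norm X f"]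
      by (simp add: sn_def)
  qed
  show "\<omega> \<in> X \<Longrightarrow> \<upsilon> \<in> X \<Longrightarrow> \<omega> 0 = \<upsilon> 0 \<Longrightarrow> cmod (f \<omega> - f \<upsilon>) \<le> ls \<theta> X f * d \<omega> \<upsilon>"
    using lip_seminorm_bound[OF theta(1), of X 1 f \<omega> \<upsilon>] l by (simp add: ls_def)
  show "N f = sn X f + ls \<theta> X f"
    unfolding Fb_norm_def sn_def ls_def using s l by (simp add: enn2real_plus)
qed (auto simp: sn_def ls_def)

lemma banach_Fb: "banach_fun W N"
proof
  show "(\<lambda>_. 0) \<in> W" by (rule FbI[of _ 0 0]) auto
next
  fix f g assume f: "f \<in> W" and g: "g \<in> W"
  have *: "cmod (f \<omega> + g \<omega> - (f \<upsilon> + g \<upsilon>)) \<le> (ls \<theta> X f + ls \<theta> X g) * d \<omega> \<upsilon>"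
    if "\<omega> \<in> X" "\<upsilon> \<in> X" "\<omega> 0 = \<upsilon> 0" for \<omega> \<upsilon>
    using FbD(3)[OF f that] FbD(3)[OF g that] norm_triangle_ineq[of "f \<omega> - f \<upsilon>" "g \<omega> - g \<upsilon>"]
    by (simp add: algebra_simps)
  have **: "cmod (f \<omega> + g \<omega>) \<le> sn X f + sn X g" if "\<omega> \<in> X" for \<omega>
    using FbD(2)[OF f that] FbD(2)[OF g that] norm_triangle_ineq[of "f \<omega>" "g \<omega>"] by linarith
  note I = FbI[of "\<lambda>x. f x + g x" "sn X f + sn X g" "ls \<theta> X f + ls \<theta> X g", OF _ _ ** _ *]
  show "(\<lambda>x. f x + g x) \<in> W"
    by (rule I(1)) (use FbD[OF f] FbD[OF g] in auto)
  have "N (\<lambda>x. f x + g x) \<le> sn X f + sn X g + (ls \<theta> X f + ls \<theta> X g)"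
    by (rule I(4)) (use FbD[OF f] FbD[OF g] in auto)
  then show "N (\<lambda>x. f x + g x) \<le> N f + N g" by (simp add: FbD(4) f g)
next
  have scale: "(\<lambda>x. c * f x) \<in> W \<and> N (\<lambda>x. c * f x) \<le> cmod c * N f" if f: "f \<in> W" for c f
  proof -
    have *: "cmod (c * f \<omega> - c * f \<upsilon>) \<le> (cmod c * ls \<theta> X f) * d \<omega> \<upsilon>"
      if "\<omega> \<in> X" "\<upsilon> \<in> X" "\<omega> 0 = \<upsilon> 0" for \<omega> \<upsilon>
      using mult_left_mono[OF FbD(3)[OF f that], of "cmod c"]
      by (simp add: norm_mult right_diff_distrib[symmetric] mult.assoc)
    have **: "cmod (c * f \<omega>) \<le> cmod c * sn X f" if "\<omega> \<in> X" for \<omega>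
      using mult_left_mono[OF FbD(2)[OF f that], of "cmod c"] by (simp add: norm_mult)
    note I = FbI[of "\<lambda>x. c * f x" "cmod c * sn X f" "cmod c * ls \<theta> X f", OF _ _ ** _ *]
    have "N (\<lambda>x. c * f x) \<le> cmod c * sn X f + cmod c * ls \<theta> X f"
      by (rule I(4)) (use FbD[OF f] in auto)
    moreover have "(\<lambda>x. c * f x) \<in> W" by (rule I(1)) (use FbD[OF f] in auto)
    ultimately show ?thesis by (simp add: FbD(4)[OF f] algebra_simps)
  qed
  fix f c assume f: "f \<in> W"
  show "(\<lambda>x. c * f x) \<in> W" using scale[OF f] by blast
  show "N (\<lambda>x. c * f x) = cmod c * N f"
  proof (cases "c = 0")
    case True
    then show ?thesis using FbI(4)[of "\<lambda>_. 0" 0 0] FbD(4-6)[of "\<lambda>_. 0"] FbI(1)[of "\<lambda>_. 0" 0 0] by simp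
  next
    case False
    \<comment> \<open>The reverse inequality is the same estimate for the factor
      \<open>1 / c\<close>.\<close>
    have "N (\<lambda>x. (1 / c) * (c * f x)) \<le> cmod (1 / c) * N (\<lambda>x. c * f x)"
      using scale[of "\<lambda>x. c * f x" "1 / c"] scale[OF f] by blast
    then have "cmod c * N f \<le> N (\<lambda>x. c * f x)"
      using False by (simp add: norm_divide field_simps)
    then show ?thesis using scale[OF f, of c] by simp
  qed
next
  fix f x assume f: "f \<in> W"
  show "cmod (f x) \<le> N f"
    by (cases "x \<in> X") (use FbD(1,2)[OF f, of x] FbD(4-6)[OF f] in auto)
next
  fix F :: "nat \<Rightarrow> (nat \<Rightarrow> 's) \<Rightarrow> complex"
  assume F: "\<And>n. F n \<in> W" and sm: "summable (\<lambda>n. N (F n))"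
  have s: "summable (\<lambda>n. sn X (F n))" and l: "summable (\<lambda>n. ls \<theta> X (F n))"
    by (rule summable_comparison_test'[OF sm, of 0], use FbD(4-6)[OF F] in auto)+
  have pt: "summable (\<lambda>n. cmod (F n \<omega>))" for \<omega>
    by (rule summable_comparison_test'[OF s, of 0], cases "\<omega> \<in> X")
       (use FbD(1,2)[OF F, of \<omega>] FbD(5)[OF F] in auto)
  note pt' = summable_norm_cancel[OF pt]
  have b: "cmod (\<Sum>n. F n \<omega>) \<le> (\<Sum>n. sn X (F n))" if "\<omega> \<in> X" for \<omega>
    using summable_norm[OF pt] suminf_le[OF _ pt s] FbD(2)[OF F that] order_trans by blast
  have L: "cmod ((\<Sum>n. F n \<omega>) - (\<Sum>n. F n \<upsilon>)) \<le> (\<Sum>n. ls \<theta> X (F n)) * d \<omega> \<upsilon>"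
    if "\<omega> \<in> X" "\<upsilon> \<in> X" "\<omega> 0 = \<upsilon> 0" for \<omega> \<upsilon>
  proof -
    have sd: "summable (\<lambda>n. cmod (F n \<omega> - F n \<upsilon>))"
      by (rule summable_comparison_test'[OF summable_add[OF pt pt], of 0])
         (use norm_triangle_ineq4 in auto)
    have "cmod ((\<Sum>n. F n \<omega>) - (\<Sum>n. F n \<upsilon>)) = cmod (\<Sum>n. F n \<omega> - F n \<upsilon>)"
      using suminf_diff[OF pt' pt'] by simp
    also have "\<dots> \<le> (\<Sum>n. cmod (F n \<omega> - F n \<upsilon>))" by (rule summable_norm[OF sd])
    also have "\<dots> \<le> (\<Sum>n. ls \<theta> X (F n) * d \<omega> \<upsilon>)"
      using FbD(3)[OF F that] by (intro suminf_le sd summable_mult2 l)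
    finally show ?thesis using suminf_mult2[OF l] by simp
  qed
  note I = FbI[of "\<lambda>\<omega>. \<Sum>n. F n \<omega>" "\<Sum>n. sn X (F n)" "\<Sum>n. ls \<theta> X (F n)", OF _ _ b _ L]
  have nn: "0 \<le> (\<Sum>n. sn X (F n))" "0 \<le> (\<Sum>n. ls \<theta> X (F n))"
    using FbD(5,6)[OF F] by (auto intro: suminf_nonneg s l)
  have "N (\<lambda>\<omega>. \<Sum>n. F n \<omega>) \<le> (\<Sum>n. sn X (F n)) + (\<Sum>n. ls \<theta> X (F n))"
    by (rule I(4)) (use nn FbD(1)[OF F] in auto)
  moreover have "(\<lambda>\<omega>. \<Sum>n. F n \<omega>) \<in> W" by (rule I(1)) (use nn FbD(1)[OF F] in auto)
  ultimately show "(\<lambda>\<omega>. \<Sum>n. F n \<omega>) \<in> W \<and> N (\<lambda>\<omega>. \<Sum>n. F n \<omega>) \<le> (\<Sum>n. N (F n))"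
    using suminf_add[OF s l] FbD(4)[OF F] by simp
qed

sublocale banach_fun W N by (rule banach_Fb)

lemma lip_dist_le:
  assumes "f \<in> W" "\<omega> \<in> X" "\<upsilon> \<in> X" "\<And>i. i < n \<Longrightarrow> \<omega> i = \<upsilon> i" "0 < n"
  shows "cmod (f \<omega> - f \<upsilon>) \<le> N f * \<theta> ^ n"
proof -
  have "cmod (f \<omega> - f \<upsilon>) \<le> ls \<theta> X f * d \<omega> \<upsilon>" using FbD(3)[OF assms(1-3)] assms(4,5) by simp
  also have "\<dots> \<le> N f * \<theta> ^ n"
    using FbD(4-6)[OF assms(1)] theta assms(4) d_nonneg by (intro mult_mono d_theta_le) auto
  finally show ?thesis .
qed

text \<open>All values lie in one disc, so Tychonoff gives a cluster point for pointwise
  convergence. The product runs over all sequences, in general an uncountable set, so the limit is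
  taken along a filter finer than \<open>sequentially\<close> instead of along a subsequence. The
  uniform bounds survive the limit and put it in \<open>W\<close>.\<close>

lemma compact_family:
  assumes g: "\<And>k. g k \<in> W" and B: "\<And>k. N (g k) \<le> B"
  obtains F g' where "F \<noteq> bot" "F \<le> sequentially" "g' \<in> W"
    "\<And>\<omega>. ((\<lambda>k::nat. g k \<omega>) \<longlongrightarrow> g' \<omega>) F"
proof -
  define K where "K = (PiE UNIV (\<lambda>_::nat \<Rightarrow> 's. cball (0::complex) B))"
  have "compactin (product_topology (\<lambda>_. euclidean) UNIV) K"
    unfolding K_def compactin_PiE by auto
  then have "compact K" by (simp add: euclidean_product_topology)
  moreover have "\<forall>k. g k \<in> K"
    using order_trans[OF pointwise_le[OF g] B] by (auto simp: K_def PiE_iff)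
  ultimately obtain g' where g': "inf (nhds g') (filtermap g sequentially) \<noteq> bot"
    unfolding compact_filter
    by (metis (no_types, lifting) eventually_filtermap always_eventually filtermap_bot_iff
        sequentially_bot)
  \<comment> \<open>The indices whose functions are near the cluster point. \<open>F\<close> is
    nontrivial because \<open>g'\<close> is a cluster point, and \<open>g\<close> tends to
    \<open>g'\<close> along it by construction.\<close>
  define F where "F = inf (filtercomap g (nhds g')) sequentially"
  have nb: "F \<noteq> bot"
  proof
    assume "F = bot"
    then have "eventually (\<lambda>_. False) F" by simp
    then obtain P Q where P: "eventually P (filtercomap g (nhds g'))" and Q: "eventually Q sequentially"
      and PQ: "\<And>x. P x \<Longrightarrow> Q x \<Longrightarrow> False" by (auto simp: F_def eventually_inf)
    obtain P' where P': "eventually P' (nhds g')" "\<And>x. P' (g x) \<Longrightarrow> P x"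
      using P by (auto simp: eventually_filtercomap)
    have "eventually (\<lambda>y. \<not> P' y) (filtermap g sequentially)"
      unfolding eventually_filtermap using Q by (rule eventually_mono) (use P' PQ in blast)
    then have "eventually (\<lambda>_. False) (inf (nhds g') (filtermap g sequentially))"
      unfolding eventually_inf using P'(1) by blast
    then show False using g' by (simp add: trivial_limit_def)
  qed
  have "(g \<longlongrightarrow> g') F"
    unfolding F_def filterlim_def
    by (rule order_trans[OF filtermap_mono[OF inf_le1] filtermap_filtercomap])
  then have lim: "((\<lambda>k. g k \<omega>) \<longlongrightarrow> g' \<omega>) F" for \<omega>
    using continuous_on_tendsto_compose[OF continuous_on_product_coordinates[of \<omega>]] by auto
  have B0: "0 \<le> B" using N_nonneg[OF g] B order_trans by blast
  have "g' \<in> W"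
  proof (rule FbI(1)[of _ B B])
    fix \<omega> assume "\<omega> \<notin> X"
    then show "g' \<omega> = 0" using lim[of \<omega>] FbD(1)[OF g] nb by (simp add: tendsto_const_iff)
  next
    fix \<omega> show "cmod (g' \<omega>) \<le> B"
      by (rule tendsto_upperbound[OF tendsto_norm[OF lim] _ nb])
         (use order_trans[OF pointwise_le[OF g] B] in auto)
  next
    fix \<omega> \<upsilon> assume *: "\<omega> \<in> X" "\<upsilon> \<in> X" "\<omega> 0 = \<upsilon> 0"
    have "cmod (g k \<omega> - g k \<upsilon>) \<le> B * d \<omega> \<upsilon>" for k
      using FbD(3)[OF g *, of k] B[of k] FbD(4,5)[OF g, of k] d_nonneg[of \<omega> \<upsilon>]
        mult_right_mono[of "ls \<theta> X (g k)" B "d \<omega> \<upsilon>"] by linarith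
    then show "cmod (g' \<omega> - g' \<upsilon>) \<le> B * d \<omega> \<upsilon>"
      by (intro tendsto_upperbound[OF tendsto_norm[OF tendsto_diff[OF lim lim]] _ nb]) auto
  qed (rule B0)+
  then show thesis using that[OF nb _ _ lim] by (simp add: F_def)
qed

end

section \<open>Transfer operators\<close>

locale transfer = shift_space \<theta> S A
  for \<theta> :: real and S :: "'s set" and A :: "'s \<Rightarrow> 's \<Rightarrow> nat" +
  fixes S0 :: "'s set" and M :: "'s \<Rightarrow> 's \<Rightarrow> nat" and \<phi> :: "(nat \<Rightarrow> 's) \<Rightarrow> real"
  assumes S0: "S0 \<subseteq> S"
    and MA: "\<And>i j. i \<in> S0 \<Longrightarrow> j \<in> S0 \<Longrightarrow> M i j = 1 \<Longrightarrow> A i j = 1"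
    and summable_phi: "summable_potential S (markov_shift S A) \<phi>"
    and lip_phi: "lip_seminorm \<theta> (markov_shift S A) 2 \<phi> < \<infinity>"
begin

section \<open>Pointwise calculus of the transfer operator\<close>

definition I :: "(nat \<Rightarrow> 's) \<Rightarrow> 's set" where
  "I \<omega> = {a \<in> S. zero_extend S0 M a (\<omega> 0) = 1}"

text \<open>Polymorphic in the value space: positivity arguments use real functions and spectral
  theory complex ones, with one set of lemmas for both.\<close>

definition T :: "((nat \<Rightarrow> 's) \<Rightarrow> 'b::banach) \<Rightarrow> (nat \<Rightarrow> 's) \<Rightarrow> 'b" where
  "T f \<omega> = (if \<omega> \<in> X then \<Sum>\<^sub>\<infinity>a\<in>I \<omega>. exp (\<phi> (case_nat a \<omega>)) *\<^sub>R f (case_nat a \<omega>) else 0)"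

text \<open>The value zero avoids the unspecified supremum over an empty cylinder and makes
  \<open>p\<close> summable over all of \<open>S\<close>.\<close>

definition p :: "'s \<Rightarrow> real" where
  "p a = (if cylinder X a = {} then 0 else exp (SUP \<omega>\<in>cylinder X a. \<phi> \<omega>))"

definition P :: real where "P = infsum p S"

text \<open>The geometric series [\<phi>]_2 times \<open>\<theta> + \<theta>\<^sup>2 + ...\<close>.
  If one word is prepended to two points with equal first letters, the Birkhoff sums of
  \<open>\<phi>\<close> along it differ by at most \<open>K\<close> times their distance.\<close>

definition K :: real where
  "K = enn2real (lip_seminorm \<theta> X 2 \<phi>) * \<theta> / (1 - \<theta>)"

definition bddX :: "((nat \<Rightarrow> 's) \<Rightarrow> 'b::real_normed_vector) \<Rightarrow> bool" where
  "bddX f \<longleftrightarrow> (\<exists>B. \<forall>\<omega>\<in>X. norm (f \<omega>) \<le> B)"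

lemma transfer_operator_eq: "transfer_operator S A S0 M \<phi> = T"
  by (auto simp: fun_eq_iff transfer_operator_def T_def I_def scaleR_conv_of_real)

lemma I_iff: "a \<in> I \<omega> \<longleftrightarrow> a \<in> S0 \<and> \<omega> 0 \<in> S0 \<and> M a (\<omega> 0) = 1"
  using S0 by (auto simp: I_def zero_extend_def)

lemma I_cong: "\<omega> 0 = \<upsilon> 0 \<Longrightarrow> I \<omega> = I \<upsilon>"
  by (simp add: I_def)

lemma I_subset: "I \<omega> \<subseteq> S"
  by (auto simp: I_def)

lemma Cons_in_X:
  assumes "\<omega> \<in> X" "a \<in> I \<omega>"
  shows "case_nat a \<omega> \<in> X"
  unfolding markov_shift_def
proof (safe)
  fix n
  show "case_nat a \<omega> n \<in> S" using assms S0 by (cases n) (auto simp: markov_shift_def I_iff)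
  show "A (case_nat a \<omega> n) (case_nat a \<omega> (Suc n)) = 1"
    using assms MA by (cases n) (auto simp: markov_shift_def I_iff)
qed

lemma p_nonneg: "0 \<le> p a"
  by (simp add: p_def)

lemma summable_p: "p summable_on S"
proof -
  have "(\<lambda>s. exp (SUP \<omega>\<in>cylinder X s. \<phi> \<omega>)) summable_on {s\<in>S. cylinder X s \<noteq> {}}"
    using summable_phi by (simp add: summable_potential_def)
  then show ?thesis
    by (rule summable_on_cong_neutral[THEN iffD1, rotated -1]) (auto simp: p_def)
qed

lemma exp_le_p:
  assumes "\<omega> \<in> X" "a \<in> I \<omega>"
  shows "exp (\<phi> (case_nat a \<omega>)) \<le> p a"
proof -
  have c: "case_nat a \<omega> \<in> cylinder X a" using Cons_in_X[OF assms] by (simp add: cylinder_def)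
  have "a \<in> S" using assms(2) I_subset by blast
  then have "\<phi> (case_nat a \<omega>) \<le> (SUP \<omega>\<in>cylinder X a. \<phi> \<omega>)"
    using summable_phi by (intro cSUP_upper c) (auto simp: summable_potential_def)
  then show ?thesis using c by (auto simp: p_def)
qed

lemma P_nonneg: "0 \<le> P"
  unfolding P_def by (intro infsum_nonneg p_nonneg)

lemma summable_p_subset: "B \<subseteq> S \<Longrightarrow> p summable_on B"
  using summable_on_subset_banach[OF summable_p] by blast

lemma tail_small:
  assumes "0 < e"
  obtains F where "finite F" "F \<subseteq> S" "infsum p (S - F) \<le> e"
proof -
  obtain F where F: "finite F" "F \<subseteq> S" "dist (sum p F) (infsum p S) \<le> e"
    using infsum_finite_approximation[OF summable_p assms] by blast
  have "infsum p S = infsum p F + infsum p (S - F)"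
    using infsum_Un_disjoint[of p F "S - F"] F summable_p_subset by (simp add: Un_absorb1)
  then show thesis using that[OF F(1,2)] F by (simp add: dist_real_def)
qed

lemma bddXI: "(\<And>\<omega>. \<omega> \<in> X \<Longrightarrow> norm (f \<omega>) \<le> B) \<Longrightarrow> bddX f"
  by (auto simp: bddX_def)

lemma bddXE:
  assumes "bddX f"
  obtains B where "0 \<le> B" "\<And>\<omega>. \<omega> \<in> X \<Longrightarrow> norm (f \<omega>) \<le> B"
proof -
  obtain B where "\<And>\<omega>. \<omega> \<in> X \<Longrightarrow> norm (f \<omega>) \<le> B" using assms by (auto simp: bddX_def)
  then show thesis using that[of "max B 0"] by (simp add: le_max_iff_disj)
qed

lemma bddX_const: "bddX (\<lambda>_. c)"
  by (auto simp: bddX_def)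

lemma bddX_norm: "bddX f \<Longrightarrow> bddX (\<lambda>\<omega>. norm (f \<omega>))"
  by (auto simp: bddX_def)

lemma bddX_scaleR: "bddX f \<Longrightarrow> bddX (\<lambda>\<omega>. c *\<^sub>R f \<omega>)"
  unfolding bddX_def by (metis mult_left_mono abs_ge_zero norm_scaleR)

lemma bddX_mult: "bddX f \<Longrightarrow> bddX (\<lambda>\<omega>. c * f \<omega> :: 'b::real_normed_algebra)"
  unfolding bddX_def by (meson mult_left_mono norm_ge_zero norm_mult_ineq order_trans)

lemma bddX_diff: "bddX f \<Longrightarrow> bddX g \<Longrightarrow> bddX (\<lambda>\<omega>. f \<omega> - g \<omega>)"
  unfolding bddX_def by (meson add_mono norm_triangle_ineq4 order_trans)

lemma bddX_Re: "bddX f \<Longrightarrow> bddX (\<lambda>\<omega>. Re (f \<omega>))"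
  unfolding bddX_def by (metis abs_Re_le_cmod order_trans real_norm_def)

lemma bddX_W: "f \<in> W \<Longrightarrow> bddX f"
  using pointwise_le by (auto simp: bddX_def)

lemma T_abs_summable:
  fixes f :: "(nat \<Rightarrow> 's) \<Rightarrow> 'b::banach"
  assumes "bddX f" "\<omega> \<in> X"
  shows "(\<lambda>a. norm (exp (\<phi> (case_nat a \<omega>)) *\<^sub>R f (case_nat a \<omega>))) summable_on I \<omega>"
proof -
  obtain B where B: "0 \<le> B" "\<And>\<omega>. \<omega> \<in> X \<Longrightarrow> norm (f \<omega>) \<le> B" using bddXE[OF assms(1)] by blast
  have "(\<lambda>a. p a * B) summable_on I \<omega>"
    by (intro summable_on_cmult_left summable_p_subset I_subset)
  then show ?thesis
    by (rule Infinite_Sum.abs_summable_on_comparison_test')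
       (use B exp_le_p[OF assms(2)] Cons_in_X[OF assms(2)] p_nonneg in \<open>auto intro!: mult_mono\<close>)
qed

lemmas T_summable = abs_summable_summable[OF T_abs_summable]

lemma T_cong: "(\<And>\<omega>. \<omega> \<in> X \<Longrightarrow> f \<omega> = g \<omega>) \<Longrightarrow> T f = T g"
  using Cons_in_X by (auto simp: fun_eq_iff T_def intro!: infsum_cong)

lemma T_outside: "\<omega> \<notin> X \<Longrightarrow> T f \<omega> = 0"
  by (simp add: T_def)

lemma T_outside_S0: "\<omega> 0 \<notin> S0 \<Longrightarrow> T f \<omega> = 0"
proof -
  assume "\<omega> 0 \<notin> S0"
  then have "I \<omega> = {}" by (auto simp: I_iff)
  then show ?thesis by (simp add: T_def)
qed

lemma T_add:
  assumes "bddX f" "bddX g"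
  shows "T (\<lambda>\<omega>. f \<omega> + g \<omega>) \<omega> = T f \<omega> + T g \<omega>"
  using infsum_add[OF T_summable[OF assms(1)] T_summable[OF assms(2)], of \<omega>]
  by (simp add: T_def scaleR_add_right)

text \<open>A bounded linear map passes through the convergent sum. Its instances are scaling, real
  parts and the embedding of real functions into complex ones.\<close>

lemma T_bounded_linear:
  assumes "bounded_linear l" "bddX f"
  shows "T (\<lambda>\<omega>. l (f \<omega>)) \<omega> = l (T f \<omega>)"
proof (cases "\<omega> \<in> X")
  case True
  have "((\<lambda>a. l (exp (\<phi> (case_nat a \<omega>)) *\<^sub>R f (case_nat a \<omega>))) has_sum
      l (\<Sum>\<^sub>\<infinity>a\<in>I \<omega>. exp (\<phi> (case_nat a \<omega>)) *\<^sub>R f (case_nat a \<omega>))) (I \<omega>)"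
    using has_sum_bounded_linear[OF assms(1) has_sum_infsum[OF T_summable[OF assms(2) True]]]
    by (simp add: o_def)
  then show ?thesis using True
    by (simp add: T_def infsumI linear_simps(5)[OF assms(1)])
next
  case False
  then show ?thesis by (simp add: T_def linear_simps(3)[OF assms(1)])
qed

lemma T_scaleR: "bddX f \<Longrightarrow> T (\<lambda>\<omega>. c *\<^sub>R f \<omega>) \<omega> = c *\<^sub>R T f \<omega>"
  by (rule T_bounded_linear[OF bounded_linear_scaleR_right])

lemma T_mult: "bddX f \<Longrightarrow> T (\<lambda>\<omega>. c * f \<omega>) \<omega> = c * T f \<omega>"
  for c :: "'b::{real_normed_algebra,banach}"
  by (rule T_bounded_linear[OF bounded_linear_mult_right])

lemma T_of_real: "bddX f \<Longrightarrow> T (\<lambda>\<omega>. complex_of_real (f \<omega>)) \<omega> = of_real (T f \<omega>)"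
  by (rule T_bounded_linear[OF bounded_linear_of_real])

lemma T_Re: "bddX f \<Longrightarrow> T (\<lambda>\<omega>. Re (f \<omega>)) \<omega> = Re (T f \<omega>)"
  by (rule T_bounded_linear[OF bounded_linear_Re])

lemma T_diff:
  assumes "bddX f" "bddX g"
  shows "T (\<lambda>\<omega>. f \<omega> - g \<omega>) \<omega> = T f \<omega> - T g \<omega>"
  using T_add[OF assms(1) bddX_scaleR[OF assms(2), of "-1"], of \<omega>] T_scaleR[OF assms(2), of "-1" \<omega>]
  by simp

lemma T_norm:
  assumes "bddX f"
  shows "norm (T f \<omega>) \<le> T (\<lambda>\<upsilon>. norm (f \<upsilon>)) \<omega>"
  using norm_infsum_bound[OF T_abs_summable[OF assms], of \<omega>] by (simp add: T_def)

lemma T_mono: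
  fixes f g :: "(nat \<Rightarrow> 's) \<Rightarrow> real"
  assumes "bddX f" "bddX g" "\<And>\<omega>. \<omega> \<in> X \<Longrightarrow> f \<omega> \<le> g \<omega>"
  shows "T f \<omega> \<le> T g \<omega>"
  unfolding T_def
  by (auto intro!: infsum_mono T_summable[of f, simplified] T_summable[of g, simplified] assms Cons_in_X)

lemma T_nonneg:
  fixes f :: "(nat \<Rightarrow> 's) \<Rightarrow> real"
  assumes "\<And>\<omega>. \<omega> \<in> X \<Longrightarrow> 0 \<le> f \<omega>"
  shows "0 \<le> T f \<omega>"
  unfolding T_def by (auto intro!: infsum_nonneg mult_nonneg_nonneg assms Cons_in_X)

text \<open>Since \<open>p\<close> dominates the weights, the letters outside \<open>F\<close>
  contribute at most a tail of \<open>p\<close>, uniformly in \<open>\<omega>\<close>. Limit and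
  sign arguments reduce to finite sums in this way.\<close>

lemma T_split:
  fixes q :: "(nat \<Rightarrow> 's) \<Rightarrow> real"
  assumes q: "\<And>\<omega>. \<omega> \<in> X \<Longrightarrow> 0 \<le> q \<omega>" "\<And>\<omega>. \<omega> \<in> X \<Longrightarrow> q \<omega> \<le> B" and "0 \<le> B"
    and \<omega>: "\<omega> \<in> X" and F: "finite F"
  shows "T q \<omega> \<le> (\<Sum>a\<in>F \<inter> I \<omega>. exp (\<phi> (case_nat a \<omega>)) * q (case_nat a \<omega>)) + B * infsum p (S - F)"
proof -
  define t where "t a = exp (\<phi> (case_nat a \<omega>)) * q (case_nat a \<omega>)" for a
  have b: "bddX q" using q by (intro bddXI[of _ B]) auto
  have s: "t summable_on I \<omega>" using T_summable[OF b \<omega>] by (simp add: t_def[abs_def])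
  have s': "t summable_on I \<omega> - F" by (rule summable_on_subset_banach[OF s]) auto
  have "T q \<omega> = infsum t ((F \<inter> I \<omega>) \<union> (I \<omega> - F))"
    using \<omega> by (auto simp: T_def t_def intro!: arg_cong2[where f = infsum])
  also have "\<dots> = sum t (F \<inter> I \<omega>) + infsum t (I \<omega> - F)"
    by (subst infsum_Un_disjoint) (use F s' in auto)
  also have "infsum t (I \<omega> - F) \<le> infsum (\<lambda>a. B * p a) (S - F)"
  proof (rule infsum_mono_neutral[OF s'])
    show "(\<lambda>a. B * p a) summable_on S - F" by (intro summable_on_cmult_right summable_p_subset) auto
    fix a assume "a \<in> (I \<omega> - F) \<inter> (S - F)"
    then have "t a \<le> p a * B"
      unfolding t_def using q Cons_in_X[OF \<omega>] exp_le_p[OF \<omega>] p_nonneg by (intro mult_mono) auto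
    then show "t a \<le> B * p a" by (simp add: mult.commute)
  qed (use I_subset p_nonneg \<open>0 \<le> B\<close> in auto)
  also have "\<dots> = B * infsum p (S - F)" by (rule infsum_cmult_right')
  finally show ?thesis by (simp add: t_def)
qed

lemma T_le:
  fixes q :: "(nat \<Rightarrow> 's) \<Rightarrow> real"
  assumes "\<And>\<omega>. \<omega> \<in> X \<Longrightarrow> 0 \<le> q \<omega>" "\<And>\<omega>. \<omega> \<in> X \<Longrightarrow> q \<omega> \<le> B" "0 \<le> B"
  shows "T q \<omega> \<le> P * B"
proof (cases "\<omega> \<in> X")
  case True
  then show ?thesis using T_split[OF assms True finite.emptyI] by (simp add: P_def mult.commute)
next
  case False
  then show ?thesis using P_nonneg assms(3) by (simp add: T_outside)
qed

lemma T_ge_sum: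
  fixes f :: "(nat \<Rightarrow> 's) \<Rightarrow> real"
  assumes "bddX f" "\<And>\<omega>. \<omega> \<in> X \<Longrightarrow> 0 \<le> f \<omega>" "\<omega> \<in> X" "finite G" "G \<subseteq> I \<omega>"
  shows "(\<Sum>a\<in>G. exp (\<phi> (case_nat a \<omega>)) * f (case_nat a \<omega>)) \<le> T f \<omega>"
proof -
  have "infsum (\<lambda>a. exp (\<phi> (case_nat a \<omega>)) * f (case_nat a \<omega>)) G
    \<le> infsum (\<lambda>a. exp (\<phi> (case_nat a \<omega>)) * f (case_nat a \<omega>)) (I \<omega>)"
    by (rule infsum_mono2)
       (use T_summable[OF assms(1,3)] assms(2,4,5) Cons_in_X[OF assms(3)] in auto)
  then show ?thesis using assms(3,4) by (simp add: T_def)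
qed

lemma T_ge_term:
  fixes f :: "(nat \<Rightarrow> 's) \<Rightarrow> real"
  assumes "bddX f" "\<And>\<omega>. \<omega> \<in> X \<Longrightarrow> 0 \<le> f \<omega>" "\<omega> \<in> X" "a \<in> I \<omega>"
  shows "exp (\<phi> (case_nat a \<omega>)) * f (case_nat a \<omega>) \<le> T f \<omega>"
  using T_ge_sum[OF assms(1-3), of "{a}"] assms(4) by simp

lemma bddX_T:
  assumes "bddX f"
  shows "bddX (T f)"
proof -
  obtain B where B: "0 \<le> B" "\<And>\<omega>. \<omega> \<in> X \<Longrightarrow> norm (f \<omega>) \<le> B" using bddXE[OF assms] by blast
  have "norm (T f \<omega>) \<le> P * B" for \<omega>
    using T_norm[OF assms, of \<omega>] T_le[of "\<lambda>\<upsilon>. norm (f \<upsilon>)" B \<omega>] B by simp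
  then show ?thesis by (rule bddXI)
qed

lemma bddX_Tn: "bddX f \<Longrightarrow> bddX ((T ^^ n) f)"
  by (induction n) (auto intro: bddX_T)

lemma Tn_mono:
  fixes f g :: "(nat \<Rightarrow> 's) \<Rightarrow> real"
  assumes "bddX f" "bddX g" "\<And>\<omega>. \<omega> \<in> X \<Longrightarrow> f \<omega> \<le> g \<omega>" "\<omega> \<in> X"
  shows "(T ^^ n) f \<omega> \<le> (T ^^ n) g \<omega>"
  using assms(4) by (induction n arbitrary: \<omega>) (auto intro!: T_mono bddX_Tn assms(1-3))

lemma Tn_nonneg:
  fixes f :: "(nat \<Rightarrow> 's) \<Rightarrow> real"
  assumes "\<And>\<omega>. \<omega> \<in> X \<Longrightarrow> 0 \<le> f \<omega>" "\<omega> \<in> X"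
  shows "0 \<le> (T ^^ n) f \<omega>"
  using assms(2) by (induction n arbitrary: \<omega>) (auto intro!: T_nonneg assms(1))

lemma Tn_bounded_linear:
  assumes "bounded_linear l" "bddX f"
  shows "(T ^^ n) (\<lambda>\<omega>. l (f \<omega>)) = (\<lambda>\<omega>. l ((T ^^ n) f \<omega>))"
  by (induction n) (auto intro!: ext simp: T_bounded_linear[OF assms(1) bddX_Tn[OF assms(2)]])

lemma Tn_cong: "(\<And>\<omega>. \<omega> \<in> X \<Longrightarrow> f \<omega> = g \<omega>) \<Longrightarrow> \<omega> \<in> X \<Longrightarrow> (T ^^ n) f \<omega> = (T ^^ n) g \<omega>"
proof (induction n arbitrary: \<omega>)
  case (Suc n)
  have "T ((T ^^ n) f) = T ((T ^^ n) g)" by (rule T_cong) (use Suc in auto)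
  then show ?case by simp
qed auto

lemma Tn_norm:
  assumes "bddX f" "\<omega> \<in> X"
  shows "norm ((T ^^ n) f \<omega>) \<le> (T ^^ n) (\<lambda>\<upsilon>. norm (f \<upsilon>)) \<omega>"
  using assms(2)
proof (induction n arbitrary: \<omega>)
  case (Suc n)
  have "norm ((T ^^ Suc n) f \<omega>) \<le> T (\<lambda>\<upsilon>. norm ((T ^^ n) f \<upsilon>)) \<omega>"
    using T_norm[OF bddX_Tn[OF assms(1)]] by simp
  also have "\<dots> \<le> T ((T ^^ n) (\<lambda>\<upsilon>. norm (f \<upsilon>))) \<omega>"
    by (intro T_mono bddX_norm bddX_Tn assms(1) Suc.IH)
  finally show ?case by simp
qed auto

lemma Tn_le_one:
  fixes q :: "(nat \<Rightarrow> 's) \<Rightarrow> real"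
  assumes "bddX q" "\<And>\<omega>. \<omega> \<in> X \<Longrightarrow> q \<omega> \<le> B" "\<omega> \<in> X"
  shows "(T ^^ n) q \<omega> \<le> B * (T ^^ n) (\<lambda>_. 1) \<omega>"
proof -
  have "(T ^^ n) q \<omega> \<le> (T ^^ n) (\<lambda>_. B * 1) \<omega>"
    by (rule Tn_mono) (use assms bddX_const in auto)
  also have "(T ^^ n) (\<lambda>_. B * 1) \<omega> = B * (T ^^ n) (\<lambda>_. 1) \<omega>"
    using Tn_bounded_linear[OF bounded_linear_mult_right[of B] bddX_const[of "1::real"], of n] by simp
  finally show ?thesis .
qed

section \<open>Distortion and the Lasota-Yorke inequality\<close>

lemma K_nonneg: "0 \<le> K"
  unfolding K_def using theta by (intro divide_nonneg_nonneg mult_nonneg_nonneg enn2real_nonneg) auto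

lemma K_eq: "enn2real (lip_seminorm \<theta> X 2 \<phi>) * \<theta> + \<theta> * K = K"
  unfolding K_def using theta by (simp add: field_simps)

text \<open>One common letter becomes two after prepending \<open>a\<close>, so the seminorm with
  \<open>k = 2\<close> applies. By \<open>K_eq\<close> the resulting constant is
  \<open>K - \<theta> * K\<close>.\<close>

lemma phi_diff:
  assumes "\<omega> \<in> X" "\<upsilon> \<in> X" "\<omega> 0 = \<upsilon> 0" "a \<in> I \<omega>"
  shows "\<bar>\<phi> (case_nat a \<omega>) - \<phi> (case_nat a \<upsilon>)\<bar> \<le> (K - \<theta> * K) * d \<omega> \<upsilon>"
proof -
  have "a \<in> I \<upsilon>" using I_cong[of \<omega> \<upsilon>] assms(3) assms(4) by blast
  moreover have "\<forall>i<2. case_nat a \<omega> i = case_nat a \<upsilon> i"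
    using assms(3) by (auto simp: less_Suc_eq numeral_2_eq_2)
  ultimately have "norm (\<phi> (case_nat a \<omega>) - \<phi> (case_nat a \<upsilon>))
     \<le> enn2real (lip_seminorm \<theta> X 2 \<phi>) * d (case_nat a \<omega>) (case_nat a \<upsilon>)"
    using Cons_in_X assms by (intro lip_seminorm_bound theta lip_phi) auto
  also have "\<dots> = (enn2real (lip_seminorm \<theta> X 2 \<phi>) * \<theta>) * d \<omega> \<upsilon>"
    by (simp add: d_theta_Cons)
  also have "enn2real (lip_seminorm \<theta> X 2 \<phi>) * \<theta> = K - \<theta> * K" using K_eq by linarith
  finally show ?thesis by simp
qed

text \<open>The constant \<open>K\<close> solves the recursion for the distortion of \<open>e\<^bsup>S\<^sub>n\<phi>\<^esup>\<close>, so that the induction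
  loses nothing.\<close>

lemma lasota_yorke:
  fixes g :: "(nat \<Rightarrow> 's) \<Rightarrow> 'b::banach"
  assumes g: "bddX g" and "0 \<le> G"
    and lip: "\<And>\<omega> \<upsilon>. \<omega> \<in> X \<Longrightarrow> \<upsilon> \<in> X \<Longrightarrow> \<omega> 0 = \<upsilon> 0 \<Longrightarrow> norm (g \<omega> - g \<upsilon>) \<le> G * d \<omega> \<upsilon>"
    and "\<omega> \<in> X" "\<upsilon> \<in> X" "\<omega> 0 = \<upsilon> 0"
  shows "norm ((T ^^ n) g \<omega> - (T ^^ n) g \<upsilon>) \<le>
     \<theta> ^ n * G * d \<omega> \<upsilon> * (T ^^ n) (\<lambda>_. 1) \<omega>
     + (exp (K * d \<omega> \<upsilon>) - 1) * (T ^^ n) (\<lambda>\<upsilon>. norm (g \<upsilon>)) \<upsilon>"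
  using assms(4-6)
proof (induction n arbitrary: \<omega> \<upsilon>)
  case 0
  have "0 \<le> (exp (K * d \<omega> \<upsilon>) - 1) * norm (g \<upsilon>)"
    using mult_nonneg_nonneg[OF K_nonneg d_nonneg[of \<omega> \<upsilon>]] by (intro mult_nonneg_nonneg) auto
  then show ?case using lip[OF 0] by simp
next
  case (Suc n)
  note X = Suc.prems
  let ?d = "d \<omega> \<upsilon>"
  \<comment> \<open>Bounds the ratio of the weights \<open>x a\<close> and \<open>y a\<close>.
    Multiplied by the distortion factor at distance \<open>\<theta> * ?d\<close> it gives exactly
    the factor at distance \<open>?d\<close>, see \<open>E_mult\<close>.\<close>
  define E where "E = exp ((K - \<theta> * K) * ?d)"
  define x where "x a = exp (\<phi> (case_nat a \<omega>))" for a
  define y where "y a = exp (\<phi> (case_nat a \<upsilon>))" for a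
  define g1 where "g1 = (T ^^ n) g"
  define one where "one = (T ^^ n) (\<lambda>_. 1::real)"
  define g2 where "g2 = (T ^^ n) (\<lambda>\<upsilon>. norm (g \<upsilon>))"
  have I_eq: "I \<upsilon> = I \<omega>" using I_cong[of \<omega> \<upsilon>] X(3) by simp
  have b1: "bddX g1" "bddX one" "bddX g2"
    by (auto simp: g1_def one_def g2_def intro!: bddX_Tn g bddX_const bddX_norm)
  have in_X: "case_nat a \<omega> \<in> X" "case_nat a \<upsilon> \<in> X" if "a \<in> I \<omega>" for a
    using Cons_in_X X that I_eq by auto
  have s1: "(\<lambda>a. x a *\<^sub>R g1 (case_nat a \<omega>)) summable_on I \<omega>"
    using T_summable[OF b1(1) X(1)] by (simp add: x_def)
  have s2: "(\<lambda>a. y a *\<^sub>R g1 (case_nat a \<upsilon>)) summable_on I \<omega>"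
    using T_summable[OF b1(1) X(2)] by (simp add: y_def I_eq)
  have s3: "(\<lambda>a. x a * one (case_nat a \<omega>)) summable_on I \<omega>"
    using T_summable[OF b1(2) X(1)] by (simp add: x_def)
  have s4: "(\<lambda>a. y a * g2 (case_nat a \<upsilon>)) summable_on I \<omega>"
    using T_summable[OF b1(3) X(2)] by (simp add: y_def I_eq)
  have E1: "1 \<le> E" using K_nonneg theta d_nonneg[of \<omega> \<upsilon>]
    by (auto simp: E_def intro!: mult_nonneg_nonneg mult_left_le_one_le)
  have E_mult: "E * exp (K * (\<theta> * ?d)) = exp (K * ?d)"
    unfolding E_def exp_add[symmetric] by (simp add: algebra_simps)
  have xy: "x a \<le> E * y a" "\<bar>x a - y a\<bar> \<le> (E - 1) * y a" if a: "a \<in> I \<omega>" for a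
  proof -
    define D where "D = \<phi> (case_nat a \<omega>) - \<phi> (case_nat a \<upsilon>)"
    have D: "\<bar>D\<bar> \<le> (K - \<theta> * K) * ?d" unfolding D_def using phi_diff[OF X a] .
    have xD: "x a = exp D * y a" by (simp add: x_def y_def D_def exp_diff)
    have "exp D \<le> E" unfolding E_def using D by simp
    moreover have "2 - E \<le> exp D"
    proof -
      have "1 / E \<le> exp D" unfolding E_def using D by (simp add: exp_minus[symmetric] inverse_eq_divide[symmetric])
      \<comment> \<open>From \<open>E + 1 / E \<ge> 2\<close>: the weight ratio falls below 1 by no
        more than it may exceed 1, namely \<open>E - 1\<close>.\<close>
      moreover have "2 - E \<le> 1 / E"
      proof -
        have "0 \<le> (E - 1)\<^sup>2 / E" using E1 by simp
        then show ?thesis using E1 by (simp add: field_simps power2_eq_square)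
      qed
      ultimately show ?thesis by simp
    qed
    moreover have "0 < y a" by (simp add: y_def)
    moreover have "x a - y a = (exp D - 1) * y a" by (simp add: xD algebra_simps)
    ultimately show "x a \<le> E * y a" "\<bar>x a - y a\<bar> \<le> (E - 1) * y a"
      by (auto simp: xD abs_mult)
  qed
  have bound: "norm (x a *\<^sub>R g1 (case_nat a \<omega>) - y a *\<^sub>R g1 (case_nat a \<upsilon>)) \<le>
     \<theta> ^ Suc n * G * ?d * (x a * one (case_nat a \<omega>)) + (exp (K * ?d) - 1) * (y a * g2 (case_nat a \<upsilon>))"
    if a: "a \<in> I \<omega>" for a
  proof -
    let ?v = "case_nat a \<omega>" and ?w = "case_nat a \<upsilon>"
    have ih: "norm (g1 ?v - g1 ?w) \<le> \<theta> ^ n * G * (\<theta> * ?d) * one ?v + (exp (K * (\<theta> * ?d)) - 1) * g2 ?w"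
      using Suc.IH[OF in_X[OF a]] by (simp add: g1_def g2_def one_def d_theta_Cons)
    have g12: "norm (g1 ?w) \<le> g2 ?w" unfolding g1_def g2_def by (rule Tn_norm[OF g in_X(2)[OF a]])
    have g20: "0 \<le> g2 ?w" using norm_ge_zero g12 order_trans by blast
    have e0: "0 \<le> exp (K * (\<theta> * ?d)) - 1" using K_nonneg theta d_nonneg[of \<omega> \<upsilon>] by simp
    have x0: "0 \<le> x a" by (simp add: x_def)
    \<comment> \<open>In this splitting the difference of weights meets the value over
      \<open>\<upsilon>\<close>, while the difference of values keeps the weight over
      \<open>\<omega>\<close>; hence the two base points in the claim.\<close>
    have "x a *\<^sub>R g1 ?v - y a *\<^sub>R g1 ?w = x a *\<^sub>R (g1 ?v - g1 ?w) + (x a - y a) *\<^sub>R g1 ?w"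
      by (simp add: algebra_simps)
    then have "norm (x a *\<^sub>R g1 ?v - y a *\<^sub>R g1 ?w) \<le>
        x a * norm (g1 ?v - g1 ?w) + \<bar>x a - y a\<bar> * norm (g1 ?w)"
      using norm_triangle_ineq[of "x a *\<^sub>R (g1 ?v - g1 ?w)" "(x a - y a) *\<^sub>R g1 ?w"] x0 by simp
    also have "\<dots> \<le> x a * (\<theta> ^ n * G * (\<theta> * ?d) * one ?v + (exp (K * (\<theta> * ?d)) - 1) * g2 ?w)
        + ((E - 1) * y a) * g2 ?w"
      using ih xy(2)[OF a] g12 x0 g20 by (intro add_mono mult_left_mono mult_mono) auto
    also have "\<dots> = \<theta> ^ Suc n * G * ?d * (x a * one ?v)
        + (x a * ((exp (K * (\<theta> * ?d)) - 1) * g2 ?w) + ((E - 1) * y a) * g2 ?w)"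
      by (simp add: algebra_simps)
    also have "x a * ((exp (K * (\<theta> * ?d)) - 1) * g2 ?w) \<le> (E * y a) * ((exp (K * (\<theta> * ?d)) - 1) * g2 ?w)"
      using xy(1)[OF a] e0 g20 by (intro mult_right_mono mult_nonneg_nonneg)
    also have "(E * y a) * ((exp (K * (\<theta> * ?d)) - 1) * g2 ?w) + ((E - 1) * y a) * g2 ?w
        = (E * exp (K * (\<theta> * ?d)) - 1) * (y a * g2 ?w)"
      by (simp add: algebra_simps)
    finally show ?thesis unfolding E_mult by simp
  qed
  have sum_bound: "(\<lambda>a. \<theta> ^ Suc n * G * ?d * (x a * one (case_nat a \<omega>))
      + (exp (K * ?d) - 1) * (y a * g2 (case_nat a \<upsilon>))) summable_on I \<omega>"
    by (intro summable_on_add summable_on_cmult_right s3 s4)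
  have "(T ^^ Suc n) g \<omega> - (T ^^ Suc n) g \<upsilon> =
      (\<Sum>\<^sub>\<infinity>a\<in>I \<omega>. x a *\<^sub>R g1 (case_nat a \<omega>)) - (\<Sum>\<^sub>\<infinity>a\<in>I \<omega>. y a *\<^sub>R g1 (case_nat a \<upsilon>))"
    using X by (simp add: T_def g1_def x_def y_def I_eq)
  also have "\<dots> = (\<Sum>\<^sub>\<infinity>a\<in>I \<omega>. x a *\<^sub>R g1 (case_nat a \<omega>) - y a *\<^sub>R g1 (case_nat a \<upsilon>))"
    using has_sum_add[OF has_sum_infsum[OF s1] has_sum_infsum[OF summable_on_uminus[THEN iffD2, OF s2]]]
    by (simp add: infsum_uminus infsumI)
  also have "norm \<dots> \<le> (\<Sum>\<^sub>\<infinity>a\<in>I \<omega>. norm (x a *\<^sub>R g1 (case_nat a \<omega>) - y a *\<^sub>R g1 (case_nat a \<upsilon>)))"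
    by (rule norm_infsum_bound[OF Infinite_Sum.abs_summable_on_comparison_test'[OF sum_bound bound]])
  also have "\<dots> \<le> (\<Sum>\<^sub>\<infinity>a\<in>I \<omega>. \<theta> ^ Suc n * G * ?d * (x a * one (case_nat a \<omega>))
      + (exp (K * ?d) - 1) * (y a * g2 (case_nat a \<upsilon>)))"
    by (rule infsum_mono[OF Infinite_Sum.abs_summable_on_comparison_test'[OF sum_bound bound] sum_bound bound])
  also have "\<dots> = \<theta> ^ Suc n * G * ?d * (\<Sum>\<^sub>\<infinity>a\<in>I \<omega>. x a * one (case_nat a \<omega>))
      + (exp (K * ?d) - 1) * (\<Sum>\<^sub>\<infinity>a\<in>I \<omega>. y a * g2 (case_nat a \<upsilon>))"
    by (subst infsum_add) (auto intro!: summable_on_cmult_right s3 s4 simp: infsum_cmult_right')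
  also have "\<dots> = \<theta> ^ Suc n * G * ?d * (T ^^ Suc n) (\<lambda>_. 1) \<omega>
      + (exp (K * ?d) - 1) * (T ^^ Suc n) (\<lambda>\<upsilon>. norm (g \<upsilon>)) \<upsilon>"
    using X by (simp add: T_def one_def g2_def x_def y_def I_eq)
  finally show ?case .
qed

text \<open>Linearizes the distortion factor: \<open>exp (K * x) - 1 \<le> E * x\<close> for
  \<open>0 \<le> x \<le> 1\<close>, the range of the metric.\<close>

definition E :: real where "E = K * exp K"

lemma E_nonneg: "0 \<le> E"
  unfolding E_def using K_nonneg by simp

lemma exp_K_le: "exp (K * d \<omega> \<upsilon>) - 1 \<le> E * d \<omega> \<upsilon>"
proof -
  define x where "x = K * d \<omega> \<upsilon>"
  have x: "0 \<le> x" "x \<le> K"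
    using K_nonneg d_nonneg[of \<omega> \<upsilon>] d_theta_le_1[OF theta, of \<omega> \<upsilon>] by (auto simp: x_def mult_left_le)
  have "1 - x \<le> exp (- x)" using exp_ge_add_one_self[of "- x"] by simp
  then have "exp x * (1 - x) \<le> exp x * exp (- x)" by simp
  then have "exp x - 1 \<le> x * exp x" by (simp add: exp_minus algebra_simps)
  also have "\<dots> \<le> x * exp K" using x by (intro mult_left_mono) auto
  finally show ?thesis by (simp add: x_def E_def algebra_simps)
qed

text \<open>The bound \<open>\<tau>\<close> on the iterates of \<open>|f|\<close> is kept apart from
  \<open>N f\<close>: when \<open>f\<close> is small in a weak sense, \<open>\<tau>\<close> is small
  as well and only the term with \<open>\<theta> ^ n\<close> sees the full norm.\<close>

lemma Tn_Fb:
  assumes f: "f \<in> W"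
    and \<rho>: "\<And>\<omega>. \<omega> \<in> X \<Longrightarrow> (T ^^ n) (\<lambda>_. 1) \<omega> \<le> \<rho>" "0 \<le> \<rho>"
    and \<tau>: "\<And>\<omega>. \<omega> \<in> X \<Longrightarrow> (T ^^ n) (\<lambda>\<upsilon>. cmod (f \<upsilon>)) \<omega> \<le> \<tau>" "0 \<le> \<tau>"
  shows "(T ^^ n) f \<in> W" "N ((T ^^ n) f) \<le> \<theta> ^ n * \<rho> * N f + (1 + E) * \<tau>"
proof -
  have b: "bddX f" by (rule bddX_W[OF f])
  have n: "cmod ((T ^^ n) f \<omega>) \<le> \<tau>" if "\<omega> \<in> X" for \<omega>
    using Tn_norm[OF b that] \<tau>(1)[OF that] order_trans by blast
  have z: "(T ^^ n) f \<omega> = 0" if "\<omega> \<notin> X" for \<omega>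
    using that FbD(1)[OF f] by (cases n) (auto simp: T_outside)
  have l: "cmod ((T ^^ n) f \<omega> - (T ^^ n) f \<upsilon>) \<le> (\<theta> ^ n * \<rho> * ls \<theta> X f + E * \<tau>) * d \<omega> \<upsilon>"
    if X: "\<omega> \<in> X" "\<upsilon> \<in> X" "\<omega> 0 = \<upsilon> 0" for \<omega> \<upsilon>
  proof -
    have "cmod ((T ^^ n) f \<omega> - (T ^^ n) f \<upsilon>) \<le>
     \<theta> ^ n * ls \<theta> X f * d \<omega> \<upsilon> * (T ^^ n) (\<lambda>_. 1) \<omega>
     + (exp (K * d \<omega> \<upsilon>) - 1) * (T ^^ n) (\<lambda>\<upsilon>. norm (f \<upsilon>)) \<upsilon>"
      by (rule lasota_yorke[OF b FbD(6)[OF f] FbD(3)[OF f] X])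
    also have "\<dots> \<le> \<theta> ^ n * ls \<theta> X f * d \<omega> \<upsilon> * \<rho> + (E * d \<omega> \<upsilon>) * \<tau>"
      using theta FbD(6)[OF f] d_nonneg[of \<omega> \<upsilon>] \<rho>(1)[OF X(1)] \<tau>(1)[OF X(2)] exp_K_le[of \<omega> \<upsilon>] E_nonneg
        Tn_nonneg[of "\<lambda>\<upsilon>. norm (f \<upsilon>)" \<upsilon> n] X
      by (intro add_mono mult_left_mono mult_mono mult_nonneg_nonneg) auto
    finally show ?thesis by (simp add: algebra_simps)
  qed
  have nn: "0 \<le> \<theta> ^ n * \<rho> * ls \<theta> X f + E * \<tau>"
    using theta \<rho>(2) \<tau>(2) FbD(6)[OF f] E_nonneg by simp
  note I = FbI[OF z \<tau>(2) n nn l]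
  show "(T ^^ n) f \<in> W" by (rule I(1))
  have "N ((T ^^ n) f) \<le> \<tau> + (\<theta> ^ n * \<rho> * ls \<theta> X f + E * \<tau>)" by (rule I(4))
  moreover have "\<theta> ^ n * \<rho> * ls \<theta> X f \<le> \<theta> ^ n * \<rho> * N f"
    using theta \<rho>(2) FbD(4-6)[OF f] by (intro mult_left_mono) auto
  ultimately show "N ((T ^^ n) f) \<le> \<theta> ^ n * \<rho> * N f + (1 + E) * \<tau>" by (simp add: algebra_simps)
qed

lemma Tn_norm_le:
  assumes f: "f \<in> W" and \<rho>: "\<And>\<omega>. \<omega> \<in> X \<Longrightarrow> (T ^^ n) (\<lambda>_. 1) \<omega> \<le> \<rho>" "0 \<le> \<rho>"
  shows "N ((T ^^ n) f) \<le> (2 + E) * \<rho> * N f"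
proof -
  have b: "bddX (\<lambda>\<upsilon>. cmod (f \<upsilon>))" by (intro bddX_norm bddX_W f)
  have "(T ^^ n) (\<lambda>\<upsilon>. cmod (f \<upsilon>)) \<omega> \<le> N f * \<rho>" if "\<omega> \<in> X" for \<omega>
    using Tn_le_one[OF b pointwise_le[OF f] that, of n] mult_left_mono[OF \<rho>(1)[OF that] N_nonneg[OF f]]
    by linarith
  then have "N ((T ^^ n) f) \<le> \<theta> ^ n * \<rho> * N f + (1 + E) * (N f * \<rho>)"
    by (intro Tn_Fb f \<rho>) (use N_nonneg[OF f] \<rho>(2) in auto)
  moreover have "\<theta> ^ n * (\<rho> * N f) \<le> 1 * (\<rho> * N f)"
    using theta \<rho>(2) N_nonneg[OF f] by (intro mult_right_mono power_le_one) auto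
  ultimately show ?thesis by (simp add: algebra_simps)
qed

lemma T_one_le: "T (\<lambda>_. 1) \<omega> \<le> P"
  using T_le[of "\<lambda>_. 1" 1 \<omega>] by simp

lemma bop_T: "bop T"
proof (rule bopI[of _ "(2 + E) * P"])
  fix f assume f: "f \<in> W"
  show "N (T f) \<le> (2 + E) * P * N f"
    using Tn_norm_le[of f 1 P] f T_one_le P_nonneg by simp
  show "T f \<in> W"
    using Tn_Fb(1)[of f 1 P "N f * P"] f T_one_le P_nonneg N_nonneg[OF f] T_le[of "\<lambda>\<upsilon>. cmod (f \<upsilon>)" "N f"]
      pointwise_le[OF f] by (simp add: mult.commute)
qed (auto simp: T_add T_mult bddX_W)

end

lemma tendsto_zero_squeeze:
  fixes f g :: "'a \<Rightarrow> real"
  assumes "\<And>k. 0 \<le> f k" "\<And>k. f k \<le> g k" "(g \<longlongrightarrow> 0) F"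
  shows "(f \<longlongrightarrow> 0) F"
  by (rule tendsto_sandwich[OF _ _ tendsto_const assms(3)]) (simp_all add: assms)

context transfer
begin

section \<open>Growth bounds, limits along filters and invertibility\<close>

definition grows :: "real \<Rightarrow> bool" where
  "grows r \<longleftrightarrow> (\<exists>C\<ge>0. \<forall>n. \<forall>\<omega>\<in>X. (T ^^ n) (\<lambda>_. 1) \<omega> \<le> C * r ^ n)"

text \<open>By \<open>Tn_norm_le\<close> the operator norms of the iterates grow no faster than
  \<open>sup (T\<^sup>n 1)\<close>, up to the factor \<open>2 + E\<close>, so the Neumann series is
  dominated by a geometric one of ratio \<open>r / cmod z\<close>.\<close>

lemma resolvent_beyond:
  assumes "grows r" "0 < r" "r < cmod z"
  shows "is_resolvent T z (\<lambda>f x. \<Sum>n. (T ^^ n) f x / z ^ Suc n)"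
    and "f \<in> W \<Longrightarrow> (\<lambda>n. (T ^^ n) f x / z ^ Suc n) sums (\<Sum>n. (T ^^ n) f x / z ^ Suc n)"
proof -
  obtain C where C: "0 \<le> C" "\<And>n \<omega>. \<omega> \<in> X \<Longrightarrow> (T ^^ n) (\<lambda>_. 1) \<omega> \<le> C * r ^ n"
    using assms(1) by (auto simp: grows_def)
  have c: "N ((T ^^ n) f) \<le> ((2 + E) * (C * r ^ n)) * N f" if "f \<in> W" for n f
    using Tn_norm_le[OF that C(2), of n] C(1) assms(2) by simp
  have "(\<lambda>n. (2 + E) * (C * r ^ n) / cmod z ^ Suc n) = (\<lambda>n. ((2 + E) * C / cmod z) * (r / cmod z) ^ n)"
    by (simp add: power_divide fun_eq_iff)
  moreover have "summable (\<lambda>n. ((2 + E) * C / cmod z) * (r / cmod z) ^ n)"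
    using assms(2,3) by (intro summable_mult summable_geometric) (simp add: divide_less_eq)
  ultimately have s: "summable (\<lambda>n. (2 + E) * (C * r ^ n) / cmod z ^ Suc n)" by simp
  have z: "z \<noteq> 0" using assms(2,3) by auto
  show "is_resolvent T z (\<lambda>f x. \<Sum>n. (T ^^ n) f x / z ^ Suc n)"
    by (rule neumann(1)[OF bop_T c z s])
  show "f \<in> W \<Longrightarrow> (\<lambda>n. (T ^^ n) f x / z ^ Suc n) sums (\<Sum>n. (T ^^ n) f x / z ^ Suc n)"
    by (rule neumann(2)[OF bop_T c z s])
qed

text \<open>Dominated convergence along an arbitrary filter: the tail over letters is uniformly
  small, and on the finitely many remaining letters pointwise convergence suffices.\<close>

lemma T_small:
  fixes q :: "nat \<Rightarrow> (nat \<Rightarrow> 's) \<Rightarrow> real"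
  assumes q: "\<And>k \<omega>. \<omega> \<in> X \<Longrightarrow> 0 \<le> q k \<omega>" "\<And>k \<omega>. \<omega> \<in> X \<Longrightarrow> q k \<omega> \<le> B" and B: "0 \<le> B"
    and lim: "\<And>\<omega>. \<omega> \<in> X \<Longrightarrow> ((\<lambda>k. q k \<omega>) \<longlongrightarrow> 0) F" and \<omega>: "\<omega> \<in> X"
  shows "((\<lambda>k. T (q k) \<omega>) \<longlongrightarrow> 0) F"
proof (rule tendstoI)
  fix e :: real assume "0 < e"
  then have "0 < e / (2 * (B + 1))" using B by simp
  then obtain G where G: "finite G" "infsum p (S - G) \<le> e / (2 * (B + 1))"
    by (rule tail_small)
  have "((\<lambda>k. \<Sum>a\<in>G \<inter> I \<omega>. exp (\<phi> (case_nat a \<omega>)) * q k (case_nat a \<omega>)) \<longlongrightarrow>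
      (\<Sum>a\<in>G \<inter> I \<omega>. exp (\<phi> (case_nat a \<omega>)) * 0)) F"
    by (intro tendsto_intros lim Cons_in_X \<omega>) auto
  then have "eventually (\<lambda>k. (\<Sum>a\<in>G \<inter> I \<omega>. exp (\<phi> (case_nat a \<omega>)) * q k (case_nat a \<omega>)) < e / 2) F"
    using \<open>0 < e\<close> by (intro order_tendstoD) auto
  then show "eventually (\<lambda>k. dist (T (q k) \<omega>) 0 < e) F"
  proof (rule eventually_mono)
    fix k assume k: "(\<Sum>a\<in>G \<inter> I \<omega>. exp (\<phi> (case_nat a \<omega>)) * q k (case_nat a \<omega>)) < e / 2"
    have "B * infsum p (S - G) \<le> B * (e / (2 * (B + 1)))" by (intro mult_left_mono G B)
    also have "\<dots> \<le> e / 2" using B \<open>0 < e\<close> by (simp add: divide_simps)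
    finally have "T (q k) \<omega> < e" using T_split[of "q k" B \<omega> G, OF q B \<omega> G(1)] k by linarith
    moreover have "0 \<le> T (q k) \<omega>" by (rule T_nonneg[OF q(1)])
    ultimately show "dist (T (q k) \<omega>) 0 < e" by simp
  qed
qed

lemma T_limit:
  assumes g: "\<And>k. g k \<in> W" "\<And>k. N (g k) \<le> B" and g': "g' \<in> W"
    and lim: "\<And>\<omega>. ((\<lambda>k::nat. g k \<omega>) \<longlongrightarrow> g' \<omega>) F"
  shows "((\<lambda>k. T (g k) \<omega>) \<longlongrightarrow> T g' \<omega>) F"
proof (cases "\<omega> \<in> X")
  case True
  define q where "q k \<omega> = cmod (g k \<omega> - g' \<omega>)" for k \<omega>
  have "((\<lambda>k. T (q k) \<omega>) \<longlongrightarrow> 0) F"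
  proof (rule T_small[OF _ _ _ _ True])
    show "q k \<upsilon> \<le> B + N g'" for k \<upsilon>
      using norm_triangle_ineq4[of "g k \<upsilon>" "g' \<upsilon>"] pointwise_le[OF g(1), of k \<upsilon>] g(2)[of k]
        pointwise_le[OF g', of \<upsilon>] unfolding q_def by linarith
    show "0 \<le> B + N g'" using N_nonneg[OF g(1)] g(2) N_nonneg[OF g'] by (meson add_nonneg_nonneg order_trans)
    show "((\<lambda>k. q k \<upsilon>) \<longlongrightarrow> 0) F" for \<upsilon>
      unfolding q_def using lim[of \<upsilon>] by (simp add: tendsto_norm_zero_iff Lim_null[symmetric])
  qed (simp add: q_def)
  moreover have "cmod (T (g k) \<omega> - T g' \<omega>) \<le> T (q k) \<omega>" for k
    using T_norm[OF bddX_W[OF diff_mem[OF g(1) g']], of k \<omega>] T_diff[OF bddX_W[OF g(1)] bddX_W[OF g'], of k \<omega>]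
    by (simp add: q_def[abs_def])
  ultimately have "((\<lambda>k. T (g k) \<omega> - T g' \<omega>) \<longlongrightarrow> 0) F"
    by (rule Lim_null_comparison[OF always_eventually[OF allI], rotated])
  then show ?thesis by (subst Lim_null)
qed (simp add: T_outside)

text \<open>Cylinders need not be compact, so pointwise convergence is not uniform on them; each
  application of \<open>T\<close> removes one letter from the cylinders on which smallness is uniform.\<close>

lemma Tn_uniformly_small:
  fixes q :: "nat \<Rightarrow> (nat \<Rightarrow> 's) \<Rightarrow> real"
  assumes q: "\<And>k \<omega>. \<omega> \<in> X \<Longrightarrow> 0 \<le> q k \<omega>" "\<And>k \<omega>. \<omega> \<in> X \<Longrightarrow> q k \<omega> \<le> B" and B: "0 \<le> B" and "0 \<le> \<delta>"
    and base: "\<And>\<upsilon> e. 0 < e \<Longrightarrow> eventually (\<lambda>k. \<forall>\<omega>\<in>X. (\<forall>i<n. \<omega> i = \<upsilon> i) \<longrightarrow> q k \<omega> \<le> \<delta> + e) F"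
  shows "m \<le> n \<Longrightarrow> 0 < e \<Longrightarrow>
    eventually (\<lambda>k. \<forall>\<omega>\<in>X. (\<forall>i<n - m. \<omega> i = \<upsilon> i) \<longrightarrow>
      (T ^^ m) (q k) \<omega> \<le> \<delta> * (T ^^ m) (\<lambda>_. 1) \<omega> + e) F"
proof (induction m arbitrary: \<upsilon> e)
  case 0
  then show ?case using base by simp
next
  case (Suc m)
  have bq: "bddX (q k)" for k using q by (intro bddXI[of _ B]) auto
  define one where "one = (T ^^ m) (\<lambda>_. 1::real)"
  have b1: "bddX one" unfolding one_def by (intro bddX_Tn bddX_const)
  obtain C where C: "0 \<le> C" "\<And>\<omega>. \<omega> \<in> X \<Longrightarrow> norm (one \<omega>) \<le> C" using bddXE[OF b1] by blast
  have one0: "0 \<le> one \<omega>" if "\<omega> \<in> X" for \<omega> unfolding one_def by (rule Tn_nonneg[OF _ that]) simp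
  define Q where "Q k = (T ^^ m) (q k)" for k
  have Q0: "0 \<le> Q k \<omega>" if "\<omega> \<in> X" for k \<omega> unfolding Q_def by (rule Tn_nonneg[OF q(1) that])
  have QB: "Q k \<omega> \<le> B * C" if "\<omega> \<in> X" for k \<omega>
  proof -
    have "Q k \<omega> \<le> B * one \<omega>" unfolding Q_def one_def by (rule Tn_le_one[OF bq q(2) that])
    also have "\<dots> \<le> B * C" using C(2)[OF that] B by (intro mult_left_mono) auto
    finally show ?thesis .
  qed
  have BC: "0 \<le> B * C" using B C by simp
  then have "0 < e / (2 * (B * C + 1))" using Suc.prems by simp
  then obtain G where G: "finite G" "infsum p (S - G) \<le> e / (2 * (B * C + 1))"
    by (rule tail_small)
  \<comment> \<open>The letters of \<open>G\<close> have total weight at most \<open>P\<close>, so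
    an error \<open>e'\<close> at each of them costs at most \<open>e / 2\<close>; the letters
    outside \<open>G\<close> cost the other half.\<close>
  define e' where "e' = e / (2 * (P + 1))"
  have e': "0 < e'" using Suc.prems P_nonneg by (simp add: e'_def)
  \<comment> \<open>Only the finitely many prefixes beginning with a letter of \<open>G\<close> have
    to be controlled at the same time.\<close>
  have "eventually (\<lambda>k. \<forall>a\<in>G. \<forall>\<omega>\<in>X. (\<forall>i<n - m. \<omega> i = case_nat a \<upsilon> i) \<longrightarrow> Q k \<omega> \<le> \<delta> * one \<omega> + e') F"
    unfolding Q_def one_def using Suc.IH[OF _ e'] Suc.prems G(1) by (intro eventually_ball_finite) auto
  then show ?case
  proof (rule eventually_mono, intro ballI impI)
    fix k \<omega>
    assume k: "\<forall>a\<in>G. \<forall>\<omega>\<in>X. (\<forall>i<n - m. \<omega> i = case_nat a \<upsilon> i) \<longrightarrow> Q k \<omega> \<le> \<delta> * one \<omega> + e'"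
      and \<omega>: "\<omega> \<in> X" and ag: "\<forall>i<n - Suc m. \<omega> i = \<upsilon> i"
    define x where "x a = exp (\<phi> (case_nat a \<omega>))" for a
    have "Q k (case_nat a \<omega>) \<le> \<delta> * one (case_nat a \<omega>) + e'" if "a \<in> G \<inter> I \<omega>" for a
    proof -
      have "\<forall>i<n - m. case_nat a \<omega> i = case_nat a \<upsilon> i"
        using ag by (auto split: nat.split)
      then show ?thesis using k that Cons_in_X[OF \<omega>] by blast
    qed
    then have "(\<Sum>a\<in>G \<inter> I \<omega>. x a * Q k (case_nat a \<omega>))
        \<le> (\<Sum>a\<in>G \<inter> I \<omega>. x a * (\<delta> * one (case_nat a \<omega>) + e'))"
      by (intro sum_mono mult_left_mono) (auto simp: x_def)
    also have "\<dots> = \<delta> * (\<Sum>a\<in>G \<inter> I \<omega>. x a * one (case_nat a \<omega>)) + e' * (\<Sum>a\<in>G \<inter> I \<omega>. x a * 1)"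
      by (simp add: sum_distrib_left sum.distrib algebra_simps)
    also have "\<dots> \<le> \<delta> * T one \<omega> + e' * P"
    proof (intro add_mono mult_left_mono)
      show "(\<Sum>a\<in>G \<inter> I \<omega>. x a * one (case_nat a \<omega>)) \<le> T one \<omega>"
        unfolding x_def by (rule T_ge_sum[OF b1 one0 \<omega>]) (use G in auto)
      have "(\<Sum>a\<in>G \<inter> I \<omega>. x a * 1) \<le> T (\<lambda>_. 1) \<omega>"
        unfolding x_def by (rule T_ge_sum[OF bddX_const _ \<omega>]) (use G in auto)
      then show "(\<Sum>a\<in>G \<inter> I \<omega>. x a * 1) \<le> P" using T_one_le order_trans by blast
    qed (use e' \<open>0 \<le> \<delta>\<close> in auto)
    finally have 1: "(\<Sum>a\<in>G \<inter> I \<omega>. x a * Q k (case_nat a \<omega>)) \<le> \<delta> * T one \<omega> + e' * P" .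
    have 2: "e' * P \<le> e / 2" unfolding e'_def using P_nonneg Suc.prems by (simp add: field_simps)
    have "(B * C) * infsum p (S - G) \<le> (B * C) * (e / (2 * (B * C + 1)))" by (intro mult_left_mono G BC)
    also have "\<dots> \<le> e / 2" using BC Suc.prems by (simp add: field_simps)
    finally have 3: "(B * C) * infsum p (S - G) \<le> e / 2" .
    have "T (Q k) \<omega> \<le> (\<Sum>a\<in>G \<inter> I \<omega>. x a * Q k (case_nat a \<omega>)) + (B * C) * infsum p (S - G)"
      unfolding x_def by (rule T_split[OF Q0 QB BC \<omega> G(1)])
    then have "T (Q k) \<omega> \<le> \<delta> * T one \<omega> + e" using 1 2 3 by linarith
    then show "(T ^^ Suc m) (q k) \<omega> \<le> \<delta> * (T ^^ Suc m) (\<lambda>_. 1) \<omega> + e" by (simp add: Q_def one_def)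
  qed
qed

text \<open>Approximate eigenfunctions cannot escape to infinity: the essential spectral radius is at most
  \<open>\<theta>\<close> times the growth rate.\<close>

lemma approximate_eigenfunctions_vanish:
  assumes gr: "grows r" "0 < r" "\<theta> * r < lam"
    and g: "\<And>k. g k \<in> W" "\<And>k. N (g k) \<le> B"
    and lim: "\<And>\<omega>. \<omega> \<in> X \<Longrightarrow> ((\<lambda>k. g k \<omega>) \<longlongrightarrow> 0) F"
    and approx: "((\<lambda>k::nat. N (scalar_minus (of_real lam) T (g k))) \<longlongrightarrow> 0) F"
  shows "((\<lambda>k. N (g k)) \<longlongrightarrow> 0) F"
proof (rule tendstoI)
  fix e :: real assume e: "0 < e"
  have lam: "0 < lam" using gr(2,3) theta by (smt (verit) mult_pos_pos)
  obtain C where C: "0 \<le> C" "\<And>n \<omega>. \<omega> \<in> X \<Longrightarrow> (T ^^ n) (\<lambda>_. 1) \<omega> \<le> C * r ^ n"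
    using gr(1) by (auto simp: grows_def)
  have B: "0 \<le> B" using N_nonneg[OF g(1)] g(2) order_trans by blast
  \<comment> \<open>The Lipschitz terms of the \<open>n\<close>-th iterate after division by
    \<open>lam ^ n\<close>; they decay because \<open>\<theta> * r < lam\<close>.\<close>
  have "(\<lambda>n. (2 + E) * B * C * (\<theta> * r / lam) ^ n) \<longlonglongrightarrow> (2 + E) * B * C * 0"
    using gr theta lam by (intro tendsto_intros LIMSEQ_realpow_zero) auto
  then have "eventually (\<lambda>n. (2 + E) * B * C * (\<theta> * r / lam) ^ n < e / 2) sequentially"
    using e by (intro order_tendstoD) auto
  from eventually_happens'[OF sequentially_bot eventually_conj[OF this eventually_ge_at_top[of 1]]]
  obtain n where n: "(2 + E) * B * C * (\<theta> * r / lam) ^ n < e / 2" "1 \<le> n" by blast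
  \<comment> \<open>Chosen so that the remaining errors, \<open>(2 + E) * e1\<close> in total,
    amount to \<open>lam ^ n * e / 2\<close>.\<close>
  define e1 where "e1 = lam ^ n * e / (2 * (2 + E))"
  have e1: "0 < e1" using lam e E_nonneg by (simp add: e1_def)
  \<comment> \<open>Telescoping: the defect of order \<open>m + 1\<close> is \<open>lam ^ m\<close>
    times the first-order defect plus the image under \<open>T\<close> of the defect of order
    \<open>m\<close>.\<close>
  have D: "((\<lambda>k. N (\<lambda>x. of_real (lam ^ m) * g k x - (T ^^ m) (g k) x)) \<longlongrightarrow> 0) F" for m
  proof (induction m)
    case 0
    then show ?case by (simp add: N_zero)
  next
    case (Suc m)
    obtain c where c: "0 < c" "\<And>f. f \<in> W \<Longrightarrow> N (T f) \<le> c * N f" using bop_bound[OF bop_T] by blast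
    define D where "D k = (\<lambda>x. of_real (lam ^ m) * g k x - (T ^^ m) (g k) x)" for k
    have Dm: "D k \<in> W" for k
      unfolding D_def by (intro diff_mem scale_mem g bop_funpow_mem bop_T)
    have sm: "scalar_minus (of_real lam) T (g k) \<in> W" for k
      by (rule bop_mem[OF bop_scalar_minus[OF bop_T] g(1)])
    define D' where "D' k = (\<lambda>x. of_real (lam ^ Suc m) * g k x - (T ^^ Suc m) (g k) x)" for k
    have "D' k = (\<lambda>x. of_real (lam ^ m) * scalar_minus (of_real lam) T (g k) x + T (D k) x)" for k
      unfolding D_def D'_def bop_diff[OF bop_T scale_mem[OF g(1)] bop_funpow_mem[OF bop_T g(1)]]
        bop_scale[OF bop_T g(1)]
      by (simp add: scalar_minus_def algebra_simps)
    then have "N (D' k) \<le> cmod (of_real (lam ^ m)) * N (scalar_minus (of_real lam) T (g k)) + c * N (D k)" for k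
      using N_add[OF scale_mem[OF sm, of "of_real (lam ^ m)"] bop_mem[OF bop_T Dm], of k k]
        c(2)[OF Dm, of k] N_scale[OF sm, of "of_real (lam ^ m)" k] by simp
    then have "N (D' k) \<le> lam ^ m * N (scalar_minus (of_real lam) T (g k)) + c * N (D k)" for k
      using lam by (simp add: norm_power)
    moreover have "((\<lambda>k. lam ^ m * N (scalar_minus (of_real lam) T (g k)) + c * N (D k)) \<longlongrightarrow> lam ^ m * 0 + c * 0) F"
      unfolding D_def by (intro tendsto_intros approx Suc)
    moreover have "0 \<le> N (D' k)" for k
      unfolding D'_def by (intro N_nonneg diff_mem scale_mem g bop_funpow_mem bop_T)
    ultimately have "((\<lambda>k. N (D' k)) \<longlongrightarrow> 0) F"
      using tendsto_zero_squeeze[of "\<lambda>k. N (D' k)"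
          "\<lambda>k. lam ^ m * N (scalar_minus (of_real lam) T (g k)) + c * N (D k)" F] by simp
    then show ?case by (simp add: D'_def)
  qed
  \<comment> \<open>With \<open>m = n\<close> the prefix condition is empty, so the estimate is
    uniform on \<open>X\<close>; \<open>undefined\<close> only fills the argument. Its base case: on
    an \<open>n\<close>-cylinder \<open>g k\<close> stays within \<open>B * \<theta> ^ n\<close> of
    its value at one point, and that value tends to zero.\<close>
  have small: "eventually (\<lambda>k. \<forall>\<omega>\<in>X. (\<forall>i<n - n. \<omega> i = undefined i) \<longrightarrow>
     (T ^^ n) (\<lambda>\<omega>. cmod (g k \<omega>)) \<omega> \<le> (B * \<theta> ^ n) * (T ^^ n) (\<lambda>_. 1) \<omega> + e1) F"
  proof (rule Tn_uniformly_small[OF _ _ B _ _ order_refl e1])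
    fix \<upsilon> :: "nat \<Rightarrow> 's" and e' :: real assume e': "0 < e'"
    show "eventually (\<lambda>k. \<forall>\<omega>\<in>X. (\<forall>i<n. \<omega> i = \<upsilon> i) \<longrightarrow> cmod (g k \<omega>) \<le> B * \<theta> ^ n + e') F"
    proof (cases "\<exists>\<omega>1\<in>X. \<forall>i<n. \<omega>1 i = \<upsilon> i")
      case True
      then obtain \<omega>1 where \<omega>1: "\<omega>1 \<in> X" "\<forall>i<n. \<omega>1 i = \<upsilon> i" by blast
      have "eventually (\<lambda>k. cmod (g k \<omega>1) < e') F"
        using tendstoD[OF lim[OF \<omega>1(1)] e'] by simp
      then show ?thesis
      proof (rule eventually_mono, intro ballI impI)
        fix k \<omega> assume k: "cmod (g k \<omega>1) < e'" and \<omega>: "\<omega> \<in> X" "\<forall>i<n. \<omega> i = \<upsilon> i"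
        have "cmod (g k \<omega> - g k \<omega>1) \<le> N (g k) * \<theta> ^ n"
          using \<omega> \<omega>1 n(2) by (intro lip_dist_le g) auto
        also have "\<dots> \<le> B * \<theta> ^ n" using theta by (intro mult_right_mono g) auto
        finally show "cmod (g k \<omega>) \<le> B * \<theta> ^ n + e'"
          using k norm_triangle_sub[of "g k \<omega>" "g k \<omega>1"] by linarith
      qed
    next
      case False
      then show ?thesis by (intro always_eventually) blast
    qed
  next
    show "cmod (g k \<omega>) \<le> B" for k \<omega> using order_trans[OF pointwise_le[OF g(1)] g(2)] .
  qed (use B theta in auto)
  have "eventually (\<lambda>k. N (\<lambda>x. of_real (lam ^ n) * g k x - (T ^^ n) (g k) x) < e1) F"
    using tendstoD[OF D[of n] e1] by (rule eventually_mono) (auto simp: dist_real_def)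
  with small show "eventually (\<lambda>k. dist (N (g k)) 0 < e) F"
  proof eventually_elim
    case (elim k)
    define \<rho> where "\<rho> = C * r ^ n"
    define \<tau> where "\<tau> = B * \<theta> ^ n * \<rho> + e1"
    have \<rho>: "0 \<le> \<rho>" using C gr by (simp add: \<rho>_def)
    have \<rho>1: "(T ^^ n) (\<lambda>_. 1) \<omega> \<le> \<rho>" if "\<omega> \<in> X" for \<omega> unfolding \<rho>_def by (rule C(2)[OF that])
    have "(T ^^ n) (\<lambda>\<omega>. cmod (g k \<omega>)) \<omega> \<le> \<tau>" if "\<omega> \<in> X" for \<omega>
    proof -
      have "(T ^^ n) (\<lambda>\<omega>. cmod (g k \<omega>)) \<omega> \<le> (B * \<theta> ^ n) * (T ^^ n) (\<lambda>_. 1) \<omega> + e1"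
        using elim(1) that by simp
      moreover have "(B * \<theta> ^ n) * (T ^^ n) (\<lambda>_. 1) \<omega> \<le> (B * \<theta> ^ n) * \<rho>"
        using B theta by (intro mult_left_mono \<rho>1 that) auto
      ultimately show ?thesis by (simp add: \<tau>_def)
    qed
    moreover have "0 \<le> \<tau>" using B \<rho> theta e1 by (simp add: \<tau>_def)
    ultimately have "N ((T ^^ n) (g k)) \<le> \<theta> ^ n * \<rho> * N (g k) + (1 + E) * \<tau>"
      by (intro Tn_Fb(2) g \<rho>1 \<rho>)
    also have "\<theta> ^ n * \<rho> * N (g k) \<le> \<theta> ^ n * \<rho> * B"
      using theta \<rho> by (intro mult_left_mono g) auto
    finally have 1: "N ((T ^^ n) (g k)) \<le> \<theta> ^ n * \<rho> * B + (1 + E) * \<tau>" by simp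
    define D where "D = (\<lambda>x. of_real (lam ^ n) * g k x - (T ^^ n) (g k) x)"
    have Dm: "D \<in> W" unfolding D_def by (intro diff_mem scale_mem g bop_funpow_mem bop_T)
    have "N (\<lambda>x. of_real (lam ^ n) * g k x) \<le> N D + N ((T ^^ n) (g k))"
      using N_add[OF Dm bop_funpow_mem[OF bop_T g(1), of n k]] by (simp add: D_def)
    then have "lam ^ n * N (g k) \<le> e1 + N ((T ^^ n) (g k))"
      using N_scale[OF g(1), of "of_real (lam ^ n)" k] elim(2) lam by (simp add: norm_power D_def)
    also have "\<dots> \<le> e1 + (\<theta> ^ n * \<rho> * B + (1 + E) * \<tau>)" using 1 by simp
    also have "\<dots> = (2 + E) * B * C * (\<theta> * r) ^ n + (2 + E) * e1"
      by (simp add: \<tau>_def \<rho>_def power_mult_distrib algebra_simps)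
    also have "\<dots> = lam ^ n * ((2 + E) * B * C * (\<theta> * r / lam) ^ n + e / 2)"
      using lam E_nonneg by (simp add: e1_def power_divide field_simps)
    also have "\<dots> < lam ^ n * e" using n(1) lam by (intro mult_strict_left_mono) auto
    finally have "N (g k) < e" using lam by simp
    then show ?case using N_nonneg[OF g(1), of k] by simp
  qed
qed

text \<open>Nonnegativity of \<open>u\<close> makes the Neumann series for \<open>R u w\<close>
  nonnegative at every real point beyond \<open>lam\<close>, so the Sherman-Morrison denominator
  cannot vanish there. Evaluation at \<open>w\<close> respects pointwise limits, so along a null
  sequence with limit zero the rank-one term drops out and the estimate for \<open>T\<close>
  applies. The case \<open>u = 0\<close> concerns \<open>T\<close> itself.\<close>

lemma fredholm:
  fixes lam :: real and u :: "(nat \<Rightarrow> 's) \<Rightarrow> complex" and ur :: "(nat \<Rightarrow> 's) \<Rightarrow> real"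
  assumes gr: "\<And>r. lam < r \<Longrightarrow> grows r" and lam: "0 < lam"
    and u: "u \<in> W" "\<And>x. u x = of_real (ur x)" "\<And>x. 0 \<le> ur x" and w: "w \<in> X"
    and inj: "\<And>g. g \<in> W \<Longrightarrow> (\<And>x. of_real lam * g x = T g x - g w * u x) \<Longrightarrow> g = (\<lambda>_. 0 :: complex)"
  shows "\<exists>R. is_resolvent (\<lambda>f x. T f x - f w * u x) (of_real lam) R"
proof -
  define Q :: "(nat \<Rightarrow> 's) operator" where "Q = (\<lambda>f x. T f x - f w * u x)"
  have bQ: "bop Q" unfolding Q_def by (rule bop_minus[OF bop_T bop_rank_one[OF u(1)]])
  note bS = bop_scalar_minus[OF bQ]
  have "\<exists>c>0. \<forall>f\<in>W. c * N f \<le> N (scalar_minus lam Q f)"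
  proof (rule ccontr)
    assume nb: "\<not> ?thesis"
    have "\<exists>f\<in>W. N (scalar_minus lam Q f) < 1 / real (Suc k) * N f" for k
    proof (rule ccontr)
      assume "\<not> ?thesis"
      then have "\<forall>f\<in>W. 1 / real (Suc k) * N f \<le> N (scalar_minus lam Q f)" by (auto simp: not_less)
      moreover have "0 < 1 / real (Suc k)" by simp
      ultimately show False using nb by blast
    qed
    then obtain f where f: "\<And>k. f k \<in> W" "\<And>k. N (scalar_minus lam Q (f k)) < 1 / real (Suc k) * N (f k)"
      by metis
    have Nf: "0 < N (f k)" for k
    proof -
      have "0 \<le> N (scalar_minus lam Q (f k))" by (rule N_nonneg[OF bop_mem[OF bS f(1)]])
      then have "0 < 1 / real (Suc k) * N (f k)" using f(2)[of k] by linarith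
      then show ?thesis by (simp add: zero_less_divide_iff)
    qed
    define g where "g k = (\<lambda>x. of_real (1 / N (f k)) * f k x)" for k
    have g: "g k \<in> W" for k unfolding g_def by (rule scale_mem[OF f(1)])
    have Ng: "N (g k) = 1" for k
      using N_scale[OF f(1), of "of_real (1 / N (f k))" k] Nf[of k] by (simp add: g_def norm_divide)
    have Sg: "N (scalar_minus lam Q (g k)) \<le> 1 / real (Suc k)" for k
    proof -
      have m: "scalar_minus lam Q (f k) \<in> W" by (rule bop_mem[OF bS f(1)])
      have "N (scalar_minus lam Q (g k)) = (1 / N (f k)) * N (scalar_minus lam Q (f k))"
        unfolding g_def bop_scale[OF bS f(1)] using N_scale[OF m, of "of_real (1 / N (f k))"] Nf[of k]
        by (simp add: norm_divide)
      also have "\<dots> \<le> (1 / N (f k)) * (1 / real (Suc k) * N (f k))"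
        using f(2)[of k] Nf[of k] by (intro mult_left_mono) auto
      also have "\<dots> = 1 / real (Suc k)" using Nf[of k] by simp
      finally show ?thesis .
    qed
    obtain F g' where F: "F \<noteq> bot" "F \<le> sequentially" and g': "g' \<in> W"
      and lim: "\<And>\<omega>. ((\<lambda>k. g k \<omega>) \<longlongrightarrow> g' \<omega>) F"
      using compact_family[of g 1] g Ng by auto
    have inv: "((\<lambda>k. 1 / real (Suc k)) \<longlongrightarrow> 0) F"
      using tendsto_mono[OF F(2) LIMSEQ_inverse_real_of_nat] by (simp add: inverse_eq_divide)
    have SN: "((\<lambda>k. N (scalar_minus lam Q (g k))) \<longlongrightarrow> 0) F"
      by (rule tendsto_zero_squeeze[OF N_nonneg[OF bop_mem[OF bS g]] Sg inv])
    have "of_real lam * g' x = T g' x - g' w * u x" for x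
    proof -
      have "((\<lambda>k. scalar_minus lam Q (g k) x) \<longlongrightarrow> 0) F"
        by (rule Lim_null_comparison[OF always_eventually[OF allI] SN])
           (rule pointwise_le[OF bop_mem[OF bS g]])
      moreover have "((\<lambda>k. scalar_minus lam Q (g k) x) \<longlongrightarrow> lam * g' x - (T g' x - g' w * u x)) F"
        unfolding scalar_minus_def Q_def
        by (intro tendsto_intros lim T_limit[where B = 1, OF g _ g']) (simp add: Ng)
      ultimately show ?thesis using tendsto_unique[OF F(1)] by fastforce
    qed
    then have g'0: "g' = (\<lambda>_. 0)" by (rule inj[OF g'])
    have lim0: "((\<lambda>k. g k \<omega>) \<longlongrightarrow> 0) F" for \<omega> using lim[of \<omega>] by (simp add: g'0)
    have approx: "((\<lambda>k. N (scalar_minus lam T (g k))) \<longlongrightarrow> 0) F"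
    proof (rule tendsto_zero_squeeze)
      show "((\<lambda>k. N (scalar_minus lam Q (g k)) + cmod (g k w) * N u) \<longlongrightarrow> 0) F"
        using tendsto_add[OF SN tendsto_mult_right[OF tendsto_norm[OF lim0[of w]], of "N u"]] by simp
      show "N (scalar_minus lam T (g k)) \<le> N (scalar_minus lam Q (g k)) + cmod (g k w) * N u" for k
      proof -
        have "scalar_minus lam T (g k) = (\<lambda>x. scalar_minus lam Q (g k) x - g k w * u x)"
          by (simp add: scalar_minus_def Q_def)
        then show ?thesis
          using N_diff[OF bop_mem[OF bS[of lam] g[of k]] scale_mem[OF u(1), of "g k w"]] N_scale[OF u(1), of "g k w"]
          by simp
      qed
      show "0 \<le> N (scalar_minus lam T (g k))" for k
        by (rule N_nonneg[OF bop_mem[OF bop_scalar_minus[OF bop_T] g]])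
    qed
    \<comment> \<open>The midpoint of \<open>lam\<close> and \<open>lam / \<theta>\<close>: above
      \<open>lam\<close>, so it bounds the growth, and still with
      \<open>\<theta> * r < lam\<close>.\<close>
    define r where "r = lam * (1 / \<theta> + 1) / 2"
    have r: "lam < r" "\<theta> * r < lam" "0 < r"
      using lam theta by (auto simp: r_def field_simps intro: add_pos_pos)
    have "((\<lambda>k. N (g k)) \<longlongrightarrow> 0) F"
      by (rule approximate_eigenfunctions_vanish[OF gr[OF r(1)] r(3,2) g _ lim0 approx, where B = 1])
         (simp add: Ng)
    then show False using F(1) by (simp add: Ng tendsto_const_iff)
  qed
  then obtain c where c: "0 < c" "\<And>f. f \<in> W \<Longrightarrow> c * N f \<le> N (scalar_minus lam Q f)" by blast
  have "\<exists>R. is_resolvent Q (of_real t) R" if t: "lam < t" for t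
  proof -
    define r where "r = (lam + t) / 2"
    have r: "lam < r" "0 < r" "r < cmod (of_real t)" using t lam by (auto simp: r_def)
    define R where "R = (\<lambda>f x. \<Sum>n. (T ^^ n) f x / complex_of_real t ^ Suc n)"
    have R: "is_resolvent T (of_real t) R" unfolding R_def by (rule resolvent_beyond[OF gr[OF r(1)] r(2,3)])
    have "(\<lambda>n. (T ^^ n) u w / of_real t ^ Suc n) sums R u w"
      unfolding R_def by (rule resolvent_beyond(2)[OF gr[OF r(1)] r(2,3) u(1)])
    then have s: "(\<lambda>n. Re ((T ^^ n) u w / of_real t ^ Suc n)) sums Re (R u w)" by (rule sums_Re)
    have bu: "bddX ur" using bddX_Re[OF bddX_W[OF u(1)]] by (simp add: u(2))
    have "(T ^^ n) u w = of_real ((T ^^ n) ur w)" for n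
      using fun_cong[OF Tn_bounded_linear[OF bounded_linear_of_real bu, of n], of w] u(2)
        Tn_cong[of u "\<lambda>x. of_real (ur x)", OF _ w] by simp
    then have "0 \<le> Re ((T ^^ n) u w / of_real t ^ Suc n)" for n
      using Tn_nonneg[of ur w n] u(3) w t lam
      by (simp add: of_real_power[symmetric] of_real_divide[symmetric] of_real_mult[symmetric]
          del: of_real_power of_real_divide of_real_mult)
    then have "0 \<le> Re (R u w)" using sums_le[OF _ sums_zero s] by blast
    then have "Re (1 + R u w) \<noteq> 0" by simp
    then have "1 + R u w \<noteq> 0" by (metis zero_complex.sel(1))
    then show ?thesis unfolding Q_def by (rule resolvent_rank_one[OF bop_T R u(1)])
  qed
  then show ?thesis using resolvent_endpoint[OF bQ c] unfolding Q_def by blast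
qed

end

section \<open>The leading eigenfunction\<close>

locale irreducible_transfer = transfer \<theta> S A S0 M \<phi>
  for \<theta> :: real and S :: "'s set" and A :: "'s \<Rightarrow> 's \<Rightarrow> nat"
    and S0 :: "'s set" and M :: "'s \<Rightarrow> 's \<Rightarrow> nat" and \<phi> :: "(nat \<Rightarrow> 's) \<Rightarrow> real" +
  assumes irr: "irreducible_matrix S0 M"
    and per: "\<exists>\<omega>\<in>markov_shift S0 M. periodic_point \<omega>"
begin

abbreviation "XM \<equiv> markov_shift S0 M"

lemma XM_subset: "XM \<subseteq> X"
  using S0 MA by (auto simp: markov_shift_def)

section \<open>The growth rate and its positivity\<close>

lemma grows_P: "grows (P + 1)"
proof -
  have "(T ^^ n) (\<lambda>_. 1) \<omega> \<le> (P + 1) ^ n" if "\<omega> \<in> X" for n \<omega>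
    using that
  proof (induction n arbitrary: \<omega>)
    case (Suc n)
    have "T ((T ^^ n) (\<lambda>_. 1)) \<omega> \<le> P * (P + 1) ^ n"
      using P_nonneg by (intro T_le Suc.IH Tn_nonneg) auto
    also have "\<dots> \<le> (P + 1) * (P + 1) ^ n" using P_nonneg by (intro mult_right_mono) auto
    finally show ?case by simp
  qed auto
  then show ?thesis unfolding grows_def by (intro exI[of _ 1]) auto
qed

lemma grows_mono:
  assumes "grows r" "0 \<le> r" "r \<le> s"
  shows "grows s"
proof -
  obtain C where C: "0 \<le> C" "\<And>n \<omega>. \<omega> \<in> X \<Longrightarrow> (T ^^ n) (\<lambda>_. 1) \<omega> \<le> C * r ^ n"
    using assms(1) by (auto simp: grows_def)
  have "C * r ^ n \<le> C * s ^ n" for n using C assms by (intro mult_left_mono power_mono) auto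
  then show ?thesis unfolding grows_def using C order_trans by (intro exI[of _ C]) blast
qed

definition growth_rate :: real where
  "growth_rate = Inf {r. 0 < r \<and> grows r}"

abbreviation "\<Lambda> \<equiv> growth_rate"

lemma growth_rate_le: "0 < r \<Longrightarrow> grows r \<Longrightarrow> \<Lambda> \<le> r"
  unfolding growth_rate_def by (rule cInf_lower) (auto intro!: bdd_belowI[of _ 0])

lemma grows_gt:
  assumes "\<Lambda> < r"
  shows "grows r"
proof -
  have "{r. 0 < r \<and> grows r} \<noteq> {}" using grows_P P_nonneg by (auto intro!: exI[of _ "P + 1"])
  then obtain r' where "0 < r'" "grows r'" "r' < r"
    using cInf_lessD[of "{r. 0 < r \<and> grows r}" r] assms by (auto simp: growth_rate_def)
  then show ?thesis using grows_mono[of r' r] by simp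
qed

lemma shift_Cons: "case_nat (\<omega> 0) (shift \<omega>) = \<omega>"
  by (auto simp: shift_def fun_eq_iff split: nat.split)

lemma shift_XM: "\<omega> \<in> XM \<Longrightarrow> shift \<omega> \<in> XM"
  by (auto simp: markov_shift_def shift_def)

lemma head_in_I: "\<omega> \<in> XM \<Longrightarrow> \<omega> 0 \<in> I (shift \<omega>)"
  by (auto simp: I_iff markov_shift_def shift_def)

text \<open>Each point of a periodic orbit has a preimage on the same orbit. With \<open>b\<close>
  the least weight along the orbit, \<open>T\<^sup>n 1\<close> is therefore at least
  \<open>b ^ n\<close> on it, and no growth bound lies below \<open>b\<close>.\<close>

lemma growth_rate_pos: "0 < \<Lambda>"
proof -
  obtain \<omega> q where \<omega>: "\<omega> \<in> XM" and q: "1 \<le> q" "(shift ^^ q) \<omega> = \<omega>"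
    using per by (auto simp: periodic_point_def)
  define b where "b = Min ((\<lambda>j. exp (\<phi> ((shift ^^ j) \<omega>))) ` {..<q})"
  have b_le: "b \<le> exp (\<phi> ((shift ^^ j) \<omega>))" for j
  proof -
    have "(shift ^^ j) \<omega> = (shift ^^ (j mod q)) \<omega>" by (rule funpow_mod_eq[OF q(2), symmetric])
    moreover have "j mod q < q" using q(1) by simp
    ultimately show ?thesis unfolding b_def by (intro Min_le) auto
  qed
  have ne: "{..<q} \<noteq> {}" using q(1) by (auto simp: lessThan_empty_iff)
  have b: "0 < b" unfolding b_def by (subst Min_gr_iff) (use ne in auto)
  have mem: "(shift ^^ j) \<omega> \<in> XM" for j using \<omega> by (induction j) (auto intro: shift_XM)
  have lower: "b ^ n \<le> (T ^^ n) (\<lambda>_. 1) ((shift ^^ j) \<omega>)" for n j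
  proof (induction n arbitrary: j)
    case (Suc n)
    \<comment> \<open>The preimage on the orbit: one step back is \<open>q - 1\<close> steps
      forward.\<close>
    define x where "x = (shift ^^ (j + (q - 1))) \<omega>"
    have "shift x = (shift ^^ (j + q)) \<omega>" unfolding x_def using q(1) by (cases q) auto
    then have sx: "shift x = (shift ^^ j) \<omega>" by (simp add: funpow_add q(2))
    have x: "x \<in> XM" unfolding x_def by (rule mem)
    have "b * b ^ n \<le> exp (\<phi> x) * (T ^^ n) (\<lambda>_. 1) x"
      using b b_le Suc.IH unfolding x_def by (intro mult_mono) auto
    also have "\<dots> = exp (\<phi> (case_nat (x 0) (shift x))) * (T ^^ n) (\<lambda>_. 1) (case_nat (x 0) (shift x))"
      by (simp add: shift_Cons)
    also have "\<dots> \<le> T ((T ^^ n) (\<lambda>_. 1)) (shift x)"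
      using shift_XM[OF x] XM_subset
      by (intro T_ge_term bddX_Tn bddX_const Tn_nonneg head_in_I x) auto
    finally show ?case by (simp add: sx)
  qed auto
  have "b \<le> r" if r: "0 < r" "grows r" for r
  proof (rule ccontr)
    assume "\<not> b \<le> r"
    then have "1 < b / r" using r by simp
    obtain C where C: "0 \<le> C" "\<And>n \<omega>. \<omega> \<in> X \<Longrightarrow> (T ^^ n) (\<lambda>_. 1) \<omega> \<le> C * r ^ n"
      using r(2) unfolding grows_def by blast
    obtain n where n: "C < (b / r) ^ n" using real_arch_pow[OF \<open>1 < b / r\<close>] by blast
    have "b ^ n \<le> C * r ^ n" using lower[of n 0] C(2)[of \<omega> n] \<omega> XM_subset by auto
    then show False using n r by (simp add: power_divide pos_less_divide_eq)
  qed
  then have "b \<le> \<Lambda>"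
    unfolding growth_rate_def using grows_P P_nonneg
    by (intro cInf_greatest) (auto intro!: exI[of _ "P + 1"])
  then show ?thesis using b by simp
qed

lemma eigenfunction_exists:
  "\<exists>h :: (nat \<Rightarrow> 's) \<Rightarrow> real. (\<lambda>\<omega>. complex_of_real (h \<omega>)) \<in> W \<and> (\<forall>\<omega>. 0 \<le> h \<omega>) \<and>
     (\<forall>\<omega>. T h \<omega> = \<Lambda> * h \<omega>) \<and>
     (\<forall>\<omega>\<in>X. \<forall>\<upsilon>\<in>X. \<omega> 0 = \<upsilon> 0 \<longrightarrow> h \<omega> \<le> exp K * h \<upsilon>) \<and> (\<exists>\<omega>. 0 < h \<omega>)"
proof -
  note \<Lambda> = growth_rate_pos
  obtain \<omega>0 where \<omega>0: "\<omega>0 \<in> X" using per XM_subset by blast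
  \<comment> \<open>Members of \<open>Fb\<close> vanish outside \<open>X\<close>, so the indicator
    of \<open>X\<close> stands for the constant 1.\<close>
  define oner where "oner \<omega> = (if \<omega> \<in> X then 1 else 0 :: real)" for \<omega>
  define onec where "onec = (\<lambda>\<omega>. complex_of_real (oner \<omega>))"
  have onec: "onec \<in> W"
    by (rule FbI(1)[of _ 1 0]) (auto simp: onec_def oner_def)
  have b1: "bddX oner" by (rule bddXI[of _ 1]) (auto simp: oner_def)
  have Tn_onec: "(T ^^ n) onec = (\<lambda>\<omega>. of_real ((T ^^ n) oner \<omega>))" for n
    unfolding onec_def by (rule Tn_bounded_linear[OF bounded_linear_of_real b1])
  have Tn_oner: "(T ^^ n) oner \<omega> = (T ^^ n) (\<lambda>_. 1) \<omega>" if "\<omega> \<in> X" for n \<omega>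
    by (rule Tn_cong[OF _ that]) (simp add: oner_def)
  have Tn0: "0 \<le> (T ^^ n) oner \<omega>" for n \<omega>
    by (cases n) (auto simp: oner_def intro!: T_nonneg Tn_nonneg)
  define t where "t k = \<Lambda> + 1 / real (Suc k)" for k
  have t: "\<Lambda> < t k" "0 < t k" for k using \<Lambda> by (auto simp: t_def intro: add_pos_pos)
  define Fr where "Fr k \<omega> = (\<Sum>n. (T ^^ n) oner \<omega> / t k ^ Suc n)" for k \<omega>
  define Fc where "Fc k = (\<lambda>\<omega>. complex_of_real (Fr k \<omega>))" for k
  define R where "R k = (\<lambda>f x. \<Sum>n. (T ^^ n) f x / complex_of_real (t k) ^ Suc n)" for k
  have beyond: "is_resolvent T (of_real (t k)) (R k)"
    "(\<lambda>n. (T ^^ n) onec \<omega> / of_real (t k) ^ Suc n) sums R k onec \<omega>" for k \<omega>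
  proof -
    define r where "r = (\<Lambda> + t k) / 2"
    have r: "\<Lambda> < r" "0 < r" "r < cmod (of_real (t k))" using t[of k] \<Lambda> by (auto simp: r_def)
    show "is_resolvent T (of_real (t k)) (R k)"
      unfolding R_def by (rule resolvent_beyond(1)[OF grows_gt[OF r(1)] r(2,3)])
    show "(\<lambda>n. (T ^^ n) onec \<omega> / of_real (t k) ^ Suc n) sums R k onec \<omega>"
      unfolding R_def by (rule resolvent_beyond(2)[OF grows_gt[OF r(1)] r(2,3) onec])
  qed
  have sums_c: "(\<lambda>n. complex_of_real ((T ^^ n) oner \<omega> / t k ^ Suc n)) sums R k onec \<omega>" for k \<omega>
    using beyond(2)[of \<omega> k] by (simp add: Tn_onec)
  have sums_r: "(\<lambda>n. (T ^^ n) oner \<omega> / t k ^ Suc n) sums Fr k \<omega>" for k \<omega>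
    unfolding Fr_def using sums_Re[OF sums_c[of \<omega> k]] by (auto simp: sums_iff)
  have RF: "R k onec = Fc k" for k
    unfolding Fc_def using sums_unique2[OF sums_c sums_of_real[OF sums_r]] by (auto simp: fun_eq_iff)
  have FcW: "Fc k \<in> W" for k
    unfolding RF[symmetric] by (rule bop_mem[OF is_resolventD(1)[OF beyond(1)] onec])
  have bFr: "bddX (Fr k)" for k using bddX_Re[OF bddX_W[OF FcW[of k]]] by (simp add: Fc_def)
  have Fr_ge: "1 / t k \<le> Fr k \<omega>" if "\<omega> \<in> X" for k \<omega>
  proof -
    have "(\<Sum>n<1. (T ^^ n) oner \<omega> / t k ^ Suc n) \<le> Fr k \<omega>"
      unfolding Fr_def using sums_r[of \<omega> k] Tn0 t[of k]
      by (intro sum_le_suminf) (auto simp: sums_iff)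
    then show ?thesis using that by (simp add: oner_def)
  qed
  have Fr_pos: "0 < Fr k \<omega>" if "\<omega> \<in> X" for k \<omega>
    using Fr_ge[OF that, of k] t[of k] by (meson divide_pos_pos less_le_trans zero_less_one)
  have TFr: "T (Fr k) \<omega> = t k * Fr k \<omega> - oner \<omega>" for k \<omega>
  proof -
    have "scalar_minus (of_real (t k)) T (Fc k) \<omega> = onec \<omega>"
      using fun_cong[OF is_resolventD(3)[OF beyond(1) onec], of k \<omega>] by (simp add: RF)
    then have "complex_of_real (t k * Fr k \<omega> - T (Fr k) \<omega>) = of_real (oner \<omega>)"
      by (simp add: scalar_minus_def Fc_def onec_def T_of_real[OF bFr])
    then show ?thesis unfolding of_real_eq_iff by simp
  qed
  \<comment> \<open>A bound \<open>C\<close> on \<open>Fr k\<close> turns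
    \<open>T F = t F - 1\<close> into \<open>T F \<le> (t - 1 / C) F\<close>. Since \<open>F\<close>
    lies between positive constants, iteration makes \<open>t - 1 / C\<close> a growth bound, so
    \<open>\<Lambda> \<le> t - 1 / C\<close>, that is, \<open>C \<ge> Suc k\<close>.\<close>
  have blowup: "real (Suc k) \<le> C" if C: "\<And>\<omega>. \<omega> \<in> X \<Longrightarrow> Fr k \<omega> \<le> C" for k C
  proof -
    define \<rho> where "\<rho> = t k - 1 / C"
    have C0: "0 < C" using C[OF \<omega>0] Fr_pos[OF \<omega>0, of k] by simp
    have TF: "T (Fr k) \<omega> \<le> \<rho> * Fr k \<omega>" if "\<omega> \<in> X" for \<omega>
      using C[OF that] C0 that unfolding TFr \<rho>_def by (simp add: oner_def field_simps)
    have \<rho>: "0 \<le> \<rho>"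
    proof -
      have "0 \<le> T (Fr k) \<omega>0" by (rule T_nonneg) (use Fr_pos in \<open>auto intro: less_imp_le\<close>)
      then have "0 \<le> \<rho> * Fr k \<omega>0" using TF[OF \<omega>0] by simp
      then show ?thesis using Fr_pos[OF \<omega>0, of k] by (simp add: zero_le_mult_iff)
    qed
    have pw: "(T ^^ n) (Fr k) \<omega> \<le> \<rho> ^ n * Fr k \<omega>" if "\<omega> \<in> X" for n \<omega>
      using that
    proof (induction n arbitrary: \<omega>)
      case (Suc n)
      have "T ((T ^^ n) (Fr k)) \<omega> \<le> T (\<lambda>\<omega>. \<rho> ^ n * Fr k \<omega>) \<omega>"
        by (intro T_mono bddX_Tn bddX_mult bFr Suc.IH)
      also have "\<dots> = \<rho> ^ n * T (Fr k) \<omega>" by (rule T_mult[OF bFr])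
      also have "\<dots> \<le> \<rho> ^ n * (\<rho> * Fr k \<omega>)" using \<rho> by (intro mult_left_mono TF Suc.prems) auto
      finally show ?case by (simp add: algebra_simps)
    qed auto
    have one_le: "(T ^^ n) (\<lambda>_. 1) \<omega> \<le> t k * C * \<rho> ^ n" if "\<omega> \<in> X" for n \<omega>
    proof -
      have "1 \<le> t k * Fr k \<omega>" if "\<omega> \<in> X" for \<omega>
        using Fr_ge[OF that, of k] t[of k] by (simp add: field_simps)
      then have "(T ^^ n) (\<lambda>_. 1) \<omega> \<le> (T ^^ n) (\<lambda>\<omega>. t k * Fr k \<omega>) \<omega>"
        using that by (intro Tn_mono bddX_const bddX_mult bFr) auto
      also have "\<dots> = t k * (T ^^ n) (Fr k) \<omega>"
        using Tn_bounded_linear[OF bounded_linear_mult_right[of "t k"] bFr[of k], of n] by simp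
      also have "\<dots> \<le> t k * (\<rho> ^ n * C)"
        using pw[OF that, of n] C[OF that] \<rho> t[of k]
        by (intro mult_left_mono order_trans[OF pw[OF that]] mult_left_mono) auto
      finally show ?thesis by (simp add: algebra_simps)
    qed
    have "grows \<rho>" unfolding grows_def using one_le C0 t[of k] by (intro exI[of _ "t k * C"]) auto
    then have "\<Lambda> \<le> r" if "\<rho> < r" for r
      using that \<rho> by (intro growth_rate_le grows_mono[of \<rho> r]) auto
    then have "\<Lambda> \<le> \<rho>" by (rule dense_ge)
    then have "1 / C \<le> 1 / real (Suc k)" unfolding \<rho>_def t_def by simp
    then show ?thesis using C0 by (simp add: field_simps)
  qed
  define Z where "Z k = (SUP \<omega>\<in>X. Fr k \<omega>)" for k
  have bdd: "bdd_above (Fr k ` X)" for k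
  proof -
    obtain B where "\<And>\<omega>. \<omega> \<in> X \<Longrightarrow> norm (Fr k \<omega>) \<le> B" using bddXE[OF bFr] by blast
    then show ?thesis by (intro bdd_aboveI2[of _ _ B]) (auto dest: abs_le_D1)
  qed
  have Fr_le: "Fr k \<omega> \<le> Z k" if "\<omega> \<in> X" for k \<omega>
    unfolding Z_def by (rule cSUP_upper[OF that bdd])
  have Zk: "real (Suc k) \<le> Z k" for k by (rule blowup[OF Fr_le])
  have Z0: "0 < Z k" for k using Zk[of k] by simp
  define f where "f k = (\<lambda>\<omega>. complex_of_real (Fr k \<omega> / Z k))" for k
  have f_Fc: "f k = (\<lambda>\<omega>. of_real (1 / Z k) * Fc k \<omega>)" for k by (simp add: f_def Fc_def)
  have fW: "f k \<in> W" for k unfolding f_Fc by (rule scale_mem[OF FcW])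
  \<comment> \<open>For a constant function the Lipschitz term of \<open>lasota_yorke\<close> is
    zero; the multiplicative distortion that remains passes through the positive series.\<close>
  have distort: "\<bar>Fr k \<omega> - Fr k \<upsilon>\<bar> \<le> (exp (K * d \<omega> \<upsilon>) - 1) * Fr k \<upsilon>"
    if X: "\<omega> \<in> X" "\<upsilon> \<in> X" "\<omega> 0 = \<upsilon> 0" for k \<omega> \<upsilon>
  proof -
    have "\<bar>(T ^^ n) oner \<omega> - (T ^^ n) oner \<upsilon>\<bar> \<le> (exp (K * d \<omega> \<upsilon>) - 1) * (T ^^ n) oner \<upsilon>" for n
      using lasota_yorke[of "\<lambda>_. 1::real" 0 \<omega> \<upsilon> n, OF bddX_const] X by (simp add: Tn_oner)
    then have le: "\<bar>(T ^^ n) oner \<omega> / t k ^ Suc n - (T ^^ n) oner \<upsilon> / t k ^ Suc n\<bar> \<le>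
        (exp (K * d \<omega> \<upsilon>) - 1) * ((T ^^ n) oner \<upsilon> / t k ^ Suc n)" for n
      using t(2)[of k] by (simp add: diff_divide_distrib[symmetric] abs_div_pos[symmetric] divide_right_mono)
    have s: "(\<lambda>n. (T ^^ n) oner \<omega> / t k ^ Suc n - (T ^^ n) oner \<upsilon> / t k ^ Suc n) sums (Fr k \<omega> - Fr k \<upsilon>)"
      by (rule sums_diff[OF sums_r sums_r])
    have s': "(\<lambda>n. (exp (K * d \<omega> \<upsilon>) - 1) * ((T ^^ n) oner \<upsilon> / t k ^ Suc n)) sums
        ((exp (K * d \<omega> \<upsilon>) - 1) * Fr k \<upsilon>)"
      by (rule sums_mult[OF sums_r])
    have "Fr k \<omega> - Fr k \<upsilon> \<le> (exp (K * d \<omega> \<upsilon>) - 1) * Fr k \<upsilon>"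
      by (rule sums_le[OF _ s s']) (use le abs_le_D1 in blast)
    moreover have "- (Fr k \<omega> - Fr k \<upsilon>) \<le> (exp (K * d \<omega> \<upsilon>) - 1) * Fr k \<upsilon>"
      by (rule sums_le[OF _ sums_minus[OF s] s']) (use le abs_le_D2 in blast)
    ultimately show ?thesis by (rule abs_leI)
  qed
  have Nf: "N (f k) \<le> 1 + E" for k
  proof (rule FbI(4))
    fix \<omega> assume "\<omega> \<notin> X" then show "f k \<omega> = 0" by (rule FbD(1)[OF fW])
  next
    fix \<omega> assume \<omega>: "\<omega> \<in> X"
    show "cmod (f k \<omega>) \<le> 1"
      using Fr_le[OF \<omega>, of k] Fr_pos[OF \<omega>, of k] Z0[of k] by (simp add: f_def norm_divide)
  next
    fix \<omega> \<upsilon> assume X: "\<omega> \<in> X" "\<upsilon> \<in> X" "\<omega> 0 = \<upsilon> 0"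
    have "f k \<omega> - f k \<upsilon> = of_real ((Fr k \<omega> - Fr k \<upsilon>) / Z k)" by (simp add: f_def diff_divide_distrib)
    then have "cmod (f k \<omega> - f k \<upsilon>) = \<bar>Fr k \<omega> - Fr k \<upsilon>\<bar> / Z k"
      using Z0[of k] by (simp only: norm_of_real) simp
    also have "\<dots> \<le> (E * d \<omega> \<upsilon> * Z k) / Z k"
    proof (intro divide_right_mono order_trans[OF distort[OF X]] mult_mono exp_K_le Fr_le X)
      show "0 \<le> E * d \<omega> \<upsilon>" using E_nonneg d_nonneg[of \<omega> \<upsilon>] by simp
    qed (use Fr_pos[OF X(2), of k] Z0[of k] in auto)
    also have "\<dots> = E * d \<omega> \<upsilon>" using Z0[of k] by simp
    finally show "cmod (f k \<omega> - f k \<upsilon>) \<le> E * d \<omega> \<upsilon>" .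
  qed (use E_nonneg in auto)
  obtain F h' where F: "F \<noteq> bot" "F \<le> sequentially" and h': "h' \<in> W"
    and lim: "\<And>\<omega>. ((\<lambda>k. f k \<omega>) \<longlongrightarrow> h' \<omega>) F"
    using compact_family[of f, OF fW Nf] by metis
  define h where "h \<omega> = Re (h' \<omega>)" for \<omega>
  have limr: "((\<lambda>k. Fr k \<omega> / Z k) \<longlongrightarrow> h \<omega>) F" for \<omega>
    using tendsto_Re[OF lim[of \<omega>]] by (simp add: f_def h_def)
  have h'_h: "h' = (\<lambda>\<omega>. of_real (h \<omega>))"
  proof
    fix \<omega>
    have "((\<lambda>k. f k \<omega>) \<longlongrightarrow> of_real (h \<omega>)) F" unfolding f_def by (intro tendsto_of_real limr)
    then show "h' \<omega> = of_real (h \<omega>)" using tendsto_unique[OF F(1) lim] by blast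
  qed
  have bh: "bddX h" unfolding h_def by (rule bddX_Re[OF bddX_W[OF h']])
  have h_nonneg: "0 \<le> h \<omega>" for \<omega>
  proof (cases "\<omega> \<in> X")
    case True
    show ?thesis
      by (rule tendsto_lowerbound[OF limr _ F(1)])
         (use Fr_pos[OF True] Z0 in \<open>auto intro!: always_eventually less_imp_le divide_nonneg_nonneg\<close>)
  next
    case False
    then show ?thesis using FbD(1)[OF h'] by (simp add: h_def)
  qed
  have inv: "((\<lambda>k. 1 / real (Suc k)) \<longlongrightarrow> 0) F"
    using tendsto_mono[OF F(2) LIMSEQ_inverse_real_of_nat] by (simp add: inverse_eq_divide)
  have invZ: "((\<lambda>k. 1 / Z k) \<longlongrightarrow> 0) F"
  proof (rule tendsto_zero_squeeze[OF _ _ inv])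
    show "0 \<le> 1 / Z k" for k using Z0[of k] by simp
    show "1 / Z k \<le> 1 / real (Suc k)" for k using Zk[of k] Z0[of k] by (intro divide_left_mono) auto
  qed
  have Tf: "T (f k) \<omega> = of_real (t k) * f k \<omega> - of_real (1 / Z k) * onec \<omega>" for k \<omega>
  proof -
    have "T (f k) \<omega> = of_real (1 / Z k) * T (Fc k) \<omega>"
      unfolding f_Fc by (rule T_mult[OF bddX_W[OF FcW]])
    also have "T (Fc k) \<omega> = of_real (t k * Fr k \<omega> - oner \<omega>)"
      unfolding Fc_def T_of_real[OF bFr] TFr ..
    finally show ?thesis by (simp add: f_def onec_def right_diff_distrib diff_divide_distrib)
  qed
  have Th: "T h \<omega> = \<Lambda> * h \<omega>" for \<omega>
  proof -
    have "((\<lambda>k. of_real (\<Lambda> + 1 / real (Suc k)) * f k \<omega> - of_real (1 / Z k) * onec \<omega>)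
        \<longlongrightarrow> of_real (\<Lambda> + 0) * h' \<omega> - of_real 0 * onec \<omega>) F"
      by (intro tendsto_intros inv invZ lim)
    then have "((\<lambda>k. T (f k) \<omega>) \<longlongrightarrow> of_real \<Lambda> * h' \<omega>) F" by (simp add: Tf t_def)
    moreover have "((\<lambda>k. T (f k) \<omega>) \<longlongrightarrow> T h' \<omega>) F" by (rule T_limit[OF fW Nf h' lim])
    ultimately have "T h' \<omega> = of_real \<Lambda> * h' \<omega>" using tendsto_unique[OF F(1)] by blast
    then have "complex_of_real (T h \<omega>) = of_real (\<Lambda> * h \<omega>)" by (simp add: h'_h T_of_real[OF bh])
    then show ?thesis unfolding of_real_eq_iff .
  qed
  have h_distort: "h \<omega> \<le> exp K * h \<upsilon>" if X: "\<omega> \<in> X" "\<upsilon> \<in> X" "\<omega> 0 = \<upsilon> 0" for \<omega> \<upsilon>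
  proof (rule tendsto_le[OF F(1) tendsto_mult_left[OF limr] limr always_eventually], rule allI)
    fix k
    have "Fr k \<omega> \<le> exp (K * d \<omega> \<upsilon>) * Fr k \<upsilon>"
      using distort[OF X, of k] abs_le_D1 by (fastforce simp: algebra_simps)
    also have "\<dots> \<le> exp K * Fr k \<upsilon>"
      using Fr_pos[OF X(2), of k] K_nonneg d_theta_le_1[OF theta, of \<omega> \<upsilon>] d_nonneg[of \<omega> \<upsilon>]
      by (intro mult_right_mono) (auto simp: mult_left_le)
    finally show "Fr k \<omega> / Z k \<le> exp K * (Fr k \<upsilon> / Z k)"
      using Z0[of k] by (simp add: divide_right_mono)
  qed
  \<comment> \<open>A pointwise limit could lose all mass to infinity. But the \<open>f k\<close>
    are approximate eigenfunctions, so a zero limit would force their norms to zero, while their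
    suprema are 1.\<close>
  have "\<exists>\<omega>. 0 < h \<omega>"
  proof (rule ccontr)
    assume "\<not> ?thesis"
    then have "h \<omega> = 0" for \<omega> using h_nonneg[of \<omega>] by (metis less_eq_real_def)
    then have lim0: "((\<lambda>k. f k \<omega>) \<longlongrightarrow> 0) F" for \<omega> using lim[of \<omega>] by (simp add: h'_h)
    have approx: "((\<lambda>k. N (scalar_minus (of_real \<Lambda>) T (f k))) \<longlongrightarrow> 0) F"
    proof (rule tendsto_zero_squeeze)
      have "((\<lambda>k. 1 / Z k * N onec + 1 / real (Suc k) * (1 + E)) \<longlongrightarrow> 0 * N onec + 0 * (1 + E)) F"
        by (intro tendsto_intros inv invZ)
      then show "((\<lambda>k. 1 / Z k * N onec + 1 / real (Suc k) * (1 + E)) \<longlongrightarrow> 0) F" by simp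
      fix k
      show "0 \<le> N (scalar_minus (of_real \<Lambda>) T (f k))"
        by (rule N_nonneg[OF bop_mem[OF bop_scalar_minus[OF bop_T] fW]])
      have "scalar_minus (of_real \<Lambda>) T (f k) =
          (\<lambda>\<omega>. of_real (1 / Z k) * onec \<omega> - of_real (1 / real (Suc k)) * f k \<omega>)"
        by (simp add: scalar_minus_def Tf t_def algebra_simps)
      then have "N (scalar_minus (of_real \<Lambda>) T (f k)) \<le>
          cmod (of_real (1 / Z k)) * N onec + cmod (of_real (1 / real (Suc k))) * N (f k)"
        using N_diff[OF scale_mem[OF onec] scale_mem[OF fW], of "of_real (1 / Z k)" "of_real (1 / real (Suc k))" k]
        by (simp only: N_scale[OF onec] N_scale[OF fW])
      also have "\<dots> \<le> 1 / Z k * N onec + 1 / real (Suc k) * (1 + E)"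
        unfolding norm_of_real using Z0[of k] Nf[of k]
        by (intro add_mono mult_mono) (auto intro: N_nonneg fW onec)
      finally show "N (scalar_minus (of_real \<Lambda>) T (f k)) \<le>
          1 / Z k * N onec + 1 / real (Suc k) * (1 + E)" .
    qed
    define r where "r = \<Lambda> * (1 / \<theta> + 1) / 2"
    have r: "\<Lambda> < r" "\<theta> * r < \<Lambda>" "0 < r"
      using \<Lambda> theta by (auto simp: r_def field_simps intro: add_pos_pos)
    have "((\<lambda>k. N (f k)) \<longlongrightarrow> 0) F"
      by (rule approximate_eigenfunctions_vanish[OF grows_gt[OF r(1)] r(3,2) fW Nf lim0 approx])
    moreover have "1 / 2 \<le> N (f k)" for k
    proof -
      have "Z k / 2 < Z k" using Z0[of k] by simp
      then obtain \<omega> where \<omega>: "\<omega> \<in> X" "Z k / 2 < Fr k \<omega>"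
        using less_cSUP_iff[OF _ bdd[of k], of "Z k / 2"] \<omega>0 by (auto simp: Z_def)
      then have "1 / 2 \<le> cmod (f k \<omega>)"
        using Z0[of k] Fr_pos[OF \<omega>(1), of k] by (simp add: f_def norm_divide field_simps)
      then show ?thesis using pointwise_le[OF fW, of k \<omega>] by simp
    qed
    ultimately have "1 / 2 \<le> (0::real)"
      by (intro tendsto_lowerbound[OF _ _ F(1)]) auto
    then show False by simp
  qed
  then show ?thesis
    using h' h'_h h_nonneg Th h_distort by (intro exI[of _ h]) auto
qed

end

section \<open>A minimum principle\<close>

context shift_space
begin

lemma norm_mem: "f \<in> W \<Longrightarrow> (\<lambda>\<omega>. complex_of_real (cmod (f \<omega>))) \<in> W"
  using FbD[of f] norm_triangle_ineq3 order_trans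
  by (intro FbI(1)[of _ "sn X f" "ls \<theta> X f"]) (auto simp flip: of_real_diff, blast)

lemma Re_mem: "f \<in> W \<Longrightarrow> (\<lambda>\<omega>. complex_of_real (Re (f \<omega>))) \<in> W"
  using FbD[of f] abs_Re_le_cmod order_trans
  by (intro FbI(1)[of _ "sn X f" "ls \<theta> X f"]) (auto simp flip: of_real_diff minus_complex.sel, blast+)

end

context irreducible_transfer
begin

section \<open>The eigenfunction and its positivity\<close>

definition h :: "(nat \<Rightarrow> 's) \<Rightarrow> real" where
  "h = (SOME h. (\<lambda>\<omega>. complex_of_real (h \<omega>)) \<in> W \<and> (\<forall>\<omega>. 0 \<le> h \<omega>) \<and>
     (\<forall>\<omega>. T h \<omega> = \<Lambda> * h \<omega>) \<and>
     (\<forall>\<omega>\<in>X. \<forall>\<upsilon>\<in>X. \<omega> 0 = \<upsilon> 0 \<longrightarrow> h \<omega> \<le> exp K * h \<upsilon>) \<and> (\<exists>\<omega>. 0 < h \<omega>))"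

lemma h_mem: "(\<lambda>\<omega>. complex_of_real (h \<omega>)) \<in> W"
  and h_nonneg: "0 \<le> h \<omega>"
  and T_h: "T h \<omega> = \<Lambda> * h \<omega>"
  and h_distort: "\<omega> \<in> X \<Longrightarrow> \<upsilon> \<in> X \<Longrightarrow> \<omega> 0 = \<upsilon> 0 \<Longrightarrow> h \<omega> \<le> exp K * h \<upsilon>"
  and h_nonzero: "\<exists>\<omega>. 0 < h \<omega>"
  using someI_ex[OF eigenfunction_exists] unfolding h_def[symmetric] by blast+

lemma bddX_real: "(\<lambda>\<omega>. complex_of_real (g \<omega>)) \<in> W \<Longrightarrow> bddX g"
  using bddX_Re[OF bddX_W] by fastforce

lemmas bddX_h = bddX_real[OF h_mem]

lemma h_pos_imp:
  assumes "0 < h \<omega>"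
  shows "\<omega> \<in> X" "\<omega> 0 \<in> S0"
proof -
  have "T h \<omega> \<noteq> 0" using assms growth_rate_pos by (simp add: T_h)
  then show "\<omega> \<in> X" "\<omega> 0 \<in> S0" using T_outside T_outside_S0 by blast+
qed

definition edges :: "('s \<times> 's) set" where
  "edges = {(i, j). i \<in> S0 \<and> j \<in> S0 \<and> M i j = 1}"

lemma reach:
  assumes "a \<in> S0" "b \<in> S0"
  shows "(a, b) \<in> edges\<^sup>*"
proof -
  have "admissible_word S0 M w \<Longrightarrow> (hd w, last w) \<in> edges\<^sup>*" for w
  proof (induction w rule: induct_list012)
    case (3 x y w)
    then have "(x, y) \<in> edges" "(y, last (y # w)) \<in> edges\<^sup>*"
      by (auto simp: admissible_word_def edges_def)
    then show ?case by (simp add: converse_rtrancl_into_rtrancl)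
  qed (auto simp: admissible_word_def)
  then show ?thesis using irr assms by (metis irreducible_matrix_def)
qed

lemma edges_iff_I: "(a, \<omega> 0) \<in> edges \<longleftrightarrow> a \<in> I \<omega>"
  by (auto simp: edges_def I_iff)

text \<open>An admissible word leads from \<open>a\<close> to the first letter of a known point of
  \<open>XM\<close>; its letters are prepended one by one.\<close>

lemma XM_start:
  assumes "a \<in> S0"
  obtains \<upsilon> where "\<upsilon> \<in> XM" "\<upsilon> 0 = a"
proof -
  obtain \<omega> where \<omega>: "\<omega> \<in> XM" using per by blast
  then have "(a, \<omega> 0) \<in> edges\<^sup>*" using reach[OF assms] by (auto simp: markov_shift_def)
  then have "\<exists>\<upsilon>\<in>XM. \<upsilon> 0 = a"
  proof (induction rule: converse_rtrancl_induct)
    case (step a b)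
    then obtain \<upsilon> where \<upsilon>: "\<upsilon> \<in> XM" "\<upsilon> 0 = b" by blast
    then have "case_nat a \<upsilon> \<in> XM" using step(1)
      by (auto simp: markov_shift_def edges_def split: nat.split)
    then show ?case by (rule bexI[rotated]) simp
  qed (use \<omega> in blast)
  then show thesis using that by blast
qed

text \<open>Positivity at one point spreads over its cylinder by distortion. It spreads along an
  edge from \<open>a\<close> to \<open>b\<close> because \<open>\<Lambda> * h\<close> over
  \<open>b\<close> dominates the single term of \<open>T h\<close> that prepends
  \<open>a\<close>.\<close>

lemma h_pos:
  assumes "\<omega> \<in> X" "\<omega> 0 \<in> S0"
  shows "0 < h \<omega>"
proof -
  obtain \<omega>1 where \<omega>1: "0 < h \<omega>1" using h_nonzero by blast
  have "(\<omega>1 0, \<omega> 0) \<in> edges\<^sup>*" by (rule reach[OF h_pos_imp(2)[OF \<omega>1] assms(2)])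
  then have "\<forall>\<upsilon>\<in>X. \<upsilon> 0 = \<omega> 0 \<longrightarrow> 0 < h \<upsilon>"
  proof (induction rule: rtrancl_induct)
    case base
    show ?case
    proof (intro ballI impI)
      fix \<upsilon> assume "\<upsilon> \<in> X" "\<upsilon> 0 = \<omega>1 0"
      then have "0 < exp K * h \<upsilon>" using h_distort[OF h_pos_imp(1)[OF \<omega>1], of \<upsilon>] \<omega>1 by simp
      then show "0 < h \<upsilon>" by (simp add: zero_less_mult_iff)
    qed
  next
    case (step a b)
    show ?case
    proof (intro ballI impI)
      fix \<upsilon> assume \<upsilon>: "\<upsilon> \<in> X" "\<upsilon> 0 = b"
      then have a: "a \<in> I \<upsilon>" using step(2) edges_iff_I[of a \<upsilon>] by simp
      have "0 < exp (\<phi> (case_nat a \<upsilon>)) * h (case_nat a \<upsilon>)"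
        using step.IH Cons_in_X[OF \<upsilon>(1) a] by simp
      also have "\<dots> \<le> \<Lambda> * h \<upsilon>"
        using T_ge_term[OF bddX_h h_nonneg \<upsilon>(1) a] by (simp add: T_h)
      finally show "0 < h \<upsilon>" using growth_rate_pos by (simp add: zero_less_mult_iff)
    qed
  qed
  then show ?thesis using assms(1) by blast
qed

lemma h_pos_XM: "\<upsilon> \<in> XM \<Longrightarrow> 0 < h \<upsilon>"
  using h_pos[of \<upsilon>] XM_subset by (auto simp: markov_shift_def)

lemma uniform_lower_bound:
  assumes "finite G" "\<And>a. a \<in> G \<Longrightarrow> \<exists>e>0. \<forall>\<omega>\<in>X. \<omega> 0 = a \<longrightarrow> e \<le> f \<omega>"
  shows "\<exists>e>0::real. \<forall>\<omega>\<in>X. \<omega> 0 \<in> G \<longrightarrow> e \<le> f \<omega>"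
  using assms
proof (induction G)
  case empty
  then show ?case by (auto intro: exI[of _ 1])
next
  case (insert a G)
  obtain e where e: "0 < e" "\<forall>\<omega>\<in>X. \<omega> 0 \<in> G \<longrightarrow> e \<le> f \<omega>" using insert by blast
  obtain e' where e': "0 < e'" "\<forall>\<omega>\<in>X. \<omega> 0 = a \<longrightarrow> e' \<le> f \<omega>" using insert.prems by blast
  show ?case by (rule exI[of _ "min e e'"]) (use e e' in \<open>auto simp: min_le_iff_disj\<close>)
qed

text \<open>Let \<open>m\<close> be the supremum of the negative part of \<open>D\<close>. Preimages
  beginning with a letter of \<open>F\<close> contribute nothing to it, all others together at most
  \<open>m * (\<Lambda> / 2)\<close>, so \<open>m \<le> m / 2\<close>.\<close>

lemma nonneg_off_finite:
  fixes D :: "(nat \<Rightarrow> 's) \<Rightarrow> real"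
  assumes bD: "bddX D" and super: "\<And>\<omega>. \<omega> \<in> X \<Longrightarrow> T D \<omega> \<le> \<Lambda> * D \<omega>"
    and F: "finite F" "infsum p (S - F) \<le> \<Lambda> / 2"
    and nn: "\<And>\<omega>. \<omega> \<in> X \<Longrightarrow> \<omega> 0 \<in> F \<inter> S0 \<Longrightarrow> 0 \<le> D \<omega>" and \<omega>: "\<omega> \<in> X"
  shows "0 \<le> D \<omega>"
proof -
  define Dm where "Dm \<omega> = max (- D \<omega>) 0" for \<omega>
  define m where "m = (SUP \<omega>\<in>X. Dm \<omega>)"
  obtain B where B: "\<And>\<omega>. \<omega> \<in> X \<Longrightarrow> norm (D \<omega>) \<le> B" using bddXE[OF bD] by blast
  have DB: "norm (Dm \<omega>) \<le> B" if "\<omega> \<in> X" for \<omega> using B[OF that] unfolding Dm_def by auto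
  have bDm: "bddX Dm" by (rule bddXI[OF DB])
  have bdd: "bdd_above (Dm ` X)" using DB by (intro bdd_aboveI2[of _ _ B]) (auto dest: abs_le_D1)
  have le_m: "Dm \<omega> \<le> m" if "\<omega> \<in> X" for \<omega> unfolding m_def by (rule cSUP_upper[OF that bdd])
  have Dm0: "0 \<le> Dm \<omega>" for \<omega> by (simp add: Dm_def)
  have m0: "0 \<le> m" using le_m[OF \<omega>] Dm0[of \<omega>] by simp
  have half: "Dm \<upsilon> \<le> m / 2" if \<upsilon>: "\<upsilon> \<in> X" for \<upsilon>
  proof -
    have "- T D \<upsilon> = T (\<lambda>\<omega>. - D \<omega>) \<upsilon>" using T_scaleR[OF bD, of "-1" \<upsilon>] by simp
    also have "\<dots> \<le> T Dm \<upsilon>"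
      using bddX_scaleR[OF bD, of "-1"] by (intro T_mono bDm) (auto simp: Dm_def)
    also have "\<dots> \<le> (\<Sum>a\<in>F \<inter> I \<upsilon>. exp (\<phi> (case_nat a \<upsilon>)) * Dm (case_nat a \<upsilon>)) + m * infsum p (S - F)"
      by (rule T_split[OF Dm0 le_m m0 \<upsilon> F(1)])
    also have "(\<Sum>a\<in>F \<inter> I \<upsilon>. exp (\<phi> (case_nat a \<upsilon>)) * Dm (case_nat a \<upsilon>)) = 0"
    proof (rule sum.neutral, rule ballI)
      fix a assume a: "a \<in> F \<inter> I \<upsilon>"
      then have "0 \<le> D (case_nat a \<upsilon>)" by (intro nn Cons_in_X \<upsilon>) (auto simp: I_iff)
      then show "exp (\<phi> (case_nat a \<upsilon>)) * Dm (case_nat a \<upsilon>) = 0" by (simp add: Dm_def)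
    qed
    also have "0 + m * infsum p (S - F) \<le> m * (\<Lambda> / 2)" using mult_left_mono[OF F(2) m0] by simp
    finally have "\<Lambda> * (- D \<upsilon>) \<le> \<Lambda> * (m / 2)" using super[OF \<upsilon>] by (simp add: mult.commute)
    then have "- D \<upsilon> \<le> m / 2" using growth_rate_pos by (simp only: mult_le_cancel_left_pos)
    then show ?thesis using m0 by (simp add: Dm_def)
  qed
  have "X \<noteq> {}" using \<omega> by blast
  then have "m \<le> m / 2" using cSUP_least[of X Dm "m / 2"] half unfolding m_def[symmetric] by simp
  then have "m \<le> 0" by simp
  then show ?thesis using le_m[OF \<omega>] by (simp add: Dm_def)
qed

text \<open>The largest multiple \<open>c h\<close> below a supersolution \<open>g\<close> touches it (in the infimum) over finitely
  many states; going backwards along admissible words, the contact spreads to all of \<open>XM\<close>.\<close>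

lemma minimum_principle:
  fixes g :: "(nat \<Rightarrow> 's) \<Rightarrow> real"
  assumes g: "(\<lambda>\<omega>. complex_of_real (g \<omega>)) \<in> W"
    and super: "\<And>\<omega>. \<omega> \<in> X \<Longrightarrow> T g \<omega> \<le> \<Lambda> * g \<omega>"
  shows "\<exists>c. (\<forall>\<omega>\<in>X. c * h \<omega> \<le> g \<omega>) \<and> (\<forall>\<omega>\<in>XM. g \<omega> = c * h \<omega>)"
proof -
  note \<Lambda> = growth_rate_pos
  have bg: "bddX g" by (rule bddX_real[OF g])
  have "0 < \<Lambda> / 2" using \<Lambda> by simp
  then obtain F where F: "finite F" "F \<subseteq> S" "infsum p (S - F) \<le> \<Lambda> / 2" by (rule tail_small)
  have fin: "finite (F \<inter> S0)" using F(1) by simp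
  have superD: "T (\<lambda>\<omega>. g \<omega> - c * h \<omega>) \<omega> \<le> \<Lambda> * (g \<omega> - c * h \<omega>)" if "\<omega> \<in> X" for c \<omega>
    using super[OF that] by (simp add: T_diff[OF bg bddX_mult[OF bddX_h]] T_mult[OF bddX_h] T_h algebra_simps)
  have bD: "bddX (\<lambda>\<omega>. g \<omega> - c * h \<omega>)" for c by (intro bddX_diff bddX_mult bg bddX_h)
  define Cs where "Cs = {c. \<forall>\<omega>\<in>X. c * h \<omega> \<le> g \<omega>}"
  \<comment> \<open>Comparison with a multiple of \<open>h\<close> has to be checked over the
    finitely many states in \<open>F\<close> only, where \<open>h\<close> is bounded away from
    zero.\<close>
  have CsI: "c \<in> Cs" if c: "\<And>\<omega>. \<omega> \<in> X \<Longrightarrow> \<omega> 0 \<in> F \<inter> S0 \<Longrightarrow> c * h \<omega> \<le> g \<omega>" for c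
  proof -
    have "0 \<le> g \<omega> - c * h \<omega>" if "\<omega> \<in> X" for \<omega>
      by (rule nonneg_off_finite[OF bD superD F(1,3) _ that]) (use c in auto)
    then show ?thesis by (simp add: Cs_def)
  qed
  obtain \<eta> where \<eta>: "0 < \<eta>" "\<And>\<omega>. \<omega> \<in> X \<Longrightarrow> \<omega> 0 \<in> F \<inter> S0 \<Longrightarrow> \<eta> \<le> h \<omega>"
  proof -
    have "\<exists>e>0. \<forall>\<omega>\<in>X. \<omega> 0 = a \<longrightarrow> e \<le> h \<omega>" if a: "a \<in> F \<inter> S0" for a
    proof -
      obtain \<upsilon> where \<upsilon>: "\<upsilon> \<in> XM" "\<upsilon> 0 = a" using XM_start a by blast
      have "h \<upsilon> / exp K \<le> h \<omega>" if "\<omega> \<in> X" "\<omega> 0 = a" for \<omega>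
        using h_distort[of \<upsilon> \<omega>] \<upsilon> XM_subset that by (auto simp: divide_le_eq mult.commute)
      then show ?thesis using h_pos_XM[OF \<upsilon>(1)] by (intro exI[of _ "h \<upsilon> / exp K"]) auto
    qed
    from uniform_lower_bound[OF fin this] show thesis using that by blast
  qed
  obtain B where B: "0 \<le> B" "\<And>\<omega>. \<omega> \<in> X \<Longrightarrow> norm (g \<omega>) \<le> B" using bddXE[OF bg] by blast
  have "- (B / \<eta>) \<in> Cs"
  proof (rule CsI)
    fix \<omega> assume \<omega>: "\<omega> \<in> X" "\<omega> 0 \<in> F \<inter> S0"
    have "B / \<eta> * \<eta> \<le> B / \<eta> * h \<omega>" using B(1) \<eta> \<omega> by (intro mult_left_mono) auto
    then show "- (B / \<eta>) * h \<omega> \<le> g \<omega>" using B(2)[OF \<omega>(1)] \<eta>(1) by simp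
  qed
  then have ne: "Cs \<noteq> {}" by blast
  have up: "c \<le> g \<omega> / h \<omega>" if "c \<in> Cs" "\<omega> \<in> X" "0 < h \<omega>" for c \<omega>
    using that by (auto simp: Cs_def le_divide_eq)
  obtain \<omega>1 where \<omega>1: "0 < h \<omega>1" using h_nonzero by blast
  have bdd: "bdd_above Cs" using up[OF _ h_pos_imp(1)[OF \<omega>1] \<omega>1] by (rule bdd_aboveI)
  define c where "c = Sup Cs"
  have cCs: "c * h \<omega> \<le> g \<omega>" if \<omega>: "\<omega> \<in> X" for \<omega>
  proof (cases "0 < h \<omega>")
    case True
    then have "c \<le> g \<omega> / h \<omega>" unfolding c_def using up \<omega> by (intro cSup_least ne) auto
    then show ?thesis using True by (simp add: le_divide_eq)
  next
    case False
    then have "h \<omega> = 0" using h_nonneg[of \<omega>] by simp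
    then show ?thesis using ne \<omega> by (auto simp: Cs_def)
  qed
  define D where "D \<omega> = g \<omega> - c * h \<omega>" for \<omega>
  have D0: "0 \<le> D \<omega>" if "\<omega> \<in> X" for \<omega> using cCs[OF that] by (simp add: D_def)
  have DT: "T D \<omega> \<le> \<Lambda> * D \<omega>" if "\<omega> \<in> X" for \<omega> using superD[OF that, of c] by (simp add: D_def[abs_def])
  have bDD: "bddX D" using bD[of c] by (simp add: D_def[abs_def])
  \<comment> \<open>An infimum of zero instead of an attained zero: without compactness contact need
    not happen at a point.\<close>
  define touches where "touches C \<longleftrightarrow> (\<forall>e>0. \<exists>\<omega>\<in>C. D \<omega> < e)" for C
  \<comment> \<open>Otherwise \<open>D\<close> would exceed some \<open>e > 0\<close> over
    \<open>F\<close>, and \<open>c\<close> could be raised by \<open>e / (H + 1)\<close>, with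
    \<open>H\<close> a bound for \<open>h\<close>.\<close>
  have "\<exists>a\<in>F \<inter> S0. touches {\<omega> \<in> X. \<omega> 0 = a}"
  proof (rule ccontr)
    assume none: "\<not> ?thesis"
    have "\<exists>e>0. \<forall>\<omega>\<in>X. \<omega> 0 = a \<longrightarrow> e \<le> D \<omega>" if a: "a \<in> F \<inter> S0" for a
    proof -
      obtain e where "0 < e" "\<not> (\<exists>\<omega>\<in>{\<omega> \<in> X. \<omega> 0 = a}. D \<omega> < e)"
        using none a unfolding touches_def by blast
      then show ?thesis by (intro exI[of _ e]) (auto simp: not_less)
    qed
    from uniform_lower_bound[OF fin this] obtain e
      where e: "0 < e" "\<And>\<omega>. \<omega> \<in> X \<Longrightarrow> \<omega> 0 \<in> F \<inter> S0 \<Longrightarrow> e \<le> D \<omega>" by blast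
    obtain H where H: "0 \<le> H" "\<And>\<omega>. \<omega> \<in> X \<Longrightarrow> norm (h \<omega>) \<le> H" using bddXE[OF bddX_h] by blast
    have "c + e / (H + 1) \<in> Cs"
    proof (rule CsI)
      fix \<omega> assume \<omega>: "\<omega> \<in> X" "\<omega> 0 \<in> F \<inter> S0"
      have "e / (H + 1) * h \<omega> \<le> e / (H + 1) * (H + 1)"
        using H(2)[OF \<omega>(1)] H(1) e(1) by (intro mult_left_mono) auto
      then have "e / (H + 1) * h \<omega> \<le> D \<omega>" using e(2)[OF \<omega>] H(1) by simp
      then show "(c + e / (H + 1)) * h \<omega> \<le> g \<omega>" by (simp add: D_def algebra_simps)
    qed
    then have "c + e / (H + 1) \<le> c" unfolding c_def by (rule cSup_upper[OF _ bdd])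
    moreover have "0 < e / (H + 1)" using e(1) H(1) by simp
    ultimately show False by simp
  qed
  then obtain a where a: "a \<in> S0" "touches {\<omega> \<in> X. \<omega> 0 = a}" by blast
  \<comment> \<open>\<open>\<Lambda> * D\<close> dominates the single term that prepends
    \<open>b\<close>, and by distortion the weight of this term is at least \<open>\<beta>\<close>
    throughout \<open>C\<close>. So where \<open>D\<close> is small it stays small after prepending
    \<open>b\<close>.\<close>
  have step: "touches (case_nat b ` C)"
    if tC: "touches C" and C: "C \<subseteq> X" "\<And>\<omega>. \<omega> \<in> C \<Longrightarrow> \<omega> 0 = b'" and bb': "(b, b') \<in> edges"
    for C b b'
  proof -
    have "\<exists>\<omega>'\<in>C. D \<omega>' < 1" using tC unfolding touches_def by simp
    then obtain \<omega>' where \<omega>': "\<omega>' \<in> C" by blast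
    define \<beta> where "\<beta> = exp (\<phi> (case_nat b \<omega>') - K)"
    show ?thesis
      unfolding touches_def
    proof (intro allI impI)
      fix e :: real assume e: "0 < e"
      then have "0 < e * \<beta> / \<Lambda>" using \<Lambda> by (simp add: \<beta>_def)
      then obtain \<omega> where \<omega>: "\<omega> \<in> C" "D \<omega> < e * \<beta> / \<Lambda>"
        using tC unfolding touches_def by blast
      have X: "\<omega> \<in> X" "\<omega>' \<in> X" "\<omega> 0 = \<omega>' 0" using \<omega>(1) \<omega>' C by auto
      have b: "b \<in> I \<omega>" using C(2)[OF \<omega>(1)] bb' edges_iff_I[of b \<omega>] by simp
      have "(K - \<theta> * K) * d \<omega> \<omega>' \<le> K * 1"
        using K_nonneg theta d_nonneg[of \<omega> \<omega>'] d_theta_le_1[OF theta, of \<omega> \<omega>'] by (intro mult_mono) auto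
      then have "\<phi> (case_nat b \<omega>') - K \<le> \<phi> (case_nat b \<omega>)" using phi_diff[OF X b] by linarith
      then have "\<beta> * D (case_nat b \<omega>) \<le> exp (\<phi> (case_nat b \<omega>)) * D (case_nat b \<omega>)"
        unfolding \<beta>_def using D0[OF Cons_in_X[OF X(1) b]] by (intro mult_right_mono) auto
      also have "\<dots> \<le> T D \<omega>" by (rule T_ge_term[OF bDD D0 X(1) b])
      also have "\<dots> \<le> \<Lambda> * D \<omega>" by (rule DT[OF X(1)])
      also have "\<dots> < e * \<beta>" using \<omega>(2) \<Lambda> by (simp add: pos_less_divide_eq mult.commute)
      finally have "D (case_nat b \<omega>) < e" by (simp add: \<beta>_def mult.commute)
      then show "\<exists>\<omega>\<in>case_nat b ` C. D \<omega> < e" using \<omega>(1) by blast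
    qed
  qed
  have touches_mono: "touches C'" if "touches C" "C \<subseteq> C'" for C C'
    using that unfolding touches_def by blast
  have all: "touches {\<omega> \<in> X. \<omega> 0 = b}" if "b \<in> S0" for b
  proof -
    have "(b, a) \<in> edges\<^sup>*" by (rule reach[OF that a(1)])
    then show ?thesis
    proof (induction rule: converse_rtrancl_induct)
      case (step b b')
      have "touches (case_nat b ` {\<omega> \<in> X. \<omega> 0 = b'})"
        by (rule \<open>\<And>C b b'. touches C \<Longrightarrow> C \<subseteq> X \<Longrightarrow> (\<And>\<omega>. \<omega> \<in> C \<Longrightarrow> \<omega> 0 = b') \<Longrightarrow> (b, b') \<in> edges \<Longrightarrow>
            touches (case_nat b ` C)\<close>[OF step.IH _ _ step(1)]) auto
      then show ?case
        by (rule touches_mono) (use step(1) edges_iff_I Cons_in_X in auto)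
    qed (rule a(2))
  qed
  have prefix: "touches {\<omega> \<in> X. \<forall>i\<le>m. \<omega> i = \<upsilon> i}" if "\<upsilon> \<in> XM" for m \<upsilon>
    using that
  proof (induction m arbitrary: \<upsilon>)
    case 0
    then show ?case using all[of "\<upsilon> 0"] by (simp add: markov_shift_def)
  next
    case (Suc m)
    have e: "(\<upsilon> 0, shift \<upsilon> 0) \<in> edges" using head_in_I[OF Suc.prems] by (simp add: edges_iff_I)
    have "touches (case_nat (\<upsilon> 0) ` {\<omega> \<in> X. \<forall>i\<le>m. \<omega> i = shift \<upsilon> i})"
      by (rule step[OF Suc.IH[OF shift_XM[OF Suc.prems]] _ _ e]) auto
    then show ?case
    proof (rule touches_mono, safe)
      fix \<omega> assume \<omega>: "\<omega> \<in> X" "\<forall>i\<le>m. \<omega> i = shift \<upsilon> i"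
      show "case_nat (\<upsilon> 0) \<omega> \<in> X" using \<omega> e by (intro Cons_in_X) (simp_all add: edges_iff_I[symmetric])
      fix i assume "i \<le> Suc m"
      then show "case_nat (\<upsilon> 0) \<omega> i = \<upsilon> i" using \<omega>(2) by (cases i) (auto simp: shift_def)
    qed
  qed
  define Dc where "Dc = (\<lambda>\<omega>. complex_of_real (D \<omega>))"
  have DcW: "Dc \<in> W"
    using diff_mem[OF g scale_mem[OF h_mem, of "of_real c"]] by (simp add: Dc_def D_def)
  have "D \<upsilon> = 0" if \<upsilon>: "\<upsilon> \<in> XM" for \<upsilon>
  proof -
    have \<upsilon>X: "\<upsilon> \<in> X" using \<upsilon> XM_subset by blast
    \<comment> \<open>There are near-contacts that agree with \<open>\<upsilon>\<close> in the first
      \<open>Suc m\<close> places, so the Lipschitz bound controls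
      \<open>D \<upsilon>\<close>.\<close>
    have le: "D \<upsilon> \<le> N Dc * \<theta> ^ Suc m" for m
    proof (rule field_le_epsilon)
      fix e :: real assume "0 < e"
      then obtain \<omega> where \<omega>: "\<omega> \<in> X" "\<forall>i\<le>m. \<omega> i = \<upsilon> i" "D \<omega> < e"
        using prefix[OF \<upsilon>, of m] unfolding touches_def by blast
      have "cmod (Dc \<upsilon> - Dc \<omega>) \<le> N Dc * \<theta> ^ Suc m"
        by (rule lip_dist_le[OF DcW \<upsilon>X \<omega>(1)]) (use \<omega>(2) in auto)
      then have "\<bar>D \<upsilon> - D \<omega>\<bar> \<le> N Dc * \<theta> ^ Suc m"
        unfolding Dc_def of_real_diff[symmetric] norm_of_real .
      then show "D \<upsilon> \<le> N Dc * \<theta> ^ Suc m + e" using \<omega>(3) by linarith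
    qed
    have "(\<lambda>m. N Dc * \<theta> ^ Suc m) \<longlonglongrightarrow> N Dc * 0"
      using theta by (intro tendsto_intros LIMSEQ_Suc LIMSEQ_realpow_zero) auto
    then have "D \<upsilon> \<le> N Dc * 0" by (rule LIMSEQ_le_const) (use le in blast)
    then show ?thesis using D0[OF \<upsilon>X] by simp
  qed
  then show ?thesis using cCs by (intro exI[of _ c]) (auto simp: D_def)
qed

text \<open>The minimum principle applies to \<open>- |g|\<close>. A zero on \<open>XM\<close>,
  where \<open>h\<close> is positive, forces \<open>c = 0\<close>, and then
  \<open>0 \<le> - |g|\<close> on \<open>X\<close>.\<close>

lemma subsolution_zero:
  assumes g: "g \<in> W" and sub: "\<And>\<omega>. \<omega> \<in> X \<Longrightarrow> \<Lambda> * cmod (g \<omega>) \<le> T (\<lambda>\<omega>. cmod (g \<omega>)) \<omega>"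
    and \<upsilon>: "\<upsilon> \<in> XM" "g \<upsilon> = 0"
  shows "g = (\<lambda>_. 0)"
proof -
  have b: "bddX (\<lambda>\<omega>. cmod (g \<omega>))" by (intro bddX_norm bddX_W g)
  have m: "(\<lambda>\<omega>. complex_of_real (- cmod (g \<omega>))) \<in> W" using minus_mem[OF norm_mem[OF g]] by simp
  have "T (\<lambda>\<omega>. - cmod (g \<omega>)) \<omega> \<le> \<Lambda> * (- cmod (g \<omega>))" if "\<omega> \<in> X" for \<omega>
    using sub[OF that] T_scaleR[OF b, of "-1" \<omega>] by simp
  from minimum_principle[OF m this] obtain c
    where c: "\<And>\<omega>. \<omega> \<in> X \<Longrightarrow> c * h \<omega> \<le> - cmod (g \<omega>)" "\<And>\<omega>. \<omega> \<in> XM \<Longrightarrow> - cmod (g \<omega>) = c * h \<omega>"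
    by blast
  have "c = 0" using c(2)[OF \<upsilon>(1)] \<upsilon>(2) h_pos_XM[OF \<upsilon>(1)] by simp
  then have "g \<omega> = 0" if "\<omega> \<in> X" for \<omega> using c(1)[OF that] by simp
  then show ?thesis using FbD(1)[OF g] by blast
qed

text \<open>The minimum principle gives proportionality on \<open>XM\<close> only. Elsewhere the
  difference \<open>g - c h\<close> vanishes because its modulus is a subsolution with a zero on
  \<open>XM\<close>.\<close>

lemma real_eigenfunction_unique:
  fixes g :: "(nat \<Rightarrow> 's) \<Rightarrow> real"
  assumes g: "(\<lambda>\<omega>. complex_of_real (g \<omega>)) \<in> W" and eig: "\<And>\<omega>. T g \<omega> = \<Lambda> * g \<omega>"
  shows "\<exists>c. g = (\<lambda>\<omega>. c * h \<omega>)"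
proof -
  have bg: "bddX g" by (rule bddX_real[OF g])
  obtain c where c: "\<And>\<omega>. \<omega> \<in> XM \<Longrightarrow> g \<omega> = c * h \<omega>"
    using minimum_principle[OF g] eig by fastforce
  define D where "D \<omega> = g \<omega> - c * h \<omega>" for \<omega>
  have Dm: "(\<lambda>\<omega>. complex_of_real (D \<omega>)) \<in> W"
    using diff_mem[OF g scale_mem[OF h_mem, of "of_real c"]] by (simp add: D_def)
  have bD: "bddX D" by (rule bddX_real[OF Dm])
  have TD: "T D \<omega> = \<Lambda> * D \<omega>" for \<omega>
    unfolding D_def by (simp add: T_diff[OF bg bddX_mult[OF bddX_h]] T_mult[OF bddX_h] T_h eig algebra_simps)
  obtain \<upsilon> where \<upsilon>: "\<upsilon> \<in> XM" using per by blast
  have "(\<lambda>\<omega>. complex_of_real (D \<omega>)) = (\<lambda>_. 0)"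
  proof (rule subsolution_zero[OF Dm _ \<upsilon>])
    show "\<Lambda> * cmod (of_real (D \<omega>)) \<le> T (\<lambda>\<omega>. cmod (of_real (D \<omega>))) \<omega>" for \<omega>
      using T_norm[OF bD, of \<omega>] growth_rate_pos by (simp add: TD abs_mult)
  qed (simp add: D_def c[OF \<upsilon>])
  then have "D \<omega> = 0" for \<omega> by (metis of_real_eq_0_iff)
  then show ?thesis unfolding D_def by (intro exI[of _ c]) (auto simp: fun_eq_iff)
qed

lemma eigenfunction_unique:
  assumes g: "g \<in> W" and eig: "\<And>\<omega>. T g \<omega> = of_real \<Lambda> * g \<omega>"
  shows "\<exists>c. g = (\<lambda>\<omega>. c * of_real (h \<omega>))"
proof -
  have re: "\<exists>c. (\<lambda>\<omega>. Re (f \<omega>)) = (\<lambda>\<omega>. c * h \<omega>)"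
    if f: "f \<in> W" "\<And>\<omega>. T f \<omega> = of_real \<Lambda> * f \<omega>" for f
    by (rule real_eigenfunction_unique[OF Re_mem[OF f(1)]])
       (simp add: T_Re[OF bddX_W[OF f(1)]] f(2))
  obtain c1 where c1: "(\<lambda>\<omega>. Re (g \<omega>)) = (\<lambda>\<omega>. c1 * h \<omega>)" using re[OF g eig] by blast
  \<comment> \<open>\<open>Re (\<i> * g)\<close> is \<open>- Im g\<close>, hence the sign of
    \<open>c2\<close> below.\<close>
  have "T (\<lambda>\<omega>. \<i> * g \<omega>) \<omega> = of_real \<Lambda> * (\<i> * g \<omega>)" for \<omega>
    by (simp add: T_mult[OF bddX_W[OF g]] eig)
  from re[OF scale_mem[OF g] this] obtain c2 where c2: "(\<lambda>\<omega>. Re (\<i> * g \<omega>)) = (\<lambda>\<omega>. c2 * h \<omega>)" by blast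
  have "g = (\<lambda>\<omega>. Complex c1 (- c2) * of_real (h \<omega>))"
  proof
    fix \<omega>
    show "g \<omega> = Complex c1 (- c2) * of_real (h \<omega>)"
      using fun_cong[OF c1, of \<omega>] fun_cong[OF c2, of \<omega>] by (simp add: complex_eq_iff)
  qed
  then show ?thesis by blast
qed

text \<open>If \<open>c \<noteq> 0\<close>, then \<open>Re (g / c)\<close> is a supersolution and
  dominates some \<open>b h\<close> with equality at \<open>\<upsilon>\<close>. At that point
  \<open>T\<close> of the nonnegative difference would equal \<open>- u \<upsilon>\<close>, which is
  negative.\<close>

lemma no_jordan_chain:
  assumes g: "g \<in> W" and eq: "\<And>\<omega>. of_real \<Lambda> * g \<omega> - T g \<omega> = c * of_real (u \<omega>)"
    and u: "\<And>\<omega>. 0 \<le> u \<omega>" "0 < u \<upsilon>" "\<upsilon> \<in> XM"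
  shows "c = 0"
proof (rule ccontr)
  assume "c \<noteq> 0"
  define f where "f \<omega> = Re ((1 / c) * g \<omega>)" for \<omega>
  have f: "(\<lambda>\<omega>. complex_of_real (f \<omega>)) \<in> W" unfolding f_def by (rule Re_mem[OF scale_mem[OF g]])
  have Tf: "T f \<omega> = \<Lambda> * f \<omega> - u \<omega>" for \<omega>
  proof -
    have "T f \<omega> = Re ((1 / c) * T g \<omega>)"
      unfolding f_def T_Re[OF bddX_mult[OF bddX_W[OF g]]] T_mult[OF bddX_W[OF g]] ..
    also have "T g \<omega> = of_real \<Lambda> * g \<omega> - c * of_real (u \<omega>)" using eq[of \<omega>] by (simp add: algebra_simps)
    also have "(1 / c) * \<dots> = of_real \<Lambda> * ((1 / c) * g \<omega>) - of_real (u \<omega>)"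
      using \<open>c \<noteq> 0\<close> by (simp add: right_diff_distrib)
    also have "Re \<dots> = \<Lambda> * f \<omega> - u \<omega>"
      unfolding f_def minus_complex.sel times_complex.sel Re_complex_of_real Im_complex_of_real by simp
    finally show ?thesis .
  qed
  obtain b where b: "\<And>\<omega>. \<omega> \<in> X \<Longrightarrow> b * h \<omega> \<le> f \<omega>" "\<And>\<omega>. \<omega> \<in> XM \<Longrightarrow> f \<omega> = b * h \<omega>"
    using minimum_principle[OF f] u(1) by (auto simp: Tf)
  have "0 \<le> T (\<lambda>\<omega>. f \<omega> - b * h \<omega>) \<upsilon>" by (rule T_nonneg) (simp add: b(1))
  then show False
    using b(2)[OF u(3)] u(2)
    by (simp add: T_diff[OF bddX_real[OF f] bddX_mult[OF bddX_h]] T_mult[OF bddX_h] T_h Tf)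
qed

end

section \<open>The induced operator\<close>

context shift_space
begin

lemma chi_simp: "chi X B \<omega> = (if \<omega> \<in> X \<and> \<omega> 0 \<in> B then 1 else 0)"
  by (simp add: chi_def indicator_def)

text \<open>\<open>chi\<close> depends on the first letter only, and the seminorm compares only
  points with equal first letters, so multiplication costs nothing.\<close>

lemma chi_mem:
  assumes f: "f \<in> W"
  shows "(\<lambda>\<omega>. chi X B \<omega> * f \<omega>) \<in> W" "N (\<lambda>\<omega>. chi X B \<omega> * f \<omega>) \<le> N f"
proof -
  note I = FbI[of "\<lambda>\<omega>. chi X B \<omega> * f \<omega>" "sn X f" "ls \<theta> X f"]
  have 1: "cmod (chi X B \<omega> * f \<omega>) \<le> sn X f" if "\<omega> \<in> X" for \<omega>
    using FbD(2,5)[OF f] that by (simp add: chi_simp)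
  have 2: "cmod (chi X B \<omega> * f \<omega> - chi X B \<upsilon> * f \<upsilon>) \<le> ls \<theta> X f * d \<omega> \<upsilon>"
    if "\<omega> \<in> X" "\<upsilon> \<in> X" "\<omega> 0 = \<upsilon> 0" for \<omega> \<upsilon>
    using FbD(3)[OF f that] FbD(6)[OF f] d_nonneg[of \<omega> \<upsilon>] that by (simp add: chi_simp)
  show "(\<lambda>\<omega>. chi X B \<omega> * f \<omega>) \<in> W"
    by (rule I(1)[OF _ _ 1 _ 2]) (use FbD(5,6)[OF f] in \<open>auto simp: chi_simp\<close>)
  have "N (\<lambda>\<omega>. chi X B \<omega> * f \<omega>) \<le> sn X f + ls \<theta> X f"
    by (rule I(4)[OF _ _ 1 _ 2]) (use FbD(5,6)[OF f] in \<open>auto simp: chi_simp\<close>)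
  then show "N (\<lambda>\<omega>. chi X B \<omega> * f \<omega>) \<le> N f" by (simp add: FbD(4)[OF f])
qed

lemma bop_chi: "bop (\<lambda>f \<omega>. chi X B \<omega> * f \<omega>)"
  by (rule bopI[of _ 1]) (simp_all add: chi_mem distrib_left mult.left_commute)

lemma bop_block: "bop L \<Longrightarrow> bop (block X L B1 B2)"
  using bop_comp[OF bop_chi bop_comp[OF _ bop_chi], of L B1 B2] by (simp add: block_def[abs_def])

end

locale induced_transfer = irreducible_transfer \<theta> S A S0 M \<phi>
  for \<theta> :: real and S :: "'s set" and A :: "'s \<Rightarrow> 's \<Rightarrow> nat"
    and S0 :: "'s set" and M :: "'s \<Rightarrow> 's \<Rightarrow> nat" and \<phi> :: "(nat \<Rightarrow> 's) \<Rightarrow> real" +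
  fixes U V :: "'s set"
  assumes U: "U \<noteq> {}" "U \<subseteq> S0" and V: "V = S0 - U"
begin

section \<open>The block on \<open>V\<close> as a transfer operator\<close>

sublocale VT: transfer \<theta> S A V M \<phi>
  by unfold_locales (use S0 V MA summable_phi lip_phi in auto)

abbreviation "TT B1 B2 \<equiv> block X T B1 B2"

lemma VT_T:
  "VT.T f \<omega> = (if \<omega> 0 \<in> V then T (\<lambda>\<upsilon>. if \<upsilon> 0 \<in> V then f \<upsilon> else 0) \<omega> else 0)"
proof (cases "\<omega> \<in> X \<and> \<omega> 0 \<in> V")
  case True
  have "V \<subseteq> S0" using V by blast
  have "VT.T f \<omega> = (\<Sum>\<^sub>\<infinity>a\<in>VT.I \<omega>. exp (\<phi> (case_nat a \<omega>)) *\<^sub>R f (case_nat a \<omega>))"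
    using True by (simp add: VT.T_def)
  also have "\<dots> = (\<Sum>\<^sub>\<infinity>a\<in>I \<omega>. exp (\<phi> (case_nat a \<omega>)) *\<^sub>R (if case_nat a \<omega> 0 \<in> V then f (case_nat a \<omega>) else 0))"
    by (rule infsum_cong_neutral) (use True \<open>V \<subseteq> S0\<close> in \<open>auto simp: VT.I_iff I_iff\<close>)
  finally show ?thesis using True by (simp add: T_def)
next
  case False
  then show ?thesis using VT.T_outside VT.T_outside_S0 T_outside by auto
qed

text \<open>Cutting with \<open>chi\<close> on both sides amounts to restricting the matrix to
  \<open>V\<close>, which makes everything proved for \<open>transfer\<close>, in particular
  \<open>fredholm\<close>, available for this block.\<close>

lemma block_VV: "TT V V = VT.T"
proof (intro ext)
  fix f \<omega>
  have "T (\<lambda>\<upsilon>. chi X V \<upsilon> * f \<upsilon>) = T (\<lambda>\<upsilon>. if \<upsilon> 0 \<in> V then f \<upsilon> else 0)"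
    by (rule T_cong) (simp add: chi_simp)
  then show "TT V V f \<omega> = VT.T f \<omega>"
    by (auto simp: block_def VT_T chi_simp T_outside)
qed

lemma VT_T_le:
  fixes f g :: "(nat \<Rightarrow> 's) \<Rightarrow> real"
  assumes "bddX g" "\<And>\<omega>. \<omega> \<in> X \<Longrightarrow> 0 \<le> f \<omega>" "\<And>\<omega>. \<omega> \<in> X \<Longrightarrow> f \<omega> \<le> g \<omega>"
  shows "VT.T f \<omega> \<le> T g \<omega>"
proof -
  obtain B where B: "0 \<le> B" "\<And>\<omega>. \<omega> \<in> X \<Longrightarrow> norm (g \<omega>) \<le> B" using bddXE[OF assms(1)] by blast
  have g0: "0 \<le> g \<omega>" if "\<omega> \<in> X" for \<omega> using assms(2,3)[OF that] by linarith
  have "bddX (\<lambda>\<upsilon>. if \<upsilon> 0 \<in> V then f \<upsilon> else 0)"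
    by (rule bddXI[of _ B]) (use assms(2,3) B in \<open>fastforce\<close>)
  then have "T (\<lambda>\<upsilon>. if \<upsilon> 0 \<in> V then f \<upsilon> else 0) \<omega> \<le> T g \<omega>"
    by (rule T_mono[OF _ assms(1)]) (use assms(3) g0 in auto)
  then show ?thesis using T_nonneg[OF g0] by (simp add: VT_T)
qed

lemma VT_grows:
  assumes "grows r"
  shows "VT.grows r"
proof -
  have le: "(VT.T ^^ n) (\<lambda>_. 1) \<omega> \<le> (T ^^ n) (\<lambda>_. 1::real) \<omega>" if "\<omega> \<in> X" for n \<omega>
    using that
  proof (induction n arbitrary: \<omega>)
    case (Suc n)
    have "VT.T ((VT.T ^^ n) (\<lambda>_. 1)) \<omega> \<le> T ((T ^^ n) (\<lambda>_. 1::real)) \<omega>"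
      by (intro VT_T_le bddX_Tn bddX_const VT.Tn_nonneg Suc.IH) auto
    then show ?case by simp
  qed auto
  obtain C where "0 \<le> C" "\<And>n \<omega>. \<omega> \<in> X \<Longrightarrow> (T ^^ n) (\<lambda>_. 1) \<omega> \<le> C * r ^ n"
    using assms unfolding grows_def by blast
  then show ?thesis unfolding VT.grows_def using le order_trans by (intro exI[of _ C]) blast
qed

lemma XM_U:
  obtains w where "w \<in> XM" "w 0 \<in> U"
  using XM_start U by blast

text \<open>For a null vector \<open>g\<close> of \<open>\<Lambda> - T\<^sub>V\<^sub>V\<close> the
  modulus \<open>|g|\<close> is a subsolution for the full operator \<open>T\<close>, and
  \<open>g\<close> vanishes at a point of \<open>XM\<close> that starts in \<open>U\<close>. So
  \<open>g = 0\<close>, and \<open>fredholm\<close> with \<open>u = 0\<close> gives the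
  inverse.\<close>

lemma resolvent_VV: "\<exists>R. is_resolvent (TT V V) (of_real \<Lambda>) R"
proof -
  obtain w where w: "w \<in> XM" "w 0 \<in> U" by (rule XM_U)
  have "\<exists>R. is_resolvent (\<lambda>f x. VT.T f x - f w * (\<lambda>_. 0) x) (of_real \<Lambda>) R"
  proof (rule VT.fredholm[where ur = "\<lambda>_. 0"])
    fix g :: "(nat \<Rightarrow> 's) \<Rightarrow> complex"
    assume g: "g \<in> W" and eq: "\<And>x. of_real \<Lambda> * g x = VT.T g x - g w * (\<lambda>_. 0) x"
    show "g = (\<lambda>_. 0)"
    proof (rule subsolution_zero[OF g _ w(1)])
      fix \<omega> assume "\<omega> \<in> X"
      have "\<Lambda> * cmod (g \<omega>) = cmod (VT.T g \<omega>)"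
        using arg_cong[OF eq[of \<omega>], of cmod] growth_rate_pos by (simp add: norm_mult)
      also have "\<dots> \<le> VT.T (\<lambda>\<upsilon>. cmod (g \<upsilon>)) \<omega>" by (rule VT.T_norm[OF bddX_W[OF g]])
      also have "\<dots> \<le> T (\<lambda>\<upsilon>. cmod (g \<upsilon>)) \<omega>" by (intro VT_T_le bddX_norm bddX_W g) auto
      finally show "\<Lambda> * cmod (g \<omega>) \<le> T (\<lambda>\<upsilon>. cmod (g \<upsilon>)) \<omega>" .
    next
      have "VT.T g w = 0" by (rule VT.T_outside_S0) (use w V in auto)
      then show "g w = 0" using eq[of w] growth_rate_pos by simp
    qed
  qed (use VT_grows grows_gt growth_rate_pos zero_mem w XM_subset in auto)
  then show ?thesis by (simp add: block_VV)
qed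

definition w :: "nat \<Rightarrow> 's" where "w = (SOME w. w \<in> XM \<and> w 0 \<in> U)"

lemma w: "w \<in> XM" "w 0 \<in> U" "w \<in> X"
proof -
  have "\<exists>w. w \<in> XM \<and> w 0 \<in> U" using XM_U by blast
  from someI_ex[OF this] show "w \<in> XM" "w 0 \<in> U" by (simp_all add: w_def)
  then show "w \<in> X" using XM_subset by blast
qed

definition u :: "(nat \<Rightarrow> 's) \<Rightarrow> complex" where
  "u = (\<lambda>\<omega>. chi X U \<omega> * of_real (h \<omega>))"

lemma u_mem: "u \<in> W"
  unfolding u_def by (rule chi_mem[OF h_mem])

lemma u_real: "u \<omega> = of_real (if \<omega> \<in> X \<and> \<omega> 0 \<in> U then h \<omega> else 0)"
  by (simp add: u_def chi_simp)

lemma u_w: "u w = of_real (h w)" "0 < h w"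
  using w h_pos_XM[OF w(1)] by (simp_all add: u_real)

text \<open>A null vector satisfies \<open>(\<Lambda> - T) g = - g w * u\<close>. Absence of Jordan
  chains gives \<open>g w = 0\<close>, so \<open>g\<close> is a multiple of \<open>h\<close> that
  vanishes at \<open>w\<close>, where \<open>h\<close> is positive.\<close>

lemma resolvent_rank_one_perturbation:
  "\<exists>R. is_resolvent (\<lambda>f x. T f x - f w * u x) (of_real \<Lambda>) R"
proof (rule fredholm[OF grows_gt growth_rate_pos u_mem u_real _ w(3)])
  fix g :: "(nat \<Rightarrow> 's) \<Rightarrow> complex"
  assume g: "g \<in> W" and eq: "\<And>x. of_real \<Lambda> * g x = T g x - g w * u x"
  have "- g w = 0"
  proof (rule no_jordan_chain[OF g _ _ _ w(1), where u = "\<lambda>\<omega>. if \<omega> \<in> X \<and> \<omega> 0 \<in> U then h \<omega> else 0"])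
    show "of_real \<Lambda> * g \<omega> - T g \<omega> = - g w * of_real (if \<omega> \<in> X \<and> \<omega> 0 \<in> U then h \<omega> else 0)" for \<omega>
      unfolding u_real[symmetric] eq by simp
  qed (use w u_w h_nonneg in auto)
  then have gw: "g w = 0" by simp
  obtain c where c: "g = (\<lambda>\<omega>. c * of_real (h \<omega>))"
    using eigenfunction_unique[OF g] eq by (auto simp: gw)
  have "c = 0" using gw u_w(2) unfolding c by simp
  then show "g = (\<lambda>_. 0)" by (simp add: c)
qed (use h_nonneg in auto)

section \<open>The induced operator as a Schur complement\<close>

definition RV :: "(nat \<Rightarrow> 's) operator" where
  "RV = (SOME R. is_resolvent (TT V V) (of_real \<Lambda>) R)"

definition RB :: "(nat \<Rightarrow> 's) operator" where
  "RB = (SOME R. is_resolvent (\<lambda>f x. T f x - f w * u x) (of_real \<Lambda>) R)"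

lemma RV: "is_resolvent (TT V V) (of_real \<Lambda>) RV"
  unfolding RV_def by (rule someI_ex[OF resolvent_VV])

lemma RB: "is_resolvent (\<lambda>f x. T f x - f w * u x) (of_real \<Lambda>) RB"
  unfolding RB_def by (rule someI_ex[OF resolvent_rank_one_perturbation])

text \<open>The induced operator written with a fixed bounded inverse. It agrees on \<open>W\<close>
  with the version based on \<open>the_inv_into\<close>, and spectra depend only on values on
  \<open>W\<close>.\<close>

definition J :: "(nat \<Rightarrow> 's) operator" where
  "J f = (\<lambda>\<omega>. TT U U f \<omega> + TT U V (RV (TT V U f)) \<omega>)"

lemma bop_TT: "bop (TT B1 B2)"
  by (rule bop_block[OF bop_T])

lemma bop_J: "bop J"
  using bop_plus[OF bop_TT bop_comp[OF bop_TT bop_comp[OF is_resolventD(1)[OF RV] bop_TT]], of U U U V V U]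
  by (simp add: J_def[abs_def])

lemma induced_eq_J: "f \<in> W \<Longrightarrow> induced_operator W X T U V (of_real \<Lambda>) f = J f"
  using resolvent_eq[OF RV bop_mem[OF bop_TT]] by (simp add: induced_operator_def J_def)

lemma block_chi: "TT B1 B2 (\<lambda>\<omega>. chi X B2 \<omega> * f \<omega>) = TT B1 B2 f"
proof -
  have "(\<lambda>\<omega>. chi X B2 \<omega> * (chi X B2 \<omega> * f \<omega>)) = (\<lambda>\<omega>. chi X B2 \<omega> * f \<omega>)"
    by (simp add: chi_simp fun_eq_iff)
  then show ?thesis by (simp add: block_def)
qed

lemma J_chi: "J (\<lambda>\<omega>. chi X U \<omega> * f \<omega>) = J f"
  unfolding J_def block_chi ..

text \<open>In \<open>\<Lambda> v = k + T\<^sub>V\<^sub>V v\<close> both terms on the right live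
  over \<open>V\<close>.\<close>

lemma RV_supported:
  assumes k: "k \<in> W" "\<And>\<omega>. chi X V \<omega> * k \<omega> = k \<omega>"
  shows "chi X V \<omega> * RV k \<omega> = RV k \<omega>"
proof -
  have "of_real \<Lambda> * RV k \<omega> - TT V V (RV k) \<omega> = k \<omega>"
    using fun_cong[OF is_resolventD(3)[OF RV k(1)], of \<omega>] by (simp add: scalar_minus_def)
  then show ?thesis using k(2)[of \<omega>] growth_rate_pos
    by (auto simp: block_def chi_simp split: if_splits)
qed

lemma chi_split:
  assumes "\<And>\<omega>. \<omega> \<in> X \<Longrightarrow> \<omega> 0 \<notin> S0 \<Longrightarrow> g \<omega> = 0" "g \<in> W"
  shows "g \<omega> = chi X U \<omega> * g \<omega> + chi X V \<omega> * g \<omega>"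
  using assms(1)[of \<omega>] FbD(1)[OF assms(2), of \<omega>] V by (auto simp: chi_simp)

lemma T_chi_split:
  assumes "\<And>\<omega>. \<omega> \<in> X \<Longrightarrow> \<omega> 0 \<notin> S0 \<Longrightarrow> g \<omega> = 0" "g \<in> W"
  shows "chi X B \<omega> * T g \<omega> = TT B U g \<omega> + TT B V g \<omega>"
proof -
  have "T g \<omega> = T (\<lambda>\<omega>. chi X U \<omega> * g \<omega> + chi X V \<omega> * g \<omega>) \<omega>"
    using T_cong[of g] chi_split[OF assms] by metis
  also have "\<dots> = T (\<lambda>\<omega>. chi X U \<omega> * g \<omega>) \<omega> + T (\<lambda>\<omega>. chi X V \<omega> * g \<omega>) \<omega>"
    by (intro T_add bddX_W chi_mem assms(2))
  finally show ?thesis by (simp add: block_def algebra_simps)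
qed

text \<open>Schur complement: \<open>\<Lambda> - J\<close> arises from \<open>\<Lambda> - T\<close> by eliminating the \<open>V\<close>-component.\<close>

lemma schur_lift:
  assumes f: "f \<in> W" "\<And>\<omega>. chi X U \<omega> * f \<omega> = f \<omega>"
  defines "g \<equiv> \<lambda>\<omega>. f \<omega> + RV (TT V U f) \<omega>"
  shows "g \<in> W" "chi X U \<omega> * g \<omega> = f \<omega>"
    "of_real \<Lambda> * g \<omega> - T g \<omega> = of_real \<Lambda> * f \<omega> - J f \<omega>"
proof -
  define v where "v = RV (TT V U f)"
  have k: "TT V U f \<in> W" by (rule bop_mem[OF bop_TT f(1)])
  have vW: "v \<in> W" unfolding v_def by (rule bop_mem[OF is_resolventD(1)[OF RV] k])
  have chiV: "chi X V \<omega> * TT V U f \<omega> = TT V U f \<omega>" for \<omega> by (simp add: block_def chi_simp)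
  have v: "chi X V \<omega> * v \<omega> = v \<omega>" for \<omega> unfolding v_def by (rule RV_supported[OF k chiV])
  have v_eq: "of_real \<Lambda> * v \<omega> - TT V V v \<omega> = TT V U f \<omega>" for \<omega>
    using fun_cong[OF is_resolventD(3)[OF RV k], of \<omega>] by (simp add: scalar_minus_def v_def)
  have g: "g = (\<lambda>\<omega>. f \<omega> + v \<omega>)" by (simp add: g_def v_def)
  show gW: "g \<in> W" unfolding g by (rule add_mem[OF f(1) vW])
  have Uv: "chi X U \<omega> * v \<omega> = 0" for \<omega> using v[of \<omega>] V by (auto simp: chi_simp split: if_splits)
  have Vf: "chi X V \<omega> * f \<omega> = 0" for \<omega> using f(2)[of \<omega>] V by (auto simp: chi_simp split: if_splits)
  have Ug: "chi X U \<omega> * g \<omega> = f \<omega>" for \<omega> unfolding g distrib_left Uv f(2) by simp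
  have Vg: "chi X V \<omega> * g \<omega> = v \<omega>" for \<omega> unfolding g distrib_left Vf v by simp
  show "chi X U \<omega> * g \<omega> = f \<omega>" by (rule Ug)
  have out: "g \<omega> = 0" if "\<omega> 0 \<notin> S0" for \<omega>
    using f(2)[of \<omega>] v[of \<omega>] that U V by (auto simp: g chi_simp split: if_splits)
  have TU: "TT B U g = TT B U f" "TT B V g = TT B V v" for B
    unfolding block_def Ug Vg f(2) v by auto
  consider "\<omega> \<notin> X" | "\<omega> 0 \<notin> S0" | "\<omega> \<in> X" "\<omega> 0 \<in> U" | "\<omega> \<in> X" "\<omega> 0 \<in> V" using V by blast
  then show "of_real \<Lambda> * g \<omega> - T g \<omega> = of_real \<Lambda> * f \<omega> - J f \<omega>"
  proof cases
    case 1
    then show ?thesis using FbD(1)[OF gW] FbD(1)[OF f(1)] by (simp add: T_outside J_def block_def chi_simp)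
  next
    case 2
    then show ?thesis using 2 out[of \<omega>] f(2)[of \<omega>] U T_outside_S0[of \<omega> g]
      by (auto simp: J_def block_def chi_simp split: if_splits)
  next
    case 3
    then have "T g \<omega> = TT U U g \<omega> + TT U V g \<omega>"
      using T_chi_split[OF out gW, of U \<omega>] by (simp add: chi_simp)
    then have "T g \<omega> = J f \<omega>" by (simp add: TU J_def v_def)
    moreover have "g \<omega> = f \<omega>" using Ug[of \<omega>] 3 by (simp add: chi_simp)
    ultimately show ?thesis by simp
  next
    case 4
    then have "T g \<omega> = TT V U g \<omega> + TT V V g \<omega>"
      using T_chi_split[OF out gW, of V \<omega>] by (simp add: chi_simp)
    moreover have "g \<omega> = v \<omega>" using Vg[of \<omega>] 4 by (simp add: chi_simp)
    moreover have "f \<omega> = 0" using Vf[of \<omega>] 4 by (simp add: chi_simp)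
    moreover have "\<omega> 0 \<notin> U" using 4 V by blast
    then have "J f \<omega> = 0" by (simp add: J_def block_def chi_simp)
    ultimately show ?thesis using v_eq[of \<omega>] by (simp add: TU diff_eq_eq)
  qed
qed

text \<open>The converse of the lift: over \<open>V\<close> the equation determines the
  \<open>V\<close>-part of \<open>g\<close> as \<open>RV\<close> of the coupling term, so
  \<open>g\<close> is the lift of its own \<open>U\<close>-part.\<close>

lemma schur_restrict:
  assumes g: "g \<in> W" and k: "\<And>\<omega>. of_real \<Lambda> * g \<omega> - T g \<omega> = k \<omega>" "\<And>\<omega>. chi X U \<omega> * k \<omega> = k \<omega>"
  shows "of_real \<Lambda> * (chi X U \<omega> * g \<omega>) - J g \<omega> = k \<omega>"
proof -
  have out: "g \<omega> = 0" if "\<omega> 0 \<notin> S0" for \<omega>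
    using k(1)[of \<omega>] k(2)[of \<omega>] T_outside_S0[of \<omega> g] growth_rate_pos that U
    by (auto simp: chi_simp split: if_splits)
  define f where "f = (\<lambda>\<omega>. chi X U \<omega> * g \<omega>)"
  define v where "v = (\<lambda>\<omega>. chi X V \<omega> * g \<omega>)"
  have fW: "f \<in> W" and vW: "v \<in> W" unfolding f_def v_def by (rule chi_mem[OF g])+
  have ff: "chi X U \<omega> * f \<omega> = f \<omega>" for \<omega> by (simp add: f_def chi_simp)
  have "scalar_minus (of_real \<Lambda>) (TT V V) v = TT V U f"
  proof
    fix \<omega>
    have "chi X V \<omega> * k \<omega> = 0" using k(2)[of \<omega>] V by (auto simp: chi_simp split: if_splits)
    then have "chi X V \<omega> * (of_real \<Lambda> * g \<omega>) = chi X V \<omega> * T g \<omega>"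
      using k(1)[of \<omega>] by (auto simp: chi_simp)
    then have "of_real \<Lambda> * v \<omega> = TT V U g \<omega> + TT V V g \<omega>"
      using T_chi_split[OF out g, of V \<omega>] by (simp add: v_def algebra_simps)
    then show "scalar_minus (of_real \<Lambda>) (TT V V) v \<omega> = TT V U f \<omega>"
      unfolding scalar_minus_def v_def f_def block_chi by (simp add: v_def)
  qed
  then have "RV (TT V U f) = v" using is_resolventD(2)[OF RV vW] by simp
  then have "f \<omega> + RV (TT V U f) \<omega> = g \<omega>" for \<omega>
    using chi_split[OF out g] by (simp add: f_def v_def)
  then have "of_real \<Lambda> * f \<omega> - J f \<omega> = k \<omega>"
    using schur_lift(3)[OF fW ff, of \<omega>] k(1)[of \<omega>] by simp
  then show ?thesis unfolding f_def J_chi .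
qed

text \<open>The equation \<open>(\<Lambda> - T) h = 0\<close>, restricted to
  \<open>U\<close>.\<close>

lemma J_u: "J u = (\<lambda>\<omega>. of_real \<Lambda> * u \<omega>)"
proof
  fix \<omega>
  have "of_real \<Lambda> * (chi X U \<omega> * of_real (h \<omega>)) - J (\<lambda>\<omega>. of_real (h \<omega>)) \<omega> = 0"
    by (rule schur_restrict[OF h_mem]) (simp_all add: T_of_real[OF bddX_h] T_h)
  then show "J u \<omega> = of_real \<Lambda> * u \<omega>" unfolding u_def J_chi by simp
qed

lemma J_supported: "chi X U \<omega> * J f \<omega> = J f \<omega>"
  by (simp add: J_def block_def chi_simp)

lemma u_supported: "chi X U \<omega> * u \<omega> = u \<omega>"
  by (simp add: u_def chi_simp)

text \<open>Admitting \<open>c * u\<close> on the right covers one step down the generalized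
  eigenspace. For the lift to \<open>T\<close>, \<open>no_jordan_chain\<close> gives
  \<open>c = 0\<close>, so the lift is a multiple of \<open>h\<close> and its \<open>U\<close>-part
  a multiple of \<open>u\<close>.\<close>

lemma kernel_J:
  assumes f: "f \<in> W" and eq: "\<And>\<omega>. of_real \<Lambda> * f \<omega> - J f \<omega> = c * u \<omega>"
  shows "\<exists>b. f = (\<lambda>\<omega>. b * u \<omega>)"
proof -
  have supp: "chi X U \<omega> * f \<omega> = f \<omega>" for \<omega>
    using eq[of \<omega>] J_supported[of \<omega> f] u_supported[of \<omega>] growth_rate_pos
    by (auto simp: chi_simp split: if_splits)
  define g where "g = (\<lambda>\<omega>. f \<omega> + RV (TT V U f) \<omega>)"
  note g = schur_lift(1)[OF f supp, folded g_def]
  have Ug: "chi X U \<omega> * g \<omega> = f \<omega>" for \<omega> using schur_lift(2)[OF f supp, of \<omega>] by (simp add: g_def)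
  have eq': "of_real \<Lambda> * g \<omega> - T g \<omega> = c * u \<omega>" for \<omega>
    using schur_lift(3)[OF f supp, of \<omega>] eq[of \<omega>] by (simp add: g_def)
  have "c = 0"
    by (rule no_jordan_chain[OF g _ _ _ w(1), where u = "\<lambda>\<omega>. if \<omega> \<in> X \<and> \<omega> 0 \<in> U then h \<omega> else 0"])
       (use w u_w h_nonneg eq' u_real in auto)
  then have "T g \<omega> = of_real \<Lambda> * g \<omega>" for \<omega> using eq'[of \<omega>] by simp
  from eigenfunction_unique[OF g this] obtain b where b: "g = (\<lambda>\<omega>. b * of_real (h \<omega>))" by blast
  have "f \<omega> = b * u \<omega>" for \<omega> using Ug[of \<omega>] by (simp add: b u_def algebra_simps)
  then show ?thesis by blast
qed

section \<open>Simplicity and isolation of the eigenvalue\<close>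

lemma simple_eigenvalue_J: "simple_eigenvalue W J (of_real \<Lambda>)"
proof -
  note bS = bop_scalar_minus[OF bop_J]
  have gen: "\<exists>c. f = (\<lambda>\<omega>. c * u \<omega>)"
    if "f \<in> W" "(scalar_minus (of_real \<Lambda>) J ^^ n) f = (\<lambda>_. 0)" for f n
    using that
  proof (induction n arbitrary: f)
    case 0
    then show ?case by (intro exI[of _ 0]) simp
  next
    case (Suc n)
    have "(scalar_minus (of_real \<Lambda>) J ^^ n) (scalar_minus (of_real \<Lambda>) J f) = (\<lambda>_. 0)"
      using Suc.prems(2) by (simp only: funpow_Suc_right o_apply)
    from Suc.IH[OF bop_mem[OF bS Suc.prems(1)] this]
    obtain c where c: "scalar_minus (of_real \<Lambda>) J f = (\<lambda>\<omega>. c * u \<omega>)" by blast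
    show ?case
      by (rule kernel_J[OF Suc.prems(1), of c]) (use fun_cong[OF c] in \<open>simp add: scalar_minus_def\<close>)
  qed
  have "generalized_eigenspace W J (of_real \<Lambda>) = {(\<lambda>x. c * u x) |c. True}"
  proof (intro equalityI subsetI)
    fix f assume "f \<in> generalized_eigenspace W J (of_real \<Lambda>)"
    then show "f \<in> {(\<lambda>x. c * u x) |c. True}" using gen by (auto simp: generalized_eigenspace_def)
  next
    fix f assume "f \<in> {(\<lambda>x. c * u x) |c. True}"
    then obtain c where f: "f = (\<lambda>x. c * u x)" by blast
    have "(scalar_minus (of_real \<Lambda>) J ^^ 1) f = (\<lambda>_. 0)"
      by (simp add: scalar_minus_def f bop_scale[OF bop_J u_mem] J_u algebra_simps)
    then show "f \<in> generalized_eigenspace W J (of_real \<Lambda>)"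
      unfolding generalized_eigenspace_def using scale_mem[OF u_mem] f by blast
  qed
  moreover have "u \<noteq> (\<lambda>_. 0)" using u_w by (metis less_irrefl of_real_eq_0_iff)
  ultimately show ?thesis
    unfolding simple_eigenvalue_def using u_mem J_u by blast
qed

text \<open>On functions vanishing over \<open>U\<close> both \<open>J\<close> and evaluation at
  \<open>w\<close> are zero, so the inverse divides by \<open>\<Lambda>\<close>. On the
  \<open>U\<close>-part it is the compression of \<open>RB\<close>: as \<open>w\<close> starts in
  \<open>U\<close> and \<open>u\<close> lives over \<open>U\<close>, the rank-one term is untouched
  by the elimination of \<open>V\<close>.\<close>

lemma resolvent_J_rank_one: "\<exists>R. is_resolvent (\<lambda>f x. J f x - f w * u x) (of_real \<Lambda>) R"
proof -
  note \<Lambda> = growth_rate_pos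
  let ?B = "\<lambda>f x. T f x - f w * u x"
  let ?C = "\<lambda>f x. J f x - f w * u x"
  define cU where "cU f = (\<lambda>\<omega>. chi X U \<omega> * f \<omega>)" for f :: "(nat \<Rightarrow> 's) \<Rightarrow> complex"
  define R where "R k = (\<lambda>\<omega>. cU (RB (cU k)) \<omega> + of_real (1 / \<Lambda>) * (k \<omega> - cU k \<omega>))" for k
  have bcU: "bop cU" using bop_chi[of U] by (simp add: cU_def[abs_def])
  have cUcU: "cU (cU f) = cU f" for f by (simp add: cU_def chi_simp fun_eq_iff)
  have cUw: "cU f w = f w" for f using w by (simp add: cU_def chi_simp)
  have J_cU: "J (cU f) = J f" for f unfolding cU_def by (rule J_chi)
  note bRB = is_resolventD(1)[OF RB]
  have bR: "bop R"
    unfolding R_def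
    by (intro bop_plus bop_comp[OF bcU bop_comp[OF bRB bcU]] bop_cmult bop_minus bop_id bcU)
  have 1: "scalar_minus (of_real \<Lambda>) ?C (R k) = k" if k: "k \<in> W" for k
  proof
    fix \<omega>
    define g where "g = RB (cU k)"
    have kU: "cU k \<in> W" by (rule bop_mem[OF bcU k])
    have gW: "g \<in> W" unfolding g_def by (rule bop_mem[OF bRB kU])
    have "of_real \<Lambda> * g \<omega> - T g \<omega> = cU k \<omega> - g w * u \<omega>" for \<omega>
      using fun_cong[OF is_resolventD(3)[OF RB kU], of \<omega>]
      by (simp add: scalar_minus_def g_def algebra_simps)
    then have "of_real \<Lambda> * (chi X U \<omega> * g \<omega>) - J g \<omega> = cU k \<omega> - g w * u \<omega>"
      by (rule schur_restrict[OF gW]) (simp add: cU_def u_def chi_simp)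
    then have e: "of_real \<Lambda> * cU g \<omega> - J g \<omega> + g w * u \<omega> = cU k \<omega>" by (simp add: cU_def)
    have RU: "cU (R k) = cU g" by (simp add: R_def g_def cU_def chi_simp fun_eq_iff)
    have JR: "J (R k) = J g" using J_cU[of "R k"] J_cU[of g] by (simp add: RU)
    have Rw: "R k w = g w" using cUw[of "R k"] cUw[of g] by (simp add: RU)
    have \<Lambda>R: "of_real \<Lambda> * R k \<omega> = of_real \<Lambda> * cU g \<omega> + (k \<omega> - cU k \<omega>)"
    proof -
      have "complex_of_real \<Lambda> * (of_real (1 / \<Lambda>) * y) = y" for y using \<Lambda> by simp
      then show ?thesis unfolding R_def g_def distrib_left by simp
    qed
    have "scalar_minus (of_real \<Lambda>) ?C (R k) \<omega> =
        (of_real \<Lambda> * cU g \<omega> - J g \<omega> + g w * u \<omega>) + (k \<omega> - cU k \<omega>)"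
      unfolding scalar_minus_def JR Rw \<Lambda>R by simp
    then show "scalar_minus (of_real \<Lambda>) ?C (R k) \<omega> = k \<omega>" unfolding e by simp
  qed
  have 2: "R (scalar_minus (of_real \<Lambda>) ?C f) = f" if f: "f \<in> W" for f
  proof
    fix \<omega>
    define k where "k = scalar_minus (of_real \<Lambda>) ?C f"
    have fU: "cU f \<in> W" by (rule bop_mem[OF bcU f])
    have supp: "chi X U \<omega> * cU f \<omega> = cU f \<omega>" for \<omega> by (simp add: cU_def chi_simp)
    define g where "g = (\<lambda>\<omega>. cU f \<omega> + RV (TT V U (cU f)) \<omega>)"
    note g1 = schur_lift(1)[OF fU supp, folded g_def]
    have g2: "chi X U \<omega> * g \<omega> = cU f \<omega>" for \<omega>
      using schur_lift(2)[OF fU supp, of \<omega>] by (simp add: g_def)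
    have g3: "of_real \<Lambda> * g \<omega> - T g \<omega> = of_real \<Lambda> * cU f \<omega> - J (cU f) \<omega>" for \<omega>
      using schur_lift(3)[OF fU supp, of \<omega>] by (simp add: g_def)
    have gw: "g w = f w" using g2[of w] w by (simp add: cU_def chi_simp)
    have kU: "cU k \<omega> = of_real \<Lambda> * cU f \<omega> - J f \<omega> + f w * u \<omega>" for \<omega>
      using J_supported[of \<omega> f] u_supported[of \<omega>]
      by (auto simp: cU_def k_def scalar_minus_def algebra_simps)
    have "scalar_minus (of_real \<Lambda>) ?B g = cU k"
    proof
      fix \<omega>
      show "scalar_minus (of_real \<Lambda>) ?B g \<omega> = cU k \<omega>"
        using g3[of \<omega>] unfolding kU gw[symmetric] J_cU scalar_minus_def by (simp add: algebra_simps)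
    qed
    then have "RB (cU k) = g" using is_resolventD(2)[OF RB g1] by simp
    moreover have "cU g = cU f" using g2 by (simp add: cU_def fun_eq_iff)
    moreover have "k \<omega> - cU k \<omega> = of_real \<Lambda> * (f \<omega> - cU f \<omega>)"
    proof -
      have "k \<omega> = of_real \<Lambda> * f \<omega> - J f \<omega> + f w * u \<omega>" by (simp add: k_def scalar_minus_def)
      then show ?thesis unfolding kU by (simp add: algebra_simps)
    qed
    ultimately show "R (scalar_minus (of_real \<Lambda>) ?C f) \<omega> = f \<omega>"
      unfolding k_def[symmetric] using \<Lambda> by (simp add: R_def)
  qed
  show ?thesis unfolding is_resolvent_def using bR 1 2 by blast
qed

text \<open>The rank-one term is removed again by Sherman-Morrison, now with \<open>- u\<close>.
  Since \<open>u\<close> is an eigenvector of \<open>J\<close>, the denominator is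
  \<open>(z - \<Lambda>) / (z - \<Lambda> + u w)\<close>, which vanishes only at
  \<open>z = \<Lambda>\<close>.\<close>

lemma isolated_J: "of_real \<Lambda> isolated_in spectrum W N J"
proof -
  let ?C = "\<lambda>f x. J f x - f w * u x"
  have bC: "bop ?C" by (rule bop_minus[OF bop_J bop_rank_one[OF u_mem]])
  obtain R where R: "is_resolvent ?C (of_real \<Lambda>) R" using resolvent_J_rank_one by blast
  obtain C where C: "0 < C" "\<And>f. f \<in> W \<Longrightarrow> N (R f) \<le> C * N f"
    using bop_bound[OF is_resolventD(1)[OF R]] by blast
  \<comment> \<open>The bound \<open>1 / C\<close> keeps
    \<open>z - J + u \<otimes> \<delta>\<^sub>w\<close> invertible; the bound \<open>h w\<close>
    keeps \<open>z\<close> away from \<open>\<Lambda> - h w\<close>, where \<open>a\<close> would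
    vanish.\<close>
  define \<delta> where "\<delta> = min (1 / C) (h w)"
  have \<delta>: "0 < \<delta>" using C(1) u_w(2) by (simp add: \<delta>_def)
  have off: "z \<in> resolvent_set W N J" if z: "cmod (z - of_real \<Lambda>) < \<delta>" "z \<noteq> of_real \<Lambda>" for z
  proof -
    have "cmod (z - of_real \<Lambda>) * C < 1" using z(1) C(1) by (simp add: \<delta>_def field_simps)
    then obtain R' where R': "is_resolvent ?C z R'"
      using resolvent_perturb[OF bC R C(2) less_imp_le[OF C(1)]] by blast
    define a where "a = z - of_real \<Lambda> + u w"
    have a: "a \<noteq> 0"
    proof
      assume "a = 0"
      then have "z - of_real \<Lambda> = - of_real (h w)" by (simp add: a_def u_w(1) add_eq_0_iff2)
      then have "cmod (z - of_real \<Lambda>) = h w" using u_w(2) by simp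
      then show False using z(1) by (simp add: \<delta>_def)
    qed
    have m: "(\<lambda>x. - (1 / a) * u x) \<in> W" by (rule scale_mem[OF u_mem])
    have "scalar_minus z ?C (\<lambda>x. - (1 / a) * u x) = (\<lambda>x. - u x)"
    proof
      fix x
      define b where "b = 1 / a"
      have "scalar_minus z ?C (\<lambda>x. - b * u x) x = - (b * a) * u x"
        unfolding scalar_minus_def bop_scale[OF bop_J u_mem] J_u a_def by (simp add: algebra_simps)
      then show "scalar_minus z ?C (\<lambda>x. - (1 / a) * u x) x = - u x"
        using a by (simp add: b_def)
    qed
    then have "R' (\<lambda>x. - u x) = (\<lambda>x. - (1 / a) * u x)" using is_resolventD(2)[OF R' m] by simp
    then have "1 + R' (\<lambda>x. - u x) w = (z - of_real \<Lambda>) / a"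
      using a by (simp add: field_simps a_def)
    then have "1 + R' (\<lambda>x. - u x) w \<noteq> 0" using a z(2) by simp
    from resolvent_rank_one[OF bC R' minus_mem[OF u_mem] this]
    have "\<exists>R. is_resolvent (\<lambda>f x. ?C f x - f w * - u x) z R" .
    then show ?thesis unfolding resolvent_set_iff by simp
  qed
  have "of_real \<Lambda> \<notin> resolvent_set W N J"
  proof
    assume "of_real \<Lambda> \<in> resolvent_set W N J"
    then obtain R where R: "is_resolvent J (of_real \<Lambda>) R" unfolding resolvent_set_iff by blast
    have "scalar_minus (of_real \<Lambda>) J u = (\<lambda>_. 0)" by (simp add: scalar_minus_def J_u)
    then have "u = (\<lambda>_. 0)"
      using is_resolventD(2)[OF R u_mem] bop_zero[OF is_resolventD(1)[OF R]] by simp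
    then show False using u_w by (simp add: fun_eq_iff)
  qed
  then have "ball (of_real \<Lambda>) \<delta> \<inter> spectrum W N J = {of_real \<Lambda>}"
    using off \<delta> unfolding spectrum_def by (fastforce simp: dist_norm norm_minus_commute)
  then show ?thesis unfolding isolated_in_def by (metis IntE insertI1 open_ball)
qed

section \<open>Passage to the operators of the statement\<close>

lemma is_resolvent_cong:
  assumes "is_resolvent L z R" "\<And>f. f \<in> W \<Longrightarrow> L' f = L f"
  shows "is_resolvent L' z R"
  using assms bop_mem[OF is_resolventD(1)[OF assms(1)]]
  by (auto simp: is_resolvent_def scalar_minus_def)

lemma spectrum_cong:
  assumes "\<And>f. f \<in> W \<Longrightarrow> L' f = L f"
  shows "spectrum W N L' = spectrum W N L"
  unfolding spectrum_def set_eq_iff Compl_iff resolvent_set_iff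
  using is_resolvent_cong[of L _ _ L'] is_resolvent_cong[of L' _ _ L] assms by metis

lemma simple_eigenvalue_cong:
  assumes eq: "\<And>f. f \<in> W \<Longrightarrow> L' f = L f" and L: "bop L"
  shows "simple_eigenvalue W L' z = simple_eigenvalue W L z"
proof -
  have "(scalar_minus z L' ^^ n) f = (scalar_minus z L ^^ n) f" if "f \<in> W" for f n
    by (induction n) (simp_all add: scalar_minus_def[of z L'] scalar_minus_def[of z L]
        eq bop_funpow_mem[OF bop_scalar_minus[OF L] that, unfolded scalar_minus_def])
  then have "generalized_eigenspace W L' z = generalized_eigenspace W L z"
    by (auto simp: generalized_eigenspace_def)
  then show ?thesis unfolding simple_eigenvalue_def by (intro bex_cong refl) (simp add: eq)
qed

text \<open>The eigenfunction \<open>h\<close> puts \<open>\<Lambda>\<close> into the spectrum and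
  \<open>resolvent_beyond\<close> excludes every larger modulus, so the supremum is
  attained.\<close>

lemma spectral_radius_T: "spectral_radius W N T = \<Lambda>"
  unfolding spectral_radius_def
proof (rule cSup_eq_maximum)
  have "of_real \<Lambda> \<notin> resolvent_set W N T"
  proof
    assume "of_real \<Lambda> \<in> resolvent_set W N T"
    then obtain R where R: "is_resolvent T (of_real \<Lambda>) R" unfolding resolvent_set_iff by blast
    have "scalar_minus (of_real \<Lambda>) T (\<lambda>\<omega>. of_real (h \<omega>)) = (\<lambda>_. 0)"
      by (simp add: scalar_minus_def T_of_real[OF bddX_h] T_h)
    then have "(\<lambda>\<omega>. complex_of_real (h \<omega>)) = (\<lambda>_. 0)"
      using is_resolventD(2)[OF R h_mem] bop_zero[OF is_resolventD(1)[OF R]] by simp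
    then show False using h_nonzero by (simp add: fun_eq_iff)
  qed
  then show "\<Lambda> \<in> cmod ` spectrum W N T"
    using growth_rate_pos by (intro image_eqI[of _ _ "of_real \<Lambda>"]) (auto simp: spectrum_def)
next
  fix r assume "r \<in> cmod ` spectrum W N T"
  then obtain z where z: "r = cmod z" "z \<notin> resolvent_set W N T" by (auto simp: spectrum_def)
  show "r \<le> \<Lambda>"
  proof (rule ccontr)
    assume "\<not> r \<le> \<Lambda>"
    then have r: "\<Lambda> < (\<Lambda> + r) / 2" "(\<Lambda> + r) / 2 < cmod z" using z(1) by auto
    have "\<exists>R. is_resolvent T z R"
      using resolvent_beyond(1)[OF grows_gt[OF r(1)] _ r(2)] r(1) growth_rate_pos by fastforce
    then show False using z(2) unfolding resolvent_set_iff by blast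
  qed
qed

lemma spectral_gap_induced:
  "spectral_gap W N (induced_operator W X T U V (of_real \<Lambda>)) (of_real \<Lambda>)"
  unfolding spectral_gap_def
  using simple_eigenvalue_J isolated_J simple_eigenvalue_cong[OF induced_eq_J bop_J]
    spectrum_cong[OF induced_eq_J] by simp

lemma bop_induced: "bop (induced_operator W X T U V (of_real \<Lambda>))"
  by (rule bop_cong[OF bop_J induced_eq_J])

end

theorem theorem2p8:
  fixes S S0 U V :: "'s set"
    and A M :: "'s \<Rightarrow> 's \<Rightarrow> nat"
    and \<phi> :: "(nat \<Rightarrow> 's) \<Rightarrow> real"
    and \<theta> lambda :: real
  defines "X \<equiv> markov_shift S A"
    and "W \<equiv> Fb \<theta> S A"
    and "N \<equiv> Fb_norm \<theta> S A"
    and "L \<equiv> transfer_operator S A S0 M \<phi>"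
  assumes theta: "0 < \<theta>" "\<theta> < 1"
    and S: "countable S"
    and A: "zero_one_matrix S A"
    and S0: "S0 \<subseteq> S"
    and M: "zero_one_matrix S0 M"
    and irr: "irreducible_matrix S0 M"
    and MA: "\<And>i j. i \<in> S0 \<Longrightarrow> j \<in> S0 \<Longrightarrow> M i j = 1 \<Longrightarrow> A i j = 1"
    and per: "\<exists>\<omega>\<in>markov_shift S0 M. periodic_point \<omega>"
    and phi_summable: "summable_potential S X \<phi>"
    and phi_lip: "lip_seminorm \<theta> X 2 \<phi> < \<infinity>"
    and U: "U \<noteq> {}" "U \<subseteq> S0" "U \<noteq> S0"
    and V: "V = S0 - U"
    and lam: "lambda = spectral_radius W N L"
  shows "bounded_operator W N L \<and>
         of_real lambda \<in> resolvent_set W N (block X L V V) \<and>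
         bounded_operator W N (induced_operator W X L U V (of_real lambda)) \<and>
         spectral_gap W N (induced_operator W X L U V (of_real lambda)) (of_real lambda)"
proof -
  interpret induced_transfer \<theta> S A S0 M \<phi> U V
    by unfold_locales (use theta S0 MA phi_summable phi_lip irr per U V in \<open>auto simp: X_def\<close>)
  have "lambda = growth_rate"
    unfolding lam W_def N_def L_def transfer_operator_eq by (rule spectral_radius_T)
  then show ?thesis
    unfolding W_def N_def L_def X_def transfer_operator_eq
    using bop_T resolvent_VV bop_induced spectral_gap_induced resolvent_set_iff by blast
qed

end
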